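(* There exists a universal constant $K'$ such that the following holds. Let $n\geq 1$, $A,B\geq 1$ and $d\geq 2$ be integers, let $M\ge 0$, and let $P_{ab}\in\mathbb{Z}[x_1,\dots,x_n]$ ($1\leq a\leq A$, $1\leq b\leq B$) be polynomials of degree at most $d$ in each variable and with coefficients bounded by $M$ in absolute value, such that $$E=\bigcup_{a=1}^A\bigcap_{b=1}^B\{x\in\mathbb{R}^n : P_{ab}(x)\leq 0\}$$ is nonempty and contained in $[0,1]^n$. Then there exists a binary $N$-player game whose payoffs at all pure strategy profiles are integers bounded (in absolute value) by $(nd(M+1))^{(nd)^{K'n}}$, with $N\leq 1+AB+K'n^2\log_2(nd)$, such that the projection of its set of Nash equilibria on the first $n$ coordinates (those of the first $n$ players) is precisely $E$.
   Context: A game is binary if it is a finite normal-form game in which each player has exactly two pure strategies. Nash equilibria are understood in mixed strategies. A mixed strategy of the $i$-th player is identified with the probability $x_i\in[0,1]$ that it assigns to the first of her two pure strategies, so the set of Nash equilibria of an $N$-player binary game is a subset of $[0,1]^N$. "Universal constant" means that $K'$ depends on none of $n,d,A,B,M$, nor on the polynomials. *)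

theory Defs
  imports Complex_Main "HOL-Library.FuncSet" "HOL-Library.Poly_Mapping"
begin

text \<open>Points of \<open>\<real>\<^sup>n\<close> are functions in \<^term>\<open>{..<n} \<rightarrow>\<^sub>E (UNIV :: real set)\<close>, so that
  the dimension can be quantified over; coordinates, players and pure strategies are
  numbered from 0.\<close>


subsection \<open>Integer polynomials in several variables\<close>

text \<open>A polynomial maps each monomial (an exponent vector of finite support) to its coefficient.\<close>

type_synonym int_mpoly = "(nat \<Rightarrow>\<^sub>0 nat) \<Rightarrow>\<^sub>0 int"

definition polys_in_vars :: "nat \<Rightarrow> int_mpoly set" where
  "polys_in_vars n = {P. \<forall>m \<in> Poly_Mapping.keys P. Poly_Mapping.keys m \<subseteq> {..<n}}"

definition degree_in :: "nat \<Rightarrow> int_mpoly \<Rightarrow> nat" where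
  "degree_in i P = Max (insert 0 ((\<lambda>m. Poly_Mapping.lookup m i) ` Poly_Mapping.keys P))"

definition eval_mpoly :: "int_mpoly \<Rightarrow> (nat \<Rightarrow> real) \<Rightarrow> real" where
  "eval_mpoly P x =
     (\<Sum>m \<in> Poly_Mapping.keys P. of_int (Poly_Mapping.lookup P m) *
        (\<Prod>i \<in> Poly_Mapping.keys m. x i ^ Poly_Mapping.lookup m i))"


subsection \<open>Finite normal-form games\<close>

text \<open>The pure strategies of player \<open>i\<close> are the numbers below \<open>num_strats G i\<close>.\<close>

record game =
  num_players :: nat
  num_strats :: "nat \<Rightarrow> nat"
  payoff :: "nat \<Rightarrow> (nat \<Rightarrow> nat) \<Rightarrow> real"

definition pure_profiles :: "game \<Rightarrow> (nat \<Rightarrow> nat) set" where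
  "pure_profiles G = (\<Pi>\<^sub>E i \<in> {..<num_players G}. {..<num_strats G i})"

definition mixed_strategy :: "game \<Rightarrow> nat \<Rightarrow> (nat \<Rightarrow> real) \<Rightarrow> bool" where
  "mixed_strategy G i \<tau> \<longleftrightarrow>
     (\<forall>k < num_strats G i. 0 \<le> \<tau> k) \<and> (\<Sum>k < num_strats G i. \<tau> k) = 1"

definition expected_payoff :: "game \<Rightarrow> nat \<Rightarrow> (nat \<Rightarrow> nat \<Rightarrow> real) \<Rightarrow> real" where
  "expected_payoff G i \<sigma> =
     (\<Sum>s \<in> pure_profiles G. (\<Prod>j < num_players G. \<sigma> j (s j)) * payoff G i s)"

definition nash_equilibrium :: "game \<Rightarrow> (nat \<Rightarrow> nat \<Rightarrow> real) \<Rightarrow> bool" where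
  "nash_equilibrium G \<sigma> \<longleftrightarrow>
     (\<forall>i < num_players G. mixed_strategy G i (\<sigma> i)) \<and>
     (\<forall>i < num_players G. \<forall>\<tau>. mixed_strategy G i \<tau> \<longrightarrow>
        expected_payoff G i (\<sigma>(i := \<tau>)) \<le> expected_payoff G i \<sigma>)"


subsection \<open>Binary games\<close>

definition binary_game :: "game \<Rightarrow> bool" where
  "binary_game G \<longleftrightarrow> (\<forall>i < num_players G. num_strats G i = 2)"

text \<open>The mixed profile in which player \<open>i\<close> plays her first pure strategy, which is
  numbered 0, with probability \<open>x i\<close>.\<close>

definition binary_profile :: "(nat \<Rightarrow> real) \<Rightarrow> nat \<Rightarrow> nat \<Rightarrow> real" where
  "binary_profile x i k = (if k = 0 then x i else 1 - x i)"

text \<open>The equilibria of a binary game with \<open>N\<close> players, as a subset of \<open>[0,1]\<^sup>N\<close>.\<close>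

definition binary_nash_set :: "game \<Rightarrow> (nat \<Rightarrow> real) set" where
  "binary_nash_set G =
     {x \<in> {..<num_players G} \<rightarrow>\<^sub>E {0..1}. nash_equilibrium G (binary_profile x)}"

end

theory Submission
  imports Defs "Jordan_Normal_Form.Char_Poly" "HOL-Analysis.Function_Topology"
begin

text \<open>A game can restrict a player to \<open>E\<close> only if it also knows a point \<open>p \<in> E\<close> to which the
  first \<open>n\<close> players are driven whenever they leave \<open>E\<close>. Such a point with coordinates algebraic of
  degree \<open>(nd)\<^bsup>O(n)\<^esup>\<close> and controlled height is a limit of critical points of
  \<open>\<Sum>\<^sub>b P\<^sub>b\<^sup>2 + \<zeta> \<Sum>\<^sub>i x\<^sub>i\<^sup>2\<^sup>D\<close> as \<open>\<zeta>\<close> tends to 0: the critical point equations express each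
  \<open>x\<^sub>i\<^sup>2\<^sup>D\<^sup>-\<^sup>1\<close> by monomials of lower total degree, so every coordinate is an eigenvalue of a matrix over
  \<open>\<int>[1/\<zeta>]\<close>, and the leading coefficient in \<open>1/\<zeta>\<close> of its characteristic polynomial vanishes at
  the limit. A root separation bound then isolates \<open>p\<^sub>j\<close> by a polynomial that changes sign only there.
  In the game, auxiliary players compute the powers \<open>x\<^sup>1, x\<^sup>2, x\<^sup>4, \<dots>\<close>, in which all these polynomials
  become multiaffine.\<close>


subsection \<open>Polynomials of eigenvalues\<close>

text \<open>The drive towards \<open>p\<close> cannot be a formula in \<open>p\<close>, since
  payoffs are integers and \<open>p\<close> is in general irrational. Each coordinate is therefore
  written as \<open>p j = (\<kappa> j + \<eta> j) / S j\<close> with integers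
  \<open>\<kappa> j\<close> and \<open>S j\<close>, and \<open>\<eta> j\<close> is found by a
  further player as the only sign change on [0,1] of an integer polynomial; the size of
  \<open>S j\<close> is the price of root separation. The drive is multiplied by a factor that
  vanishes once some index \<open>a\<close> has all its sign players at 0, so every point of
  \<open>E\<close> survives; where the factor is positive the players sit at \<open>p\<close>, which
  is harmless because \<open>p\<close> lies in \<open>E\<close>. Two features of the bounds shape
  the rest. Payoffs must not depend on \<open>A\<close> and \<open>B\<close>: a single nonempty
  piece serves to find \<open>p\<close>, and its constraints enter as a set, whose size is limited
  by the number of integer polynomials with the given degrees and coefficients. The number of
  players may grow only like n^2 log(nd): a polynomial of degree (nd)^O(n) is played through the O(n
  log(nd)) bits of its exponents, for each of the n coordinates.\<close>

definition l1 :: "('a::zero \<Rightarrow> real) \<Rightarrow> 'a poly \<Rightarrow> real" where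
  "l1 \<phi> p = (\<Sum>i\<le>degree p. \<phi> (coeff p i))"

text \<open>Kept abstract because the same estimates are needed on three rings: the integers,
  \<open>int poly\<close> and \<open>int poly poly\<close>. \<open>l1_seminorm\<close> carries the
  axioms from a coefficient ring to its polynomials.\<close>

locale ring_seminorm =
  fixes \<phi> :: "'a::comm_ring_1 \<Rightarrow> real"
  assumes zero [simp]: "\<phi> 0 = 0"
    and nonneg [simp]: "0 \<le> \<phi> a"
    and one_le: "\<phi> 1 \<le> 1"
    and add_le: "\<phi> (a + b) \<le> \<phi> a + \<phi> b"
    and mult_le: "\<phi> (a * b) \<le> \<phi> a * \<phi> b"
    and uminus [simp]: "\<phi> (- a) = \<phi> a"
begin

lemma l1_zero [simp]: "l1 \<phi> 0 = 0"
  by (simp add: l1_def)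

lemma l1_nonneg [simp]: "0 \<le> l1 \<phi> p"
  by (simp add: l1_def sum_nonneg)

lemma l1_pCons [simp]: "l1 \<phi> (pCons a p) = \<phi> a + l1 \<phi> p"
proof (cases "p = 0")
  case False
  then show ?thesis
    unfolding l1_def by (simp add: sum.atMost_Suc_shift del: sum.atMost_Suc)
qed (simp add: l1_def)

lemma coeff_le_l1: "\<phi> (coeff p i) \<le> l1 \<phi> p"
proof (cases "i \<le> degree p")
  case True
  then show ?thesis unfolding l1_def
    by (intro member_le_sum) auto
qed (simp add: coeff_eq_0)

lemma l1_add_le: "l1 \<phi> (p + q) \<le> l1 \<phi> p + l1 \<phi> q"
proof (induction p q rule: poly_induct2)
  case (pCons a p b q)
  then show ?case using add_le[of a b] by simp
qed simp

lemma l1_smult_le: "l1 \<phi> (Polynomial.smult a p) \<le> \<phi> a * l1 \<phi> p"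
proof (induction p)
  case (pCons b p)
  then show ?case using mult_le[of a b] by (simp add: distrib_left)
qed simp

lemma l1_mult_le: "l1 \<phi> (p * q) \<le> l1 \<phi> p * l1 \<phi> q"
proof (induction p)
  case (pCons a p)
  have "l1 \<phi> (pCons a p * q) \<le> l1 \<phi> (Polynomial.smult a q) + l1 \<phi> (p * q)"
    using l1_add_le[of "Polynomial.smult a q" "pCons 0 (p * q)"] by simp
  also have "\<dots> \<le> \<phi> a * l1 \<phi> q + l1 \<phi> p * l1 \<phi> q"
    using pCons.IH l1_smult_le[of a q] by linarith
  finally show ?case by (simp add: distrib_right)
qed simp

lemma l1_seminorm: "ring_seminorm (l1 \<phi>)"
proof
  show "l1 \<phi> (1 :: 'a poly) \<le> 1"
    using one_le by (simp add: one_pCons)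
  show "l1 \<phi> (- p) = l1 \<phi> p" for p
    by (simp add: l1_def)
qed (auto intro: l1_add_le l1_mult_le)

lemma sum_le: "\<phi> (sum f I) \<le> (\<Sum>i\<in>I. \<phi> (f i))"
proof (induction I rule: infinite_finite_induct)
  case (insert x F)
  then show ?case using add_le[of "f x" "sum f F"] by simp
qed auto

lemma prod_le: "\<phi> (prod f I) \<le> (\<Prod>i\<in>I. \<phi> (f i))"
proof (induction I rule: infinite_finite_induct)
  case (insert x F)
  then show ?case using mult_le[of "f x" "prod f F"]
    by simp (meson mult_left_mono nonneg order_trans)
qed (auto simp: one_le)

lemma pow_le: "\<phi> (a ^ k) \<le> \<phi> a ^ k"
proof (induction k)
  case (Suc k)
  then show ?case using mult_le[of a "a ^ k"]
    by simp (meson mult_left_mono nonneg order_trans)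
qed (auto simp: one_le)

text \<open>Leibniz formula: n! products of n entries each, and \<open>\<phi>\<close> does not see
  the signs.\<close>

lemma det_le:
  assumes A: "A \<in> carrier_mat n n" and h: "\<And>i j. i < n \<Longrightarrow> j < n \<Longrightarrow> \<phi> (A $$ (i, j)) \<le> h"
  shows "\<phi> (det A) \<le> fact n * h ^ n"
proof -
  have "\<phi> (det A) \<le> (\<Sum>p | p permutes {0..<n}. \<phi> (signof p * (\<Prod>i = 0..<n. A $$ (i, p i))))"
    unfolding det_def'[OF A] by (rule sum_le)
  also have "\<dots> \<le> (\<Sum>p | p permutes {0..<n}. h ^ n)"
  proof (rule sum_mono)
    fix p assume "p \<in> {p. p permutes {0..<n}}"
    then have p: "p permutes {0..<n}" by simp
    have "\<phi> (signof p * (\<Prod>i = 0..<n. A $$ (i, p i))) = \<phi> (\<Prod>i = 0..<n. A $$ (i, p i))"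
      by (cases p rule: sign_cases) auto
    also have "\<dots> \<le> (\<Prod>i = 0..<n. \<phi> (A $$ (i, p i)))"
      by (rule prod_le)
    also have "\<dots> \<le> (\<Prod>i = 0..<n. h)"
    proof (rule prod_mono, intro conjI)
      fix i assume i: "i \<in> {0..<n}"
      then have "p i < n" using permutes_in_image[OF p, of i] by simp
      then show "\<phi> (A $$ (i, p i)) \<le> h" using i by (intro h) auto
    qed simp
    finally show "\<phi> (signof p * (\<Prod>i = 0..<n. A $$ (i, p i))) \<le> h ^ n" by simp
  qed
  also have "\<dots> = fact n * h ^ n"
    by (simp add: card_permutations)
  finally show ?thesis .
qed

end

text \<open>Often called the length; the usual height takes the maximum instead. The sum is chosen
  because it is submultiplicative and bounds the values on [-1,1].\<close>

definition height :: "int poly \<Rightarrow> real" where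
  "height = l1 (\<lambda>c. real_of_int \<bar>c\<bar>)"

interpretation int_norm: ring_seminorm "\<lambda>c. real_of_int \<bar>c\<bar>"
  by standard (auto simp: abs_mult)

interpretation height: ring_seminorm height
  unfolding height_def by (rule int_norm.l1_seminorm)

interpretation height2: ring_seminorm "l1 height"
  by (rule height.l1_seminorm)

lemma map_poly_pCons_0:
  "f 0 = 0 \<Longrightarrow> map_poly f (pCons a p) = pCons (f a) (map_poly f p)"
  by (intro poly_eqI) (simp add: coeff_map_poly coeff_pCons split: nat.split)

section \<open>Evaluation at real points and polynomials with a parameter\<close>

definition rpoly :: "int poly \<Rightarrow> real \<Rightarrow> real" where
  "rpoly p x = poly (map_poly of_int p) x"

lemma rpoly_hom: "comm_ring_hom (\<lambda>p. rpoly p x)"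
  by standard (auto simp: rpoly_def hom_distribs)

interpretation rpoly: comm_ring_hom "\<lambda>p. rpoly p x" for x by (rule rpoly_hom)

lemma rpoly_pCons [simp]: "rpoly (pCons a p) x = of_int a + x * rpoly p x"
  by (simp add: rpoly_def map_poly_pCons_0)

text \<open>The outer variable is the parameter \<open>s\<close>, later the large inverse of the
  perturbation; the inner one is the eigenvalue. In this order the leading coefficient in
  \<open>s\<close> is an integer polynomial in the eigenvalue.\<close>

definition rpoly2 :: "int poly poly \<Rightarrow> real \<Rightarrow> real \<Rightarrow> real" where
  "rpoly2 F s x = poly (map_poly (\<lambda>p. rpoly p x) F) s"

lemma rpoly2_hom: "comm_ring_hom (\<lambda>F. rpoly2 F s x)"
proof -
  interpret map_poly_comm_ring_hom "\<lambda>p. rpoly p x" ..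
  show ?thesis by standard (auto simp: rpoly2_def hom_distribs)
qed

lemma rpoly2_pCons [simp]: "rpoly2 (pCons a p) s x = rpoly a x + s * rpoly2 p s x"
  by (simp add: rpoly2_def map_poly_pCons_0)

lemma rpoly2_0 [simp]: "rpoly2 0 s x = 0"
  by (simp add: rpoly2_def)


definition inner_degree_le :: "nat \<Rightarrow> int poly poly \<Rightarrow> bool" where
  "inner_degree_le d F \<longleftrightarrow> (\<forall>k. degree (coeff F k) \<le> d)"

lemma inner_degree_le_mult:
  assumes "inner_degree_le a F" "inner_degree_le b G"
  shows "inner_degree_le (a + b) (F * G)"
  unfolding inner_degree_le_def coeff_mult
proof (intro allI degree_sum_le)
  fix k i
  show "degree (coeff F i * coeff G (k - i)) \<le> a + b"
    using assms degree_mult_le[of "coeff F i" "coeff G (k - i)"]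
    unfolding inner_degree_le_def by (meson add_mono order_trans)
qed auto

lemma inner_degree_le_sum:
  "finite I \<Longrightarrow> (\<And>i. i \<in> I \<Longrightarrow> inner_degree_le d (f i)) \<Longrightarrow> inner_degree_le d (sum f I)"
  unfolding inner_degree_le_def coeff_sum by (auto intro!: degree_sum_le)

lemma inner_degree_le_prod:
  "finite I \<Longrightarrow> (\<And>i. i \<in> I \<Longrightarrow> inner_degree_le 1 (f i)) \<Longrightarrow> inner_degree_le (card I) (prod f I)"
proof (induction I rule: finite_induct)
  case empty
  then show ?case by (simp add: inner_degree_le_def one_pCons coeff_pCons split: nat.split)
next
  case (insert i I)
  then have "inner_degree_le (1 + card I) (f i * prod f I)"
    by (intro inner_degree_le_mult) auto
  then show ?case using insert by simp
qed

lemma inner_degree_le_det: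
  assumes A: "A \<in> carrier_mat n n"
    and d: "\<And>i j. i < n \<Longrightarrow> j < n \<Longrightarrow> inner_degree_le 1 (A $$ (i, j))"
  shows "inner_degree_le n (det A)"
  unfolding det_def'[OF A]
proof (rule inner_degree_le_sum)
  fix p assume "p \<in> {p. p permutes {0..<n}}"
  then have p: "p permutes {0..<n}" by simp
  have "inner_degree_le (card {0..<n}) (\<Prod>i = 0..<n. A $$ (i, p i))"
  proof (intro inner_degree_le_prod d)
    fix i assume "i \<in> {0..<n}"
    then show "i < n" "p i < n" using permutes_in_image[OF p, of i] by auto
  qed simp
  then show "inner_degree_le n (signof p * (\<Prod>i = 0..<n. A $$ (i, p i)))"
    by (cases p rule: sign_cases) (auto simp: inner_degree_le_def)
qed (simp add: finite_permutations)

definition const_coeffs :: "int poly \<Rightarrow> int poly poly" where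
  "const_coeffs p = map_poly (\<lambda>c. [:c:]) p"

lemma const_coeffs_pCons [simp]: "const_coeffs (pCons a p) = pCons [:a:] (const_coeffs p)"
  by (simp add: const_coeffs_def map_poly_pCons_0)

lemma const_coeffs_0 [simp]: "const_coeffs 0 = 0"
  by (simp add: const_coeffs_def)

lemma coeff_const_coeffs [simp]: "coeff (const_coeffs p) k = [:coeff p k:]"
  by (simp add: const_coeffs_def coeff_map_poly)

lemma height_pCons [simp]: "height (pCons a p) = real_of_int \<bar>a\<bar> + height p"
  using int_norm.l1_pCons[of a p] by (simp only: height_def)

lemma l1_height_const_coeffs [simp]: "l1 height (const_coeffs p) = height p"
  by (induction p) auto

lemma rpoly2_const_coeffs [simp]: "rpoly2 (const_coeffs p) s x = rpoly p s"
  by (induction p) auto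

text \<open>\<open>F\<close> is the determinant of z - C(s). The eigenvalue variable occurs only on
  the diagonal and to the first power, which gives the degree; \<open>det_le\<close> gives the size;
  and \<open>F\<close> vanishes at (s, z) because \<open>v\<close> lies in the kernel.\<close>

lemma eigenvalue_polynomial_nat:
  fixes C :: "nat \<Rightarrow> nat \<Rightarrow> int poly"
  assumes h: "\<And>i j. i < n \<Longrightarrow> j < n \<Longrightarrow> height (C i j) \<le> h"
  obtains F :: "int poly poly" where "coeff F 0 \<noteq> 0" "inner_degree_le n F"
    "l1 height F \<le> fact n * (1 + h) ^ n"
    "\<And>s z v. \<forall>i<n. z * v i = (\<Sum>j<n. rpoly (C i j) s * v j) \<Longrightarrow> \<exists>i<n. v i \<noteq> 0 \<Longrightarrow> rpoly2 F s z = 0"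
proof -
  define A where "A = mat n n (\<lambda>(i, j). (if i = j then [:[:0, 1:]:] else 0) - const_coeffs (C i j))"
  have A: "A \<in> carrier_mat n n" by (simp add: A_def)
  define B where "B = mat n n (\<lambda>(i, j). coeff (C i j) 0)"
  have B: "B \<in> carrier_mat n n" by (simp add: B_def)
  \<comment> \<open>Taking the coefficient at 0 means setting s = 0. The determinant becomes the
    characteristic polynomial of the integer matrix C(0), which is monic and hence nonzero.\<close>
  interpret c0: comm_ring_hom "\<lambda>F :: int poly poly. coeff F 0"
    by standard (auto simp: coeff_mult)
  have "coeff (det A) 0 = det (map_mat (\<lambda>F. coeff F 0) A)"
    by (simp add: c0.hom_det)
  also have "map_mat (\<lambda>F. coeff F 0) A = char_poly_matrix B"
    by (intro eq_matI) (auto simp: A_def B_def char_poly_matrix_def)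
  finally have c0: "coeff (det A) 0 = char_poly B"
    by (simp add: char_poly_def)
  have 1: "coeff (det A) 0 \<noteq> 0"
    using degree_monic_char_poly[OF B] unfolding c0 by (metis coeff_0 zero_neq_one)
  have 2: "inner_degree_le n (det A)"
    using A by (rule inner_degree_le_det)
      (auto simp: A_def inner_degree_le_def coeff_pCons intro!: degree_diff_le split: nat.split)
  have 3: "l1 height (det A) \<le> fact n * (1 + h) ^ n"
  proof (rule height2.det_le[OF A])
    fix i j assume ij: "i < n" "j < n"
    let ?d = "(if i = j then [:[:0, 1:]:] else 0) :: int poly poly"
    have "l1 height (A $$ (i, j)) \<le> l1 height ?d + l1 height (- const_coeffs (C i j))"
      using height2.add_le[of ?d "- const_coeffs (C i j)"] ij by (simp add: A_def)
    also have "\<dots> \<le> 1 + h"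
      using h[OF ij] unfolding height2.uminus by (intro add_mono) auto
    finally show "l1 height (A $$ (i, j)) \<le> 1 + h" .
  qed
  have 4: "rpoly2 (det A) s z = 0"
    if e: "\<forall>i<n. z * v i = (\<Sum>j<n. rpoly (C i j) s * v j)" and nz: "\<exists>i<n. v i \<noteq> 0" for s z v
  proof -
    interpret r2: comm_ring_hom "\<lambda>F. rpoly2 F s z" by (rule rpoly2_hom)
    let ?A = "map_mat (\<lambda>F. rpoly2 F s z) A"
    have A': "?A \<in> carrier_mat n n" using A by simp
    have "?A *\<^sub>v vec n v = 0\<^sub>v n"
    proof (rule eq_vecI)
      fix i assume "i < dim_vec (0\<^sub>v n :: real vec)"
      then have i: "i < n" by simp
      have "(?A *\<^sub>v vec n v) $ i = (\<Sum>j<n. ((if i = j then z else 0) - rpoly (C i j) s) * v j)"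
        using i A by (auto simp: A_def scalar_prod_def r2.hom_minus lessThan_atLeast0 intro!: sum.cong)
      also have "\<dots> = z * v i - (\<Sum>j<n. rpoly (C i j) s * v j)"
        using i by (simp add: left_diff_distrib sum_subtractf if_distrib[of "\<lambda>c. c * _"] cong: if_cong)
      finally show "(?A *\<^sub>v vec n v) $ i = 0\<^sub>v n $ i" using e i by simp
    qed (use A in simp)
    moreover have "vec n v \<noteq> 0\<^sub>v n"
      using nz by (metis index_vec index_zero_vec(1))
    ultimately have "det ?A = 0"
      unfolding det_0_iff_vec_prod_zero[OF A'] by (intro exI[of _ "vec n v"]) auto
    then show ?thesis by (simp add: r2.hom_det)
  qed
  show thesis using 1 2 3 4 by (rule that)
qed

lemma eigenvalue_polynomial:
  fixes C :: "'i \<Rightarrow> 'i \<Rightarrow> int poly"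
  assumes I: "finite I" and h: "\<And>i j. i \<in> I \<Longrightarrow> j \<in> I \<Longrightarrow> height (C i j) \<le> h"
  obtains F :: "int poly poly" where "coeff F 0 \<noteq> 0" "inner_degree_le (card I) F"
    "l1 height F \<le> fact (card I) * (1 + h) ^ card I"
    "\<forall>s z v. (\<forall>i\<in>I. z * v i = (\<Sum>j\<in>I. rpoly (C i j) s * v j)) \<longrightarrow> (\<exists>i\<in>I. v i \<noteq> 0) \<longrightarrow> rpoly2 F s z = 0"
proof -
  obtain e where e: "bij_betw e {..<card I} I"
    using ex_bij_betw_nat_finite[OF I] by (auto simp: lessThan_atLeast0)
  then have eI: "\<And>i. i < card I \<Longrightarrow> e i \<in> I" by (auto simp: bij_betw_def)
  have surj: "\<exists>k<card I. i = e k" if "i \<in> I" for i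
    using e that by (auto simp: bij_betw_def)
  obtain F where F: "coeff F 0 \<noteq> 0" "inner_degree_le (card I) F"
    "l1 height F \<le> fact (card I) * (1 + h) ^ card I"
    "\<And>s z v. \<forall>i<card I. z * v i = (\<Sum>j<card I. rpoly (C (e i) (e j)) s * v j)
       \<Longrightarrow> \<exists>i<card I. v i \<noteq> 0 \<Longrightarrow> rpoly2 F s z = 0"
    using eigenvalue_polynomial_nat[of "card I" "\<lambda>i j. C (e i) (e j)" h] h eI by blast
  show thesis
  proof (rule that[OF F(1-3)], intro allI impI)
    fix s z v
    assume 1: "\<forall>i\<in>I. z * v i = (\<Sum>j\<in>I. rpoly (C i j) s * v j)" and 2: "\<exists>i\<in>I. v i \<noteq> 0"
    show "rpoly2 F s z = 0"
    proof (rule F(4)[of z "\<lambda>i. v (e i)"])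
      show "\<forall>i<card I. z * v (e i) = (\<Sum>j<card I. rpoly (C (e i) (e j)) s * v (e j))"
        using 1 eI sum.reindex_bij_betw[OF e, of "\<lambda>j. rpoly (C i j) s * v j" for i] by auto
      show "\<exists>i<card I. v (e i) \<noteq> 0" using 2 surj by blast
    qed
  qed
qed


subsection \<open>Roots of integer polynomials\<close>

lemma rpoly_altdef: "rpoly p x = (\<Sum>i\<le>degree p. of_int (coeff p i) * x ^ i)"
  by (simp add: rpoly_def poly_altdef)

lemma height_altdef:
  assumes "degree p \<le> n"
  shows "height p = (\<Sum>i\<le>n. real_of_int \<bar>coeff p i\<bar>)"
  unfolding height_def l1_def using assms
  by (intro sum.mono_neutral_left) (auto simp: coeff_eq_0)

lemma rpoly2_altdef: "rpoly2 F s x = (\<Sum>i\<le>degree F. rpoly (coeff F i) x * s ^ i)"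
proof -
  have "rpoly2 F s x = (\<Sum>i\<le>degree F. coeff (map_poly (\<lambda>p. rpoly p x) F) i * s ^ i)"
    unfolding rpoly2_def using degree_map_poly_le[of "\<lambda>p. rpoly p x" F]
    by (subst poly_altdef, intro sum.mono_neutral_left) (auto simp: coeff_eq_0 coeff_map_poly intro!: le_degree)
  then show ?thesis by (simp add: coeff_map_poly)
qed

lemma abs_coeff_le_height: "real_of_int \<bar>coeff p i\<bar> \<le> height p"
  using int_norm.coeff_le_l1[of p i] by (simp only: height_def)

lemma height_smult_le: "height (Polynomial.smult c p) \<le> real_of_int \<bar>c\<bar> * height p"
  using int_norm.l1_smult_le[of c p] by (simp only: height_def)

lemma height_ge_1:
  assumes "p \<noteq> 0" shows "1 \<le> height p"
proof -
  have "1 \<le> \<bar>lead_coeff p\<bar>" using assms by (metis leading_coeff_0_iff zero_less_abs_iff int_one_le_iff_zero_less)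
  then have "1 \<le> real_of_int \<bar>lead_coeff p\<bar>" by linarith
  then show ?thesis using abs_coeff_le_height[of p "degree p"] by linarith
qed

lemma abs_rpoly_le_height: "\<bar>x\<bar> \<le> 1 \<Longrightarrow> \<bar>rpoly p x\<bar> \<le> height p"
proof (induction p)
  case (pCons a p)
  have "\<bar>x * rpoly p x\<bar> \<le> 1 * height p"
    unfolding abs_mult using pCons by (intro mult_mono) auto
  then show ?case using abs_triangle_ineq[of "real_of_int a" "x * rpoly p x"] by simp
qed simp

text \<open>After factors of the variable are removed, the constant term is a nonzero integer, so at
  least 1 in absolute value, and it equals -z times the value of the remaining polynomial.\<close>

lemma nonzero_root_lower_bound:
  assumes "rpoly f z = 0" "f \<noteq> 0" "z \<noteq> 0"
  shows "1 \<le> \<bar>z\<bar> * height f"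
proof (cases "\<bar>z\<bar> \<le> 1")
  case False
  then have "1 * 1 \<le> \<bar>z\<bar> * height f"
    using height_ge_1[OF assms(2)] by (intro mult_mono) auto
  then show ?thesis by simp
next
  case True
  show ?thesis using assms
  proof (induction f)
    case (pCons a p)
    show ?case
    proof (cases "a = 0")
      case True
      then show ?thesis using pCons by simp
    next
      case False
      have "1 \<le> \<bar>real_of_int a\<bar>" using False by linarith
      also have "\<bar>real_of_int a\<bar> = \<bar>z\<bar> * \<bar>rpoly p z\<bar>"
        using pCons.prems by (simp add: abs_mult[symmetric])
      also have "\<dots> \<le> \<bar>z\<bar> * height (pCons a p)"
        using abs_rpoly_le_height[OF True, of p] by (intro mult_left_mono) auto
      finally show ?thesis .
    qed
  qed simp
qed

text \<open>If \<open>p\<close> and \<open>q\<close> are roots of \<open>g\<close> with leading coefficient \<open>a\<close>, then \<open>a (p - q)\<close> is an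
  eigenvalue of the integer matrix \<open>C \<otimes> 1 - 1 \<otimes> C\<close>, where \<open>C\<close> is \<open>a\<close> times the companion matrix.\<close>

lemma root_separation:
  assumes g: "g \<noteq> 0" "height g \<le> h" "degree g \<le> L"
    and p: "rpoly g p = 0" and q: "rpoly g q = 0" and pq: "p \<noteq> q"
  shows "1 \<le> h * (fact (L^2) * (1 + 2 * h) ^ L^2) * \<bar>p - q\<bar>"
proof -
  define l where "l = degree g"
  define a where "a = lead_coeff g"
  have a: "a \<noteq> 0" using g by (simp add: a_def)
  have h1: "1 \<le> h" using height_ge_1[OF g(1)] g(2) by simp
  have l: "l > 0"
  proof (rule ccontr)
    assume "\<not> l > 0"
    then obtain c where "g = [:c:]" unfolding l_def by (metis degree_eq_zeroE gr0I)
    then show False using g p by simp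
  qed
  \<comment> \<open>Row i expresses a x x^i by the powers below l: a shift, except that the last row
    uses the equation \<open>rpoly g x = 0\<close>. The factor \<open>a\<close> keeps the entries
    integral.\<close>
  define c where "c i i' = (if Suc i < l then (if i' = Suc i then a else 0) else - coeff g i')" for i i'
  have c_le: "real_of_int \<bar>c i i'\<bar> \<le> h" for i i'
    using abs_coeff_le_height[of g i'] abs_coeff_le_height[of g "degree g"] g(2) h1
    unfolding c_def a_def by auto
  have c: "a * x * x ^ i = (\<Sum>i'<l. c i i' * x ^ i')" if "i < l" "rpoly g x = 0" for i and x :: real
  proof (cases "Suc i < l")
    case True
    then show ?thesis 
      by (simp add: c_def if_distrib[of real_of_int] if_distrib[of "\<lambda>c. c * _"] cong: if_cong)
  next
    case False
    have "0 = (\<Sum>i'\<le>l. of_int (coeff g i') * x ^ i')"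
      using that(2) by (simp add: rpoly_altdef l_def)
    also have "\<dots> = (\<Sum>i'<l. of_int (coeff g i') * x ^ i') + a * x ^ l"
      by (simp add: a_def l_def lessThan_Suc_atMost[symmetric])
    finally have "a * x ^ l = - (\<Sum>i'<l. of_int (coeff g i') * x ^ i')" by simp
    moreover have "l = Suc i" using False that(1) by simp
    ultimately show ?thesis using False by (simp add: c_def sum_negf)
  qed
  define I where "I = {..<l} \<times> {..<l}"
  define C where "C = (\<lambda>(i, j) (i', j').
    [:(if j = j' then c i i' else 0) - (if i = i' then c j j' else 0):])"
  have C: "height (C u v) \<le> 2 * h" for u v
  proof -
    obtain i j i' j' where uv: "u = (i, j)" "v = (i', j')" by (cases u, cases v)
    have "\<bar>real_of_int (c i i') - c j j'\<bar> \<le> 2 * h"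
      using c_le[of i i'] c_le[of j j'] by linarith
    then show ?thesis using c_le[of i i'] c_le[of j j'] h1 by (auto simp: C_def uv)
  qed
  have fin: "finite I" by (simp add: I_def)
  obtain F where F: "coeff F 0 \<noteq> 0" "inner_degree_le (card I) F"
    "l1 height F \<le> fact (card I) * (1 + 2 * h) ^ card I"
    "\<forall>s z v. (\<forall>i\<in>I. z * v i = (\<Sum>j\<in>I. rpoly (C i j) s * v j)) \<longrightarrow> (\<exists>i\<in>I. v i \<noteq> 0) \<longrightarrow> rpoly2 F s z = 0"
    by (rule eigenvalue_polynomial[where C = C and h = "2 * h", OF fin C])
  \<comment> \<open>The tensor product of the two eigenvectors of powers: the first summand of
    \<open>C\<close> acts on it by a p, the second by a q.\<close>
  define w where "w = (\<lambda>(i, j). p ^ i * q ^ j)"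
  \<comment> \<open>The entries of \<open>C\<close> are constants, so s = 0 may be taken, and
    \<open>coeff F 0\<close> is a nonzero integer polynomial with the root a (p - q).\<close>
  have "rpoly2 F 0 (a * (p - q)) = 0"
  proof (rule F(4)[rule_format, rotated])
    show "\<exists>i\<in>I. w i \<noteq> 0" using l by (intro bexI[of _ "(0, 0)"]) (auto simp: I_def w_def)
    show "a * (p - q) * w u = (\<Sum>v\<in>I. rpoly (C u v) 0 * w v)" if "u \<in> I" for u
    proof -
      from that obtain i j where u: "u = (i, j)" "i < l" "j < l" by (auto simp: I_def)
      have "(\<Sum>v\<in>I. rpoly (C u v) 0 * w v)
          = (\<Sum>i'<l. \<Sum>j'<l. (if j = j' then c i i' * (p ^ i' * q ^ j') else 0)
               - (if i = i' then c j j' * (p ^ i' * q ^ j') else 0))"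
        unfolding I_def sum.cartesian_product
        by (intro sum.cong) (auto simp: C_def u w_def left_diff_distrib)
      also have "\<dots> = (\<Sum>i'<l. c i i' * (p ^ i' * q ^ j)) - (\<Sum>j'<l. c j j' * (p ^ i * q ^ j'))"
        using u by (simp add: sum_subtractf)
          (subst sum.swap, simp add: if_distrib cong: if_cong)
      also have "\<dots> = (a * p * p ^ i) * q ^ j - p ^ i * (a * q * q ^ j)"
        unfolding c[OF u(2) p] c[OF u(3) q] sum_distrib_left sum_distrib_right
        by (intro arg_cong2[of _ _ _ _ "(-)"] sum.cong) auto
      finally show "a * (p - q) * w u = (\<Sum>v\<in>I. rpoly (C u v) 0 * w v)"
        by (simp add: u w_def algebra_simps)
    qed
  qed
  moreover have "rpoly2 F 0 x = rpoly (coeff F 0) x" for x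
    by (cases F) simp
  ultimately have "rpoly (coeff F 0) (a * (p - q)) = 0" by simp
  then have "1 \<le> \<bar>a * (p - q)\<bar> * height (coeff F 0)"
    using F(1) a pq by (intro nonzero_root_lower_bound) auto
  also have "\<dots> \<le> (h * \<bar>p - q\<bar>) * (fact (L^2) * (1 + 2 * h) ^ L^2)"
  proof (intro mult_mono)
    have "\<bar>real_of_int a\<bar> \<le> h"
      using abs_coeff_le_height[of g "degree g"] g(2) unfolding a_def by simp
    then show "\<bar>a * (p - q)\<bar> \<le> h * \<bar>p - q\<bar>"
      unfolding abs_mult by (intro mult_right_mono) auto
    have "card I \<le> L^2"
      using g(3) by (simp add: I_def l_def power2_eq_square mult_mono)
    then have "fact (card I) * (1 + 2 * h) ^ card I \<le> fact (L^2) * (1 + 2 * h) ^ L^2"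
      using h1 by (intro mult_mono power_increasing fact_mono) auto
    then show "height (coeff F 0) \<le> fact (L^2) * (1 + 2 * h) ^ L^2"
      using height.coeff_le_l1[of F 0] F(3) by linarith
  qed (use h1 in auto)
  finally show ?thesis by (simp add: mult_ac)
qed

section \<open>Isolating intervals with a single sign change\<close>

lemma height_pderiv_le:
  assumes "degree f \<le> Suc D"
  shows "height (pderiv f) \<le> real (Suc D) * height f"
proof -
  have "degree (pderiv f) \<le> D" using assms by (simp add: degree_pderiv)
  then have "height (pderiv f) = (\<Sum>i\<le>D. real (Suc i) * real_of_int \<bar>coeff f (Suc i)\<bar>)"
    by (simp add: height_altdef coeff_pderiv abs_mult del: of_nat_Suc)
  also have "\<dots> \<le> (\<Sum>i\<le>D. real (Suc D) * real_of_int \<bar>coeff f (Suc i)\<bar>)"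
    by (intro sum_mono mult_right_mono) auto
  also have "\<dots> \<le> real (Suc D) * height f"
    unfolding height_altdef[OF assms] sum_distrib_left[symmetric]
    by (intro mult_left_mono) (auto simp: sum.atMost_Suc_shift simp del: sum.atMost_Suc)
  finally show ?thesis .
qed

text \<open>Differentiate until \<open>p\<close> is a simple root; there are at most D steps, each
  costing a factor of at most D. At a multiple root the sign need not change.\<close>

lemma simple_root_derivative:
  assumes "f \<noteq> 0" "degree f \<le> D" "rpoly f p = 0"
  obtains g where "degree g \<le> D" "height g \<le> real D ^ D * height f"
    "rpoly g p = 0" "rpoly (pderiv g) p \<noteq> 0"
proof -
  have "\<exists>g. degree g \<le> D \<and> height g \<le> real D ^ D * height f \<and> rpoly g p = 0 \<and> rpoly (pderiv g) p \<noteq> 0"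
    using assms
  proof (induction D arbitrary: f)
    case 0
    then obtain c where "f = [:c:]" by (metis degree_eq_zeroE le_zero_eq)
    then show ?case using 0 by simp
  next
    case (Suc D)
    show ?case
    proof (cases "rpoly (pderiv f) p = 0")
      case False
      have "1 * height f \<le> real (Suc D) ^ Suc D * height f"
        by (intro mult_right_mono one_le_power) auto
      then show ?thesis using False Suc.prems by (intro exI[of _ f]) auto
    next
      case True
      have "pderiv f \<noteq> 0"
      proof
        assume "pderiv f = 0"
        then obtain c where "f = [:c:]" by (metis degree_eq_zeroE pderiv_eq_0_iff)
        then show False using Suc.prems by simp
      qed
      moreover have "degree (pderiv f) \<le> D" using Suc.prems by (simp add: degree_pderiv)
      ultimately obtain g where g: "degree g \<le> D" "height g \<le> real D ^ D * height (pderiv f)"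
        "rpoly g p = 0" "rpoly (pderiv g) p \<noteq> 0" using Suc.IH True by blast
      have "real D ^ D * height (pderiv f) \<le> real (Suc D) ^ D * (real (Suc D) * height f)"
        using height_pderiv_le[OF Suc.prems(2)] by (intro mult_mono power_mono) auto
      then have "height g \<le> real (Suc D) ^ Suc D * height f" using g(2) by (simp add: mult_ac)
      then show ?thesis using g le_SucI by blast
    qed
  qed
  then show thesis using that by blast
qed

lemma DERIV_rpoly: "DERIV (rpoly g) x :> rpoly (pderiv g) x"
proof -
  have "map_poly real_of_int (pderiv g) = pderiv (map_poly of_int g)"
    by (intro poly_eqI) (simp add: coeff_map_poly coeff_pderiv)
  then show ?thesis using poly_DERIV[of "map_poly real_of_int g" x]
    by (simp add: rpoly_def[abs_def])
qed

lemma isCont_rpoly [simp]: "isCont (rpoly g) x"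
  using DERIV_rpoly DERIV_isCont by blast

text \<open>The derivative fixes the sign right beside \<open>p\<close>; a wrong sign farther out
  would, by the intermediate value theorem, produce a second root within distance
  \<open>e\<close>.\<close>

lemma sign_near_isolated_simple_root:
  assumes p: "rpoly g p = 0" and d: "rpoly (pderiv g) p > 0"
    and sep: "\<And>q. rpoly g q = 0 \<Longrightarrow> q \<noteq> p \<Longrightarrow> e < \<bar>p - q\<bar>"
  shows "p < x \<Longrightarrow> x \<le> p + e \<Longrightarrow> rpoly g x > 0"
    and "x < p \<Longrightarrow> p - e \<le> x \<Longrightarrow> rpoly g x < 0"
proof -
  assume x: "p < x" "x \<le> p + e"
  obtain u where u: "u > 0" "\<And>h. h > 0 \<Longrightarrow> h < u \<Longrightarrow> rpoly g p < rpoly g (p + h)"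
    using DERIV_pos_inc_right[OF DERIV_rpoly d] by blast
  define h where "h = min (u / 2) (x - p)"
  have h: "h > 0" "h < u" "p + h \<le> x" using u x by (auto simp: h_def)
  then have pos: "rpoly g (p + h) > 0" using u(2)[of h] p by simp
  show "rpoly g x > 0"
  proof (rule ccontr)
    assume "\<not> rpoly g x > 0"
    then obtain q where q: "p + h \<le> q" "q \<le> x" "rpoly g q = 0"
      using IVT2[of "rpoly g" x 0 "p + h"] pos h by auto
    then show False using sep[of q] h x by auto
  qed
next
  assume x: "x < p" "p - e \<le> x"
  obtain u where u: "u > 0" "\<And>h. h > 0 \<Longrightarrow> h < u \<Longrightarrow> rpoly g (p - h) < rpoly g p"
    using DERIV_pos_inc_left[OF DERIV_rpoly d] by blast
  define h where "h = min (u / 2) (p - x)"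
  have h: "h > 0" "h < u" "x \<le> p - h" using u x by (auto simp: h_def)
  then have neg: "rpoly g (p - h) < 0" using u(2)[of h] p by simp
  show "rpoly g x < 0"
  proof (rule ccontr)
    assume "\<not> rpoly g x < 0"
    then obtain q where q: "x \<le> q" "q \<le> p - h" "rpoly g q = 0"
      using IVT2[of "rpoly g" "p - h" 0 x] neg h by auto
    then show False using sep[of q] h x by auto
  qed
qed

text \<open>Substitute x = (k + y) / S, which maps [0,1] onto an interval of length 1 / S, and clear
  denominators with S^L.\<close>

lemma rescaled_polynomial:
  assumes "degree g \<le> L" "k \<le> S" "S \<ge> 1"
  obtains r where "degree r \<le> L" "height r \<le> height g * real (Suc S) ^ L"
    "\<And>y. rpoly r y = real S ^ L * rpoly g ((real k + y) / real S)"
proof -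
  define r where "r = (\<Sum>i\<le>L. Polynomial.smult (coeff g i * int S ^ (L - i)) ([:int k, 1:] ^ i))"
  show thesis
  proof (rule that)
    show "degree r \<le> L" unfolding r_def
    proof (intro degree_sum_le)
      fix i assume "i \<in> {..L}"
      then show "degree (Polynomial.smult (coeff g i * int S ^ (L - i)) ([:int k, 1:] ^ i)) \<le> L"
        using degree_power_le[of "[:int k, 1:]" i] degree_smult_le[of "coeff g i * int S ^ (L - i)" "[:int k, 1:] ^ i"]
        by simp
    qed simp
    have "height r \<le> (\<Sum>i\<le>L. height (Polynomial.smult (coeff g i * int S ^ (L - i)) ([:int k, 1:] ^ i)))"
      unfolding r_def by (rule height.sum_le)
    also have "\<dots> \<le> (\<Sum>i\<le>L. real_of_int \<bar>coeff g i\<bar> * real (Suc S) ^ L)"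
    proof (rule sum_mono)
      fix i assume i: "i \<in> {..L}"
      have "height (Polynomial.smult (coeff g i * int S ^ (L - i)) ([:int k, 1:] ^ i))
          \<le> real_of_int \<bar>coeff g i * int S ^ (L - i)\<bar> * height [:int k, 1:] ^ i"
        by (rule order_trans[OF height_smult_le]) (intro mult_left_mono height.pow_le, simp)
      also have "\<dots> = real_of_int \<bar>coeff g i\<bar> * (real S ^ (L - i) * (real k + 1) ^ i)"
        by (simp add: abs_mult)
      also have "\<dots> \<le> real_of_int \<bar>coeff g i\<bar> * (real (Suc S) ^ (L - i) * real (Suc S) ^ i)"
        using assms by (intro mult_left_mono mult_mono power_mono) auto
      also have "\<dots> = real_of_int \<bar>coeff g i\<bar> * real (Suc S) ^ L"
        using i by (simp add: power_add[symmetric])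
      finally show "height (Polynomial.smult (coeff g i * int S ^ (L - i)) ([:int k, 1:] ^ i))
          \<le> real_of_int \<bar>coeff g i\<bar> * real (Suc S) ^ L" .
    qed
    also have "\<dots> = height g * real (Suc S) ^ L"
      using height_altdef[OF assms(1)] by (simp add: sum_distrib_right)
    finally show "height r \<le> height g * real (Suc S) ^ L" .
    fix y
    have "rpoly r y = (\<Sum>i\<le>L. of_int (coeff g i) * real S ^ (L - i) * (real k + y) ^ i)"
      unfolding r_def rpoly.hom_sum
    proof (rule sum.cong[OF refl])
      fix i
      have "Polynomial.smult c q = [:c:] * q" for c and q :: "int poly" by simp
      then show "rpoly (Polynomial.smult (coeff g i * int S ^ (L - i)) ([:int k, 1:] ^ i)) y
          = of_int (coeff g i) * real S ^ (L - i) * (real k + y) ^ i"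
        by (simp only: rpoly.hom_mult rpoly.hom_power) simp
    qed
    also have "\<dots> = (\<Sum>i\<le>L. real S ^ L * (of_int (coeff g i) * ((real k + y) / real S) ^ i))"
      using assms by (intro sum.cong) (auto simp: power_diff power_divide)
    also have "\<dots> = real S ^ L * rpoly g ((real k + y) / real S)"
      unfolding rpoly_altdef sum_distrib_left using assms(1)
      by (intro sum.mono_neutral_right) (auto simp: coeff_eq_0)
    finally show "rpoly r y = real S ^ L * rpoly g ((real k + y) / real S)" .
  qed
qed

lemma isolate_root:
  assumes f: "f \<noteq> 0" "degree f \<le> L" "height f \<le> h" "rpoly f p = 0" and p: "0 \<le> p" "p \<le> 1"
  defines "h4 \<equiv> real L ^ L * h"
  defines "h5 \<equiv> h4 * (fact (L^2) * (1 + 2 * h4) ^ L^2)"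
  obtains k S :: nat and r :: "int poly" and y :: real where "k \<le> S" "1 \<le> S" "real S \<le> h5 + 1"
    "0 \<le> y" "y \<le> 1" "real S * p = real k + y"
    "degree r \<le> L" "height r \<le> h4 * real (Suc S) ^ L" "rpoly r y = 0"
    "\<forall>z. 0 \<le> z \<longrightarrow> z < y \<longrightarrow> rpoly r z < 0" "\<forall>z. y < z \<longrightarrow> z \<le> 1 \<longrightarrow> rpoly r z > 0"
proof -
  obtain g0 where g0: "degree g0 \<le> L" "height g0 \<le> real L ^ L * height f"
    "rpoly g0 p = 0" "rpoly (pderiv g0) p \<noteq> 0"
    using simple_root_derivative[OF f(1,2,4)] .
  have h0: "height g0 \<le> h4"
    unfolding h4_def using f(3) by (intro order_trans[OF g0(2)] mult_left_mono) auto
  \<comment> \<open>The sign is normalised so that the polynomial increases through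
    \<open>p\<close>; a player rewarded with its negative is then pushed back to the root.\<close>
  define g where "g = (if rpoly (pderiv g0) p > 0 then g0 else - g0)"
  have g: "degree g \<le> L" "height g \<le> h4" "rpoly g p = 0" "rpoly (pderiv g) p > 0"
    using g0 h0 by (auto simp: g_def pderiv_minus rpoly.hom_uminus)
  then have gnz: "g \<noteq> 0" by auto
  have h4: "1 \<le> h4" using height_ge_1[OF gnz] g by simp
  have h5: "0 \<le> h5" using h4 unfolding h5_def by auto
  \<comment> \<open>\<open>h5\<close> is the reciprocal of the separation bound. Adding 1 after
    rounding down makes S strictly larger, so other roots are farther than 1 / S from
    \<open>p\<close>, endpoints of the interval included.\<close>
  define S where "S = nat \<lfloor>h5\<rfloor> + 1"
  have S: "1 \<le> S" "h5 < real S" "real S \<le> h5 + 1"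
    using h5 unfolding S_def by linarith+
  have sep: "1 / S < \<bar>p - q\<bar>" if "rpoly g q = 0" "q \<noteq> p" for q
  proof -
    have "1 \<le> h5 * \<bar>p - q\<bar>"
      unfolding h5_def using root_separation[OF gnz g(2,1,3) that(1)] that(2) by simp
    also have "\<dots> < real S * \<bar>p - q\<bar>"
      using S that by (intro mult_strict_right_mono) auto
    finally show ?thesis using S by (simp add: field_simps)
  qed
  \<comment> \<open>\<open>p\<close> lies in [k/S, (k+1)/S], and \<open>y\<close> is its relative
    position there; for p = 1 this gives k = S and y = 0.\<close>
  define k where "k = nat \<lfloor>real S * p\<rfloor>"
  define y where "y = real S * p - real k"
  have Sp: "0 \<le> real S * p" "real S * p \<le> real S" using p S by (auto simp: mult_left_le)
  have k: "k \<le> S" "0 \<le> y" "y \<le> 1" using Sp unfolding k_def y_def by linarith+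
  obtain r where r: "degree r \<le> L" "height r \<le> height g * real (Suc S) ^ L"
    "\<And>y. rpoly r y = real S ^ L * rpoly g ((real k + y) / real S)"
    using rescaled_polynomial[OF g(1) k(1) S(1)] by blast
  have Spos: "real S > 0" "real S ^ L > 0" using S by auto
  have p_eq: "p = (real k + y) / real S" using Spos by (simp add: y_def)
  show thesis
  proof (rule that[of k S y r])
    show "height r \<le> h4 * real (Suc S) ^ L"
      using g(2) by (intro order_trans[OF r(2)] mult_right_mono) auto
    show "rpoly r y = 0" using g(3) p_eq by (simp add: r(3))
    show "\<forall>z. 0 \<le> z \<longrightarrow> z < y \<longrightarrow> rpoly r z < 0"
    proof (intro allI impI)
      fix z assume z: "0 \<le> z" "z < y"
      have "rpoly g ((real k + z) / real S) < 0"
        using Spos z k by (intro sign_near_isolated_simple_root(2)[OF g(3,4) sep])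
          (auto simp: p_eq divide_simps)
      then show "rpoly r z < 0" unfolding r(3) using Spos by (simp add: mult_pos_neg)
    qed
    show "\<forall>z. y < z \<longrightarrow> z \<le> 1 \<longrightarrow> rpoly r z > 0"
    proof (intro allI impI)
      fix z assume z: "y < z" "z \<le> 1"
      have "rpoly g ((real k + z) / real S) > 0"
        using Spos z k by (intro sign_near_isolated_simple_root(1)[OF g(3,4) sep])
          (auto simp: p_eq divide_simps)
      then show "rpoly r z > 0" unfolding r(3) using Spos by simp
    qed
  qed (use k S r in \<open>auto simp: y_def\<close>)
qed

text \<open>Divide the equation by the top power of \<open>s k\<close>: every term but the leading
  one tends to 0, since the coefficients stay bounded along the convergent
  \<open>z k\<close>.\<close>

lemma lead_coeff_root_of_limit:
  assumes s: "filterlim s at_top sequentially" and z: "z \<longlonglongrightarrow> p"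
    and F: "\<And>k. rpoly2 F (s k) (z k) = 0"
  shows "rpoly (lead_coeff F) p = 0"
proof -
  define N where "N = degree F"
  have lim: "(\<lambda>k. \<Sum>i\<le>N. rpoly (coeff F i) (z k) * inverse (s k) ^ (N - i))
      \<longlonglongrightarrow> (\<Sum>i\<le>N. rpoly (coeff F i) p * 0 ^ (N - i))"
    by (intro tendsto_sum tendsto_mult tendsto_power isCont_tendsto_compose[OF isCont_rpoly z]
        tendsto_inverse_0_at_top[OF s])
  have "\<forall>\<^sub>F k in sequentially. s k > 0"
    using s by (simp add: filterlim_at_top_dense)
  then have "\<forall>\<^sub>F k in sequentially. (\<Sum>i\<le>N. rpoly (coeff F i) (z k) * inverse (s k) ^ (N - i)) = 0"
  proof eventually_elim
    case (elim k)
    have "(\<Sum>i\<le>N. rpoly (coeff F i) (z k) * inverse (s k) ^ (N - i))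
        = inverse (s k) ^ N * (\<Sum>i\<le>N. rpoly (coeff F i) (z k) * s k ^ i)"
      unfolding sum_distrib_left
    proof (intro sum.cong refl)
      fix i assume "i \<in> {..N}"
      then have "inverse (s k) ^ N = inverse (s k) ^ (N - i) * inverse (s k) ^ i"
        by (simp add: power_add[symmetric])
      then show "rpoly (coeff F i) (z k) * inverse (s k) ^ (N - i)
          = inverse (s k) ^ N * (rpoly (coeff F i) (z k) * s k ^ i)"
        using elim by (simp add: power_inverse field_simps)
    qed
    also have "\<dots> = 0" using F[of k] by (simp add: rpoly2_altdef N_def)
    finally show ?case .
  qed
  then have "(\<lambda>k. \<Sum>i\<le>N. rpoly (coeff F i) (z k) * inverse (s k) ^ (N - i)) \<longlonglongrightarrow> 0"
    by (simp add: tendsto_eventually)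
  then have "(\<Sum>i\<le>N. rpoly (coeff F i) p * 0 ^ (N - i)) = 0"
    using lim LIMSEQ_unique by blast
  moreover have "(\<Sum>i\<le>N. rpoly (coeff F i) p * 0 ^ (N - i)) = (\<Sum>i\<le>N. if i = N then rpoly (coeff F N) p else 0)"
    by (intro sum.cong) (auto simp: power_0_left)
  ultimately show ?thesis by (simp add: N_def)
qed


subsection \<open>Systems with pure power leading forms\<close>

definition monval :: "nat \<Rightarrow> (nat \<Rightarrow> nat) \<Rightarrow> (nat \<Rightarrow> real) \<Rightarrow> real" where
  "monval n e x = (\<Prod>i<n. x i ^ e i)"

lemma monval_add: "monval n (\<lambda>i. e i + f i) x = monval n e x * monval n f x"
  by (simp add: monval_def power_add prod.distrib)

lemma monval_single: "i < n \<Longrightarrow> monval n (\<lambda>j. if j = i then k else 0) x = x i ^ k"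
  by (simp add: monval_def if_distrib[of "\<lambda>k. _ ^ k"] cong: if_cong)

text \<open>The critical point equations of a polynomial plus \<open>\<Sum>\<^sub>i x\<^sub>i\<^sup>m\<^sup>+\<^sup>1 / (s (m + 1))\<close>: the leading
  forms are the pure powers \<open>x\<^sub>i\<^sup>m\<close>, hence the quotient ring is spanned by the monomials with
  exponents below \<open>m\<close>.\<close>

locale power_system =
  fixes n m :: nat and T :: "nat \<Rightarrow> 't set" and \<gamma> :: "nat \<Rightarrow> 't \<Rightarrow> int"
    and \<beta> :: "nat \<Rightarrow> 't \<Rightarrow> nat \<Rightarrow> nat" and h :: real
  assumes fin: "\<And>i. i < n \<Longrightarrow> finite (T i)"
    and total: "\<And>i t. i < n \<Longrightarrow> t \<in> T i \<Longrightarrow> (\<Sum>j<n. \<beta> i t j) < m"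
    and bound: "\<And>i. i < n \<Longrightarrow> (\<Sum>t\<in>T i. real_of_int \<bar>\<gamma> i t\<bar>) \<le> h"
    and h: "0 \<le> h"
begin

definition solves :: "(nat \<Rightarrow> real) \<Rightarrow> real \<Rightarrow> bool" where
  "solves x s \<longleftrightarrow> (\<forall>i<n. x i ^ m = s * (\<Sum>t\<in>T i. of_int (\<gamma> i t) * monval n (\<beta> i t) x))"

definition box :: "(nat \<Rightarrow> nat) set" where
  "box = {..<n} \<rightarrow>\<^sub>E {..<m}"

lemma finite_box: "finite box"
  by (simp add: box_def finite_PiE)

lemma card_box: "card box = m ^ n"
  by (simp add: box_def card_PiE)

text \<open>While some exponent reaches \<open>m\<close>, one factor \<open>x i ^ m\<close> is
  replaced by its equation. Each replacement lowers the total degree and multiplies the size by at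
  most h \<le> 1 + h, hence the power of 1 + h. The coefficients depend on \<open>e\<close> only and
  serve all solutions at once.\<close>

lemma reduce_monomial:
  "\<exists>c. (\<Sum>\<alpha>\<in>box. height (c \<alpha>)) \<le> (1 + h) ^ (\<Sum>j<n. e j) \<and>
     (\<forall>x s. solves x s \<longrightarrow> monval n e x = (\<Sum>\<alpha>\<in>box. rpoly (c \<alpha>) s * monval n \<alpha> x))"
proof (induction "\<Sum>j<n. e j" arbitrary: e rule: less_induct)
  case less
  show ?case
  proof (cases "\<forall>i<n. e i < m")
    case True
    define a where "a = restrict e {..<n}"
    have a: "a \<in> box" using True by (auto simp: a_def box_def)
    define c where "c \<alpha> = (if \<alpha> = a then 1 else 0 :: int poly)" for \<alpha>
    have "(\<Sum>\<alpha>\<in>box. height (c \<alpha>)) = (\<Sum>\<alpha>\<in>box. if \<alpha> = a then 1 else 0)"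
      by (intro sum.cong) (auto simp: c_def one_pCons)
    also have "\<dots> \<le> (1 + h) ^ (\<Sum>j<n. e j)"
      using a h by (simp add: finite_box)
    finally have 1: "(\<Sum>\<alpha>\<in>box. height (c \<alpha>)) \<le> (1 + h) ^ (\<Sum>j<n. e j)" .
    have "monval n e x = (\<Sum>\<alpha>\<in>box. rpoly (c \<alpha>) s * monval n \<alpha> x)" for x s
    proof -
      have "(\<Sum>\<alpha>\<in>box. rpoly (c \<alpha>) s * monval n \<alpha> x) = (\<Sum>\<alpha>\<in>box. if \<alpha> = a then monval n a x else 0)"
        by (intro sum.cong) (auto simp: c_def)
      then show ?thesis using a by (simp add: finite_box a_def monval_def)
    qed
    then show ?thesis using 1 by blast
  next
    case False
    then obtain i where i: "i < n" "m \<le> e i" by (auto simp: not_less)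
    define e0 where "e0 = e(i := e i - m)"
    define e' where "e' t = (\<lambda>j. e0 j + \<beta> i t j)" for t
    have e: "e j = e0 j + (if j = i then m else 0)" for j
      using i by (simp add: e0_def)
    then have tot: "(\<Sum>j<n. e j) = (\<Sum>j<n. e0 j) + m"
      using i by (simp add: sum.distrib)
    have dec: "(\<Sum>j<n. e' t j) < (\<Sum>j<n. e j)" if "t \<in> T i" for t
      using total[OF i(1) that] unfolding tot by (simp add: e'_def sum.distrib)
    have "\<forall>t\<in>T i. \<exists>c. (\<Sum>\<alpha>\<in>box. height (c \<alpha>)) \<le> (1 + h) ^ (\<Sum>j<n. e' t j) \<and>
        (\<forall>x s. solves x s \<longrightarrow> monval n (e' t) x = (\<Sum>\<alpha>\<in>box. rpoly (c \<alpha>) s * monval n \<alpha> x))"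
      using less[OF dec] by blast
    then obtain c where c: "\<And>t. t \<in> T i \<Longrightarrow> (\<Sum>\<alpha>\<in>box. height (c t \<alpha>)) \<le> (1 + h) ^ (\<Sum>j<n. e' t j)"
      "\<And>t x s. t \<in> T i \<Longrightarrow> solves x s \<Longrightarrow> monval n (e' t) x = (\<Sum>\<alpha>\<in>box. rpoly (c t \<alpha>) s * monval n \<alpha> x)"
      by (auto dest!: bchoice)
    define c' where "c' \<alpha> = (\<Sum>t\<in>T i. [:0, \<gamma> i t:] * c t \<alpha>)" for \<alpha>
    have "(\<Sum>\<alpha>\<in>box. height (c' \<alpha>)) \<le> (\<Sum>\<alpha>\<in>box. \<Sum>t\<in>T i. real_of_int \<bar>\<gamma> i t\<bar> * height (c t \<alpha>))"
    proof (rule sum_mono)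
      fix \<alpha>
      have "height (c' \<alpha>) \<le> (\<Sum>t\<in>T i. height ([:0, \<gamma> i t:] * c t \<alpha>))"
        unfolding c'_def by (rule height.sum_le)
      also have "\<dots> \<le> (\<Sum>t\<in>T i. height [:0, \<gamma> i t:] * height (c t \<alpha>))"
        by (intro sum_mono height.mult_le)
      finally show "height (c' \<alpha>) \<le> (\<Sum>t\<in>T i. real_of_int \<bar>\<gamma> i t\<bar> * height (c t \<alpha>))" by simp
    qed
    also have "\<dots> = (\<Sum>t\<in>T i. real_of_int \<bar>\<gamma> i t\<bar> * (\<Sum>\<alpha>\<in>box. height (c t \<alpha>)))"
      by (subst sum.swap) (simp add: sum_distrib_left)
    also have "\<dots> \<le> (\<Sum>t\<in>T i. real_of_int \<bar>\<gamma> i t\<bar> * (1 + h) ^ ((\<Sum>j<n. e j) - 1))"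
    proof (intro sum_mono mult_left_mono)
      fix t assume t: "t \<in> T i"
      have "(1 + h) ^ (\<Sum>j<n. e' t j) \<le> (1 + h) ^ ((\<Sum>j<n. e j) - 1)"
        using h dec[OF t] by (intro power_increasing) auto
      then show "(\<Sum>\<alpha>\<in>box. height (c t \<alpha>)) \<le> (1 + h) ^ ((\<Sum>j<n. e j) - 1)"
        using c(1)[OF t] by linarith
    qed auto
    also have "\<dots> \<le> (1 + h) * (1 + h) ^ ((\<Sum>j<n. e j) - 1)"
      unfolding sum_distrib_right[symmetric] using bound[OF i(1)] h by (intro mult_right_mono) auto
    \<comment> \<open>The truncated exponent is harmless: a term in \<open>T i\<close> has smaller
      degree than \<open>e\<close>, so the degree of \<open>e\<close> is positive. If
      \<open>T i\<close> is empty, all \<open>c'\<close> vanish and no such estimate is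
      needed.\<close>
    also have "\<dots> \<le> (1 + h) ^ (\<Sum>j<n. e j)" if "T i \<noteq> {}"
    proof -
      have "(\<Sum>j<n. e j) > 0" using that dec by fastforce
      then show ?thesis by (cases "\<Sum>j<n. e j") simp_all
    qed
    finally have 1: "(\<Sum>\<alpha>\<in>box. height (c' \<alpha>)) \<le> (1 + h) ^ (\<Sum>j<n. e j)"
      using h by (cases "T i = {}") (auto simp: c'_def)
    have "monval n e x = (\<Sum>\<alpha>\<in>box. rpoly (c' \<alpha>) s * monval n \<alpha> x)" if x: "solves x s" for x s
    proof -
      have "monval n e x = monval n e0 x * x i ^ m"
        by (simp only: monval_add[symmetric] monval_single[OF i(1), symmetric] e[symmetric])
      also have "\<dots> = (\<Sum>t\<in>T i. s * of_int (\<gamma> i t) * monval n (e' t) x)"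
        using x i by (simp add: solves_def sum_distrib_left e'_def monval_add mult_ac)
      also have "\<dots> = (\<Sum>t\<in>T i. \<Sum>\<alpha>\<in>box. s * of_int (\<gamma> i t) * (rpoly (c t \<alpha>) s * monval n \<alpha> x))"
        by (intro sum.cong refl) (simp add: c(2)[OF _ x] sum_distrib_left)
      also have "\<dots> = (\<Sum>\<alpha>\<in>box. rpoly (c' \<alpha>) s * monval n \<alpha> x)"
        by (subst sum.swap) (simp add: c'_def rpoly.hom_sum rpoly.hom_mult sum_distrib_left sum_distrib_right mult_ac
            del: mult_pCons_left mult_pCons_right)
      finally show ?thesis .
    qed
    then show ?thesis using 1 by blast
  qed
qed

text \<open>By \<open>reduce_monomial\<close>, multiplication by the j-th coordinate acts on the box
  monomials through a matrix over the polynomials in \<open>s\<close>. The values of these monomials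
  at a solution form an eigenvector with eigenvalue that coordinate, and the polynomial sought is
  the leading coefficient in \<open>s\<close> of the characteristic determinant.\<close>

lemma limit_coordinate_polynomial:
  assumes x: "\<And>k. solves (x k) (s k)" and s: "filterlim s at_top sequentially"
    and p: "(\<lambda>k. x k j) \<longlonglongrightarrow> p" and j: "j < n" and m: "1 \<le> m"
  obtains f where "f \<noteq> 0" "degree f \<le> m ^ n"
    "height f \<le> fact (m ^ n) * (1 + (1 + h) ^ (n * m)) ^ m ^ n" "rpoly f p = 0"
proof -
  have "\<forall>\<alpha>\<in>box. \<exists>c. (\<Sum>\<alpha>'\<in>box. height (c \<alpha>')) \<le> (1 + h) ^ (n * m) \<and> (\<forall>x s. solves x s \<longrightarrow>
      x j * monval n \<alpha> x = (\<Sum>\<alpha>'\<in>box. rpoly (c \<alpha>') s * monval n \<alpha>' x))"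
  proof
    fix \<alpha> assume \<alpha>: "\<alpha> \<in> box"
    define e where "e i = \<alpha> i + (if i = j then 1 else 0)" for i
    have "(\<Sum>i<n. \<alpha> i) \<le> (\<Sum>i<n. m - 1)"
      using \<alpha> by (intro sum_mono) (force simp: box_def PiE_def Pi_def)
    then have "(\<Sum>i<n. e i) \<le> n * (m - 1) + 1"
      using j by (simp add: e_def sum.distrib)
    also have "\<dots> \<le> n * m" using j m by (cases m) auto
    finally have "(1 + h) ^ (\<Sum>i<n. e i) \<le> (1 + h) ^ (n * m)"
      using h by (intro power_increasing) auto
    moreover have "monval n e x = x j * monval n \<alpha> x" for x
      using monval_add[of n \<alpha> "\<lambda>i. if i = j then 1 else 0" x] monval_single[OF j, of 1 x]
      by (simp add: e_def[abs_def])
    ultimately show "\<exists>c. (\<Sum>\<alpha>'\<in>box. height (c \<alpha>')) \<le> (1 + h) ^ (n * m) \<and> (\<forall>x s. solves x s \<longrightarrow>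
        x j * monval n \<alpha> x = (\<Sum>\<alpha>'\<in>box. rpoly (c \<alpha>') s * monval n \<alpha>' x))"
      using reduce_monomial[of e] by (auto intro: order_trans)
  qed
  then obtain C where C: "\<And>\<alpha>. \<alpha> \<in> box \<Longrightarrow> (\<Sum>\<alpha>'\<in>box. height (C \<alpha> \<alpha>')) \<le> (1 + h) ^ (n * m)"
    "\<And>\<alpha> x s. \<alpha> \<in> box \<Longrightarrow> solves x s \<Longrightarrow>
      x j * monval n \<alpha> x = (\<Sum>\<alpha>'\<in>box. rpoly (C \<alpha> \<alpha>') s * monval n \<alpha>' x)"
    by (auto dest!: bchoice)
  have Ch: "height (C \<alpha> \<alpha>') \<le> (1 + h) ^ (n * m)" if "\<alpha> \<in> box" "\<alpha>' \<in> box" for \<alpha> \<alpha>'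
    using member_le_sum[OF that(2), of "\<lambda>\<alpha>'. height (C \<alpha> \<alpha>')"] C(1)[OF that(1)] finite_box by simp
  obtain F where F: "coeff F 0 \<noteq> 0" "inner_degree_le (card box) F"
    "l1 height F \<le> fact (card box) * (1 + (1 + h) ^ (n * m)) ^ card box"
    "\<forall>s z v. (\<forall>i\<in>box. z * v i = (\<Sum>j\<in>box. rpoly (C i j) s * v j)) \<longrightarrow> (\<exists>i\<in>box. v i \<noteq> 0)
      \<longrightarrow> rpoly2 F s z = 0"
    by (rule eigenvalue_polynomial[OF finite_box Ch])
  have root: "rpoly2 F (s k) (x k j) = 0" for k
  proof (rule F(4)[rule_format])
    show "x k j * monval n \<alpha> (x k) = (\<Sum>\<alpha>'\<in>box. rpoly (C \<alpha> \<alpha>') (s k) * monval n \<alpha>' (x k))" if "\<alpha> \<in> box" for \<alpha>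
      using C(2)[OF that x] .
    \<comment> \<open>The constant monomial belongs to the box, so the eigenvector is never
      zero.\<close>
    show "\<exists>\<alpha>\<in>box. monval n \<alpha> (x k) \<noteq> 0"
      using m by (intro bexI[of _ "restrict (\<lambda>_. 0) {..<n}"]) (auto simp: box_def monval_def)
  qed
  show thesis
  proof (rule that)
    show "lead_coeff F \<noteq> 0" using F(1) by auto
    show "degree (lead_coeff F) \<le> m ^ n"
      using F(2) unfolding inner_degree_le_def card_box by blast
    show "height (lead_coeff F) \<le> fact (m ^ n) * (1 + (1 + h) ^ (n * m)) ^ m ^ n"
      using height.coeff_le_l1[of F "degree F"] F(3) unfolding card_box by linarith
    show "rpoly (lead_coeff F) p = 0"
      by (rule lead_coeff_root_of_limit[OF s p root])
  qed
qed

end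


subsection \<open>Limits of critical points\<close>

text \<open>Tychonoff: extensionality pins the coordinates from \<open>n\<close> on to
  \<open>undefined\<close>, so the set is a product of compact sets over all indices, with
  singletons beyond \<open>n\<close>.\<close>

lemma compact_PiE_cbox: "compact (PiE {..<n} (\<lambda>_. {a..b}) :: (nat \<Rightarrow> real) set)"
proof -
  let ?B = "\<lambda>i::nat. if i < n then {a..b} else {undefined :: real}"
  have "compactin (product_topology (\<lambda>i. euclidean) UNIV) (PiE UNIV ?B)"
    unfolding compactin_PiE by (auto simp: compactin_euclidean_iff)
  moreover have "PiE UNIV ?B = PiE {..<n} (\<lambda>_. {a..b})"
  proof (rule Set.set_eqI)
    fix f :: "nat \<Rightarrow> real"
    have "f \<in> PiE UNIV ?B \<longleftrightarrow> (\<forall>i. f i \<in> ?B i)" by (simp only: PiE_iff) simp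
    also have "\<dots> \<longleftrightarrow> (\<forall>i<n. f i \<in> {a..b}) \<and> (\<forall>i. \<not> i < n \<longrightarrow> f i = undefined)"
      by (simp split: if_split) blast
    also have "\<dots> \<longleftrightarrow> f \<in> PiE {..<n} (\<lambda>_. {a..b})"
      by (simp only: PiE_iff extensional_def mem_Collect_eq lessThan_iff Ball_def)
    finally show "f \<in> PiE UNIV ?B \<longleftrightarrow> f \<in> PiE {..<n} (\<lambda>_. {a..b})" .
  qed
  ultimately show ?thesis
    by (simp add: euclidean_product_topology compactin_euclidean_iff)
qed

lemma continuous_on_coord: "continuous_on S (\<lambda>x :: nat \<Rightarrow> real. x i)"
  by (rule continuous_on_subset[OF continuous_on_product_coordinates]) simp

lemma continuous_on_monval [continuous_intros]: "continuous_on S (monval n e)"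
  unfolding monval_def[abs_def] by (intro continuous_on_prod continuous_on_power continuous_on_coord)

lemma continuous_on_fun_upd_real: "continuous_on S (\<lambda>t :: real. (x :: nat \<Rightarrow> real)(i := t))"
proof (rule continuous_on_coordinatewise_then_product)
  fix j show "continuous_on S (\<lambda>t. (x(i := t)) j)"
    by (cases "j = i") (simp_all add: continuous_on_id)
qed

lemma tendsto_coord:
  assumes "(X \<longlongrightarrow> (p :: nat \<Rightarrow> real)) F" shows "((\<lambda>k. X k i) \<longlongrightarrow> p i) F"
  using continuous_on_tendsto_compose[OF continuous_on_coord[of UNIV i] assms] by simp

lemma has_derivative_monval_upd:
  assumes "i < n"
  shows "((\<lambda>t. monval n e (x(i := t))) has_real_derivative
    real (e i) * monval n (e(i := e i - 1)) x) (at (x i))"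
proof -
  have upd: "monval n f (x(i := t)) = t ^ f i * (\<Prod>j\<in>{..<n} - {i}. x j ^ f j)" for f t
    unfolding monval_def using assms by (subst prod.remove[of _ i]) (auto intro!: prod.cong)
  have "monval n (e(i := e i - 1)) x = x i ^ (e i - 1) * (\<Prod>j\<in>{..<n} - {i}. x j ^ e j)"
    using upd[of "e(i := e i - 1)" "x i"] by simp
  then show ?thesis unfolding upd
    by (auto intro!: derivative_eq_intros)
qed

lemma local_min_coordinate_derivative:
  fixes x :: "nat \<Rightarrow> real"
  assumes O: "open O'" "x \<in> O'" and min: "\<And>t. x(i := t) \<in> O' \<Longrightarrow> g x \<le> g (x(i := t))"
    and der: "((\<lambda>t. g (x(i := t))) has_real_derivative l) (at (x i))"
  shows "l = 0"
proof -
  have "open ((\<lambda>t. x(i := t)) -` O')"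
    by (rule open_vimage[OF O(1) continuous_on_fun_upd_real])
  moreover have "x i \<in> (\<lambda>t. x(i := t)) -` O'" using O(2) by simp
  ultimately obtain d where d: "d > 0" "\<forall>y. dist y (x i) < d \<longrightarrow> y \<in> (\<lambda>t. x(i := t)) -` O'"
    unfolding open_dist by blast
  show ?thesis
  proof (rule DERIV_local_min[OF der d(1)], intro allI impI)
    fix y assume "\<bar>x i - y\<bar> < d"
    then have "dist y (x i) < d" by (simp add: dist_real_def)
    then show "g (x(i := x i)) \<le> g (x(i := y))" using d(2) min[of y] by auto
  qed
qed

text \<open>Minimising \<open>Q + \<zeta> \<Sum>\<^sub>j x\<^sub>j\<^sup>2\<^sup>D\<close> over a compact neighbourhood of the zero set of \<open>Q \<ge> 0\<close>
  and letting \<open>\<zeta>\<close> tend to 0 gives critical points that converge to a zero of \<open>Q\<close>.\<close>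

lemma critical_sequence:
  fixes Q :: "(nat \<Rightarrow> real) \<Rightarrow> real" and R :: "((nat \<Rightarrow> real) \<Rightarrow> real) set"
    and c :: "'t \<Rightarrow> int" and e :: "'t \<Rightarrow> nat \<Rightarrow> nat"
  assumes Q: "\<And>x. Q x = (\<Sum>t\<in>T. of_int (c t) * monval n (e t) x)" and Q0: "\<And>x. 0 \<le> Q x"
    and R: "finite R" "\<forall>r\<in>R. continuous_on UNIV r"
    and D: "1 \<le> D"
  defines "Kc \<equiv> {x \<in> {..<n} \<rightarrow>\<^sub>E {-1..2}. \<forall>r\<in>R. r x \<le> 0}"
  defines "Z \<equiv> {x \<in> Kc. Q x = 0}"
  assumes ne: "Z \<noteq> {}"
    and int: "\<forall>x\<in>Z. \<forall>i<n. -1 < x i \<and> x i < 2" "\<forall>x\<in>Z. \<forall>r\<in>R. r x < 0"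
  obtains p X s where "p \<in> Z" "filterlim s at_top sequentially" "\<forall>j. (\<lambda>k. X k j) \<longlonglongrightarrow> p j"
    "\<forall>k. \<forall>i<n. X k i ^ (2 * D - 1)
       = s k * (\<Sum>t\<in>T. of_int (- c t * int (e t i)) * monval n ((e t)(i := e t i - 1)) (X k))"
proof -
  obtain q where q: "q \<in> Z" using ne by blast
  \<comment> \<open>The perturbation parameter is 1 / (k + 1).\<close>
  define g where "g k x = Q x + 1 / real (Suc k) * (\<Sum>j<n. x j ^ (2 * D))" for k x
  have Qc: "continuous_on S Q" for S
    unfolding Q[abs_def] by (intro continuous_intros)
  have gc: "continuous_on S (g k)" for S k
    unfolding g_def[abs_def] by (intro continuous_intros Qc continuous_on_coord)
  have "Kc = PiE {..<n} (\<lambda>_. {-1..2}) \<inter> (\<Inter>r\<in>R. {x. r x \<le> 0})"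
    by (auto simp: Kc_def)
  then have Kc: "compact Kc"
    using R(2) by (auto intro!: compact_Int_closed compact_PiE_cbox closed_INT closed_Collect_le continuous_on_const)
  have "\<forall>k. \<exists>x\<in>Kc. \<forall>y\<in>Kc. g k x \<le> g k y"
    using continuous_attains_inf[OF Kc _ gc] q unfolding Z_def by blast
  then obtain Y where Y: "\<And>k. Y k \<in> Kc" "\<And>k y. y \<in> Kc \<Longrightarrow> g k (Y k) \<le> g k y"
    by metis
  obtain p r where pr: "p \<in> Kc" "strict_mono r" "(Y \<circ> r) \<longlonglongrightarrow> p"
    using compact_imp_seq_compact[OF Kc] Y(1) unfolding seq_compact_def by metis
  \<comment> \<open>Comparing the minimiser with the fixed zero \<open>q\<close> of \<open>Q\<close>
    gives Q(Y k) \<le> B / (k + 1), which forces the limit into \<open>Z\<close>.\<close>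
  define B where "B = (\<Sum>j<n. q j ^ (2 * D))"
  have le: "Q (Y k) \<le> B * (1 / real (Suc k))" for k
  proof -
    have "Q (Y k) \<le> g k (Y k)"
      by (simp add: g_def sum_nonneg)
    also have "\<dots> \<le> g k q" using Y(2) q by (simp add: Z_def)
    finally show ?thesis using q by (simp add: g_def Z_def B_def)
  qed
  have lim: "(\<lambda>k. B * (1 / real (Suc k))) \<longlonglongrightarrow> B * 0"
    using LIMSEQ_inverse_real_of_nat by (intro tendsto_intros) (simp add: inverse_eq_divide)
  have "(\<lambda>k. Q (Y k)) \<longlonglongrightarrow> 0"
  proof (rule tendsto_sandwich)
    show "\<forall>\<^sub>F k in sequentially. 0 \<le> Q (Y k)" by (simp add: Q0)
    show "\<forall>\<^sub>F k in sequentially. Q (Y k) \<le> B * (1 / real (Suc k))" by (rule always_eventually) (rule allI, rule le)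
    show "(\<lambda>k. B * (1 / real (Suc k))) \<longlonglongrightarrow> 0" using lim by simp
  qed simp
  then have "(\<lambda>k. Q (Y (r k))) \<longlonglongrightarrow> 0"
    using LIMSEQ_subseq_LIMSEQ[OF _ pr(2), of "\<lambda>k. Q (Y k)" 0] by (simp only: comp_def)
  moreover have "(\<lambda>k. Q (Y (r k))) \<longlonglongrightarrow> Q p"
    using continuous_on_tendsto_compose[OF Qc[of UNIV] pr(3)] by simp
  ultimately have "Q p = 0" using LIMSEQ_unique by blast
  then have p: "p \<in> Z" using pr(1) by (simp add: Z_def)
  \<comment> \<open>All constraints of \<open>Kc\<close> made strict. Minimisers near
    \<open>p\<close> lie in \<open>U\<close> and are therefore free to move along each coordinate
    line with index below \<open>n\<close>; only these lines are used, since \<open>Kc\<close> fixes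
    the remaining coordinates.\<close>
  define U where "U = (\<Inter>i\<in>{..<n}. {x :: nat \<Rightarrow> real. -1 < x i} \<inter> {x. x i < 2}) \<inter> (\<Inter>r\<in>R. {x. r x < 0})"
  have U: "open U" unfolding U_def
    using R by (intro open_Int open_INT ballI open_Collect_less continuous_on_const continuous_on_coord) auto
  have "p \<in> U" using int p by (auto simp: U_def)
  then have "\<forall>\<^sub>F k in sequentially. (Y \<circ> r) k \<in> U"
    using topological_tendstoD[OF pr(3) U] by simp
  then obtain k0 where k0: "\<And>k. k \<ge> k0 \<Longrightarrow> Y (r k) \<in> U"
    by (auto simp: eventually_sequentially)
  \<comment> \<open>The vanishing partial derivative of \<open>g k\<close>, solved for the pure
    power; this is where the factor (k + 1) / (2 D), later \<open>s\<close>, comes from.\<close>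
  have crit: "Y k i ^ (2 * D - 1) = (real (Suc k) / (2 * real D)) *
      (\<Sum>t\<in>T. of_int (- c t * int (e t i)) * monval n ((e t)(i := e t i - 1)) (Y k))"
    if k: "Y k \<in> U" and i: "i < n" for k i
  proof -
    define l where "l = (\<Sum>t\<in>T. of_int (c t) * (real (e t i) * monval n ((e t)(i := e t i - 1)) (Y k)))
      + 1 / real (Suc k) * (real (2 * D) * Y k i ^ (2 * D - 1))"
    have pw: "(\<Sum>j<n. ((Y k)(i := t)) j ^ (2 * D)) = t ^ (2 * D) + (\<Sum>j\<in>{..<n} - {i}. Y k j ^ (2 * D))" for t
      using i by (subst sum.remove[of _ i]) auto
    have "((\<lambda>t. g k ((Y k)(i := t))) has_real_derivative l) (at (Y k i))"
      unfolding g_def Q l_def pw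
      by (intro DERIV_add DERIV_sum DERIV_cmult has_derivative_monval_upd[OF i])
        (auto intro!: derivative_eq_intros)
    then have "l = 0"
    proof (rule local_min_coordinate_derivative[OF U k, rotated])
      fix t assume t: "(Y k)(i := t) \<in> U"
      have "(Y k)(i := t) \<in> extensional {..<n}"
        using Y(1)[of k] i by (auto simp: Kc_def PiE_def extensional_def)
      moreover have "((Y k)(i := t)) j \<in> {-1..2}" if "j < n" for j
        using t that unfolding U_def by (force simp: less_imp_le)
      moreover have "r ((Y k)(i := t)) \<le> 0" if "r \<in> R" for r
        using t that unfolding U_def by (force simp: less_imp_le)
      ultimately have "(Y k)(i := t) \<in> Kc"
        unfolding Kc_def PiE_def Pi_def by blast
      then show "g k (Y k) \<le> g k ((Y k)(i := t))" by (rule Y(2))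
    qed
    then have "1 / real (Suc k) * (real (2 * D) * Y k i ^ (2 * D - 1))
        = (\<Sum>t\<in>T. of_int (- c t * int (e t i)) * monval n ((e t)(i := e t i - 1)) (Y k))"
      unfolding l_def by (simp add: sum_negf mult.assoc)
    from this[symmetric] show ?thesis using D by (simp add: field_simps)
  qed
  define X where "X k = Y (r (k + k0))" for k
  define s where "s k = real (Suc (r (k + k0))) / (2 * real D)" for k
  show thesis
  proof (rule that[OF p])
    have r_ge: "k \<le> r (k + k0)" for k
      using seq_suble[OF pr(2), of "k + k0"] by simp
    have "filterlim (\<lambda>k. 1 / (2 * real D) * real k) at_top sequentially"
      using D by (intro filterlim_tendsto_pos_mult_at_top[OF tendsto_const _ filterlim_real_sequentially]) auto
    moreover have "1 / (2 * real D) * real k \<le> s k" for k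
      using D r_ge[of k] unfolding s_def by (simp add: divide_right_mono)
    then have "\<forall>\<^sub>F k in sequentially. 1 / (2 * real D) * real k \<le> s k"
      by (intro always_eventually allI)
    ultimately show "filterlim s at_top sequentially"
      by (rule filterlim_at_top_mono)
    show "\<forall>j. (\<lambda>k. X k j) \<longlonglongrightarrow> p j"
    proof
      fix j show "(\<lambda>k. X k j) \<longlonglongrightarrow> p j"
        using LIMSEQ_ignore_initial_segment[OF tendsto_coord[OF pr(3), of j], of k0]
        by (simp add: X_def comp_def)
    qed
    show "\<forall>k. \<forall>i<n. X k i ^ (2 * D - 1)
       = s k * (\<Sum>t\<in>T. of_int (- c t * int (e t i)) * monval n ((e t)(i := e t i - 1)) (X k))"
      using crit[OF k0] unfolding X_def s_def by simp
  qed
qed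


subsection \<open>An algebraic point with bounded height\<close>

definition mons :: "nat \<Rightarrow> nat \<Rightarrow> (nat \<Rightarrow>\<^sub>0 nat) set" where
  "mons n d = {m. Poly_Mapping.keys m \<subseteq> {..<n} \<and> (\<forall>i. Poly_Mapping.lookup m i \<le> d)}"

lemma mons_inj: "inj_on (\<lambda>m. restrict (Poly_Mapping.lookup m) {..<n}) (mons n d)"
proof (rule inj_onI)
  fix a b assume a: "a \<in> mons n d" and b: "b \<in> mons n d"
    and eq: "restrict (Poly_Mapping.lookup a) {..<n} = restrict (Poly_Mapping.lookup b) {..<n}"
  show "a = b"
  proof (rule poly_mapping_eqI)
    fix i show "Poly_Mapping.lookup a i = Poly_Mapping.lookup b i"
    proof (cases "i < n")
      case True
      then show ?thesis using fun_cong[OF eq, of i] by simp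
    next
      case False
      then have "i \<notin> Poly_Mapping.keys a" "i \<notin> Poly_Mapping.keys b"
        using a b by (auto simp: mons_def)
      then show ?thesis by (simp add: in_keys_iff)
    qed
  qed
qed

lemma mons_subset: "(\<lambda>m. restrict (Poly_Mapping.lookup m) {..<n}) ` mons n d \<subseteq> {..<n} \<rightarrow>\<^sub>E {..d}"
  by (simp add: image_subset_iff mons_def restrict_PiE_iff)

lemma finite_mons: "finite (mons n d)"
  by (rule inj_on_finite[OF mons_inj mons_subset]) (simp add: finite_PiE)

lemma card_mons: "card (mons n d) \<le> (d + 1) ^ n"
  using card_inj_on_le[OF mons_inj mons_subset] by (simp add: finite_PiE card_PiE)

definition bounded_polys :: "nat \<Rightarrow> nat \<Rightarrow> real \<Rightarrow> int_mpoly set" where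
  "bounded_polys n d M = {P \<in> polys_in_vars n. (\<forall>i<n. degree_in i P \<le> d) \<and>
     (\<forall>m. \<bar>real_of_int (Poly_Mapping.lookup P m)\<bar> \<le> M)}"

lemma keys_bounded_polys:
  assumes "P \<in> bounded_polys n d M"
  shows "Poly_Mapping.keys P \<subseteq> mons n d"
proof
  fix m assume m: "m \<in> Poly_Mapping.keys P"
  then have k: "Poly_Mapping.keys m \<subseteq> {..<n}"
    using assms by (auto simp: bounded_polys_def polys_in_vars_def)
  have "Poly_Mapping.lookup m i \<le> d" for i
  proof (cases "i < n")
    case True
    have "Poly_Mapping.lookup m i \<le> degree_in i P"
      unfolding degree_in_def using m by (intro Max_ge) auto
    then show ?thesis using assms True by (auto simp: bounded_polys_def intro: order_trans)
  next
    case False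
    then have "i \<notin> Poly_Mapping.keys m" using k by auto
    then show ?thesis by (simp add: in_keys_iff)
  qed
  then show "m \<in> mons n d" using k by (simp add: mons_def)
qed

lemma eval_mpoly_monval:
  assumes "P \<in> bounded_polys n d M"
  shows "eval_mpoly P x
    = (\<Sum>m\<in>mons n d. of_int (Poly_Mapping.lookup P m) * monval n (Poly_Mapping.lookup m) x)"
proof -
  have "(\<Prod>i\<in>Poly_Mapping.keys m. x i ^ Poly_Mapping.lookup m i) = monval n (Poly_Mapping.lookup m) x"
    if "m \<in> Poly_Mapping.keys P" for m
    unfolding monval_def using keys_bounded_polys[OF assms] that
    by (intro prod.mono_neutral_left) (auto simp: mons_def in_keys_iff)
  then have "eval_mpoly P x
      = (\<Sum>m\<in>Poly_Mapping.keys P. of_int (Poly_Mapping.lookup P m) * monval n (Poly_Mapping.lookup m) x)"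
    unfolding eval_mpoly_def by (intro sum.cong) auto
  also have "\<dots> = (\<Sum>m\<in>mons n d. of_int (Poly_Mapping.lookup P m) * monval n (Poly_Mapping.lookup m) x)"
    using keys_bounded_polys[OF assms] finite_mons
    by (intro sum.mono_neutral_left) (auto simp: in_keys_iff)
  finally show ?thesis .
qed

lemma coeff_sum_bound:
  assumes "P \<in> bounded_polys n d M"
  shows "(\<Sum>m\<in>mons n d. real_of_int \<bar>Poly_Mapping.lookup P m\<bar>) \<le> real ((d + 1) ^ n) * M"
proof -
  have M: "\<bar>real_of_int (Poly_Mapping.lookup P m)\<bar> \<le> M" for m
    using assms by (simp add: bounded_polys_def)
  then have "0 \<le> M" using abs_ge_zero order_trans by blast
  have "(\<Sum>m\<in>mons n d. real_of_int \<bar>Poly_Mapping.lookup P m\<bar>) \<le> (\<Sum>m\<in>mons n d. M)"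
    using M by (intro sum_mono) simp
  also have "\<dots> = real (card (mons n d)) * M" by simp
  also have "\<dots> \<le> real ((d + 1) ^ n) * M"
    using \<open>0 \<le> M\<close> card_mons by (intro mult_right_mono) (auto simp del: of_nat_power)
  finally show ?thesis .
qed

text \<open>This count replaces the number of constraints in all height estimates and so removes
  \<open>B\<close> from the payoff bound.\<close>

lemma card_bounded_polys:
  assumes "0 \<le> M"
  shows "finite (bounded_polys n d M)"
    and "real (card (bounded_polys n d M)) \<le> (2 * M + 1) ^ ((d + 1) ^ n)"
proof -
  let ?r = "\<lambda>P :: int_mpoly. restrict (Poly_Mapping.lookup P) (mons n d)"
  let ?B = "mons n d \<rightarrow>\<^sub>E {- \<lfloor>M\<rfloor>..\<lfloor>M\<rfloor>}"
  have inj: "inj_on ?r (bounded_polys n d M)"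
  proof (rule inj_onI)
    fix P R assume P: "P \<in> bounded_polys n d M" and R: "R \<in> bounded_polys n d M" and eq: "?r P = ?r R"
    show "P = R"
    proof (rule poly_mapping_eqI)
      fix m show "Poly_Mapping.lookup P m = Poly_Mapping.lookup R m"
      proof (cases "m \<in> mons n d")
        case True
        then show ?thesis using fun_cong[OF eq, of m] by simp
      next
        case False
        then have "m \<notin> Poly_Mapping.keys P" "m \<notin> Poly_Mapping.keys R"
          using keys_bounded_polys P R by blast+
        then show ?thesis by (simp add: in_keys_iff)
      qed
    qed
  qed
  have le: "- \<lfloor>M\<rfloor> \<le> c \<and> c \<le> \<lfloor>M\<rfloor>" if "\<bar>real_of_int c\<bar> \<le> M" for c
  proof -
    have "real_of_int \<bar>c\<bar> \<le> M" using that by simp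
    then have "\<bar>c\<bar> \<le> \<lfloor>M\<rfloor>" by (simp add: le_floor_iff)
    then show ?thesis by linarith
  qed
  have sub: "?r ` bounded_polys n d M \<subseteq> ?B"
    using le by (auto simp: bounded_polys_def)
  have fin: "finite ?B" by (intro finite_PiE finite_mons) simp
  show "finite (bounded_polys n d M)" by (rule inj_on_finite[OF inj sub fin])
  have "card (bounded_polys n d M) \<le> card ?B" by (rule card_inj_on_le[OF inj sub fin])
  also have "card ?B = nat (2 * \<lfloor>M\<rfloor> + 1) ^ card (mons n d)"
    by (simp add: card_PiE finite_mons)
  finally have "real (card (bounded_polys n d M)) \<le> real (nat (2 * \<lfloor>M\<rfloor> + 1)) ^ card (mons n d)"
    by (metis of_nat_le_iff of_nat_power)
  also have "\<dots> \<le> (2 * M + 1) ^ card (mons n d)"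
  proof (rule power_mono)
    show "real (nat (2 * \<lfloor>M\<rfloor> + 1)) \<le> 2 * M + 1" using assms by linarith
  qed simp
  also have "\<dots> \<le> (2 * M + 1) ^ ((d + 1) ^ n)"
    using assms card_mons by (intro power_increasing) auto
  finally show "real (card (bounded_polys n d M)) \<le> (2 * M + 1) ^ ((d + 1) ^ n)" .
qed

text \<open>For a maximal set \<open>I\<close> of constraints that are simultaneously active somewhere in \<open>E\<close>,
  all other constraints are inactive on \<open>Z = {x \<in> E. \<forall>P\<in>I. P x = 0}\<close>, so \<open>Z\<close> is an isolated part
  of the zero set of \<open>\<Sum>\<^sub>P P\<^sup>2\<close> and the critical point argument applies.\<close>

lemma algebraic_point:
  assumes M: "0 \<le> M" and \<P>: "\<P> \<subseteq> bounded_polys n d M"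
  defines "E \<equiv> {x \<in> {..<n} \<rightarrow>\<^sub>E UNIV. \<forall>P\<in>\<P>. eval_mpoly P x \<le> 0}"
  assumes ne: "E \<noteq> {}" and E01: "E \<subseteq> {..<n} \<rightarrow>\<^sub>E {0..1}"
  defines "m \<equiv> 2 * n * d + 1"
  defines "h \<equiv> 2 * real d * ((2 * M + 1) ^ ((d + 1) ^ n) * (real ((d + 1) ^ n) * M)^2)"
  obtains p where "p \<in> E" "\<forall>j<n. \<exists>f. f \<noteq> 0 \<and> degree f \<le> m ^ n \<and>
    height f \<le> fact (m ^ n) * (1 + (1 + h) ^ (n * m)) ^ m ^ n \<and> rpoly f (p j) = 0"
proof -
  have fin: "finite \<P>" using \<P> card_bounded_polys(1)[OF M] finite_subset by blast
  let ?S = "{I. I \<subseteq> \<P> \<and> (\<exists>x\<in>E. \<forall>P\<in>I. eval_mpoly P x = 0)}"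
  have "finite ?S" using fin by auto
  moreover have "{} \<in> ?S" using ne by auto
  then have "?S \<noteq> {}" by (rule ex_in_conv[THEN iffD1, OF exI])
  ultimately have "\<exists>I\<in>?S. \<forall>J\<in>?S. I \<le> J \<longrightarrow> I = J" by (rule finite_has_maximal)
  then obtain I where I: "I \<in> ?S" and Imax: "\<forall>J\<in>?S. I \<subseteq> J \<longrightarrow> I = J" by (rule bexE)
  have IP: "I \<subseteq> \<P>" using I by auto
  have ev: "eval_mpoly P x
    = (\<Sum>m\<in>mons n d. of_int (Poly_Mapping.lookup P m) * monval n (Poly_Mapping.lookup m) x)"
    if "P \<in> \<P>" for P x
    using \<P> that by (intro eval_mpoly_monval) auto
  define R where "R = eval_mpoly ` (\<P> - I)"
  define T where "T = I \<times> (mons n d \<times> mons n d)"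
  define c where "c = (\<lambda>(P :: int_mpoly, a, b). Poly_Mapping.lookup P a * Poly_Mapping.lookup P b)"
  define e where "e = (\<lambda>(P :: int_mpoly, a, b) (j :: nat). Poly_Mapping.lookup a j + Poly_Mapping.lookup b j :: nat)"
  define Q where "Q x = (\<Sum>P\<in>I. (eval_mpoly P x)\<^sup>2)" for x
  have finI: "finite I" using fin IP finite_subset by blast
  have finT: "finite T" using finI by (simp add: T_def finite_mons)
  have Qeq: "Q x = (\<Sum>t\<in>T. of_int (c t) * monval n (e t) x)" for x
  proof -
    have "(\<Sum>t\<in>T. of_int (c t) * monval n (e t) x) = (\<Sum>P\<in>I. \<Sum>a\<in>mons n d. \<Sum>b\<in>mons n d.
        (of_int (Poly_Mapping.lookup P a) * monval n (Poly_Mapping.lookup a) x) *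
        (of_int (Poly_Mapping.lookup P b) * monval n (Poly_Mapping.lookup b) x))"
      unfolding T_def sum.cartesian_product
      by (intro sum.cong) (auto simp: c_def e_def monval_add)
    also have "\<dots> = Q x"
      unfolding Q_def using IP
      by (intro sum.cong) (auto simp: ev power2_eq_square sum_product)
    finally show ?thesis by simp
  qed
  have Q0: "0 \<le> Q x" for x by (simp add: Q_def sum_nonneg)
  \<comment> \<open>The box [-1,2] contains [0,1] in its interior, so zeros in \<open>E\<close>
    never touch its faces.\<close>
  define Kc where "Kc = {x \<in> {..<n} \<rightarrow>\<^sub>E {-1..2}. \<forall>r\<in>R. r x \<le> 0}"
  define Z where "Z = {x \<in> Kc. Q x = 0}"
  have ZE: "x \<in> E" "\<And>P. P \<in> I \<Longrightarrow> eval_mpoly P x = 0" if "x \<in> Z" for x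
  proof -
    have "Q x = 0" using that by (simp add: Z_def)
    then show *: "\<And>P. P \<in> I \<Longrightarrow> eval_mpoly P x = 0"
      unfolding Q_def by (subst (asm) sum_nonneg_eq_0_iff) (auto simp: finI)
    have "eval_mpoly P x \<le> 0" if "P \<in> \<P>" for P
      using * \<open>x \<in> Z\<close> that by (cases "P \<in> I") (auto simp: Z_def Kc_def R_def)
    moreover have "x \<in> {..<n} \<rightarrow>\<^sub>E UNIV" using that by (auto simp: Z_def Kc_def)
    ultimately show "x \<in> E" by (simp add: E_def)
  qed
  have strict: "\<forall>x\<in>Z. \<forall>r\<in>R. r x < 0"
  proof (intro ballI)
    fix x r assume x: "x \<in> Z" and r: "r \<in> R"
    obtain P where P: "P \<in> \<P>" "P \<notin> I" "r = eval_mpoly P" using r by (auto simp: R_def)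
    have "eval_mpoly P x \<noteq> 0"
    proof
      assume "eval_mpoly P x = 0"
      then have "insert P I \<in> ?S" using ZE[OF x] IP P by auto
      then have "I = insert P I" using bspec[OF Imax, of "insert P I"] by blast
      then show False using P(2) by blast
    qed
    moreover have "r x \<le> 0" using x r by (simp add: Z_def Kc_def)
    ultimately show "r x < 0" using P by simp
  qed
  have inside: "\<forall>x\<in>Z. \<forall>i<n. -1 < x i \<and> x i < 2"
  proof (intro ballI allI impI)
    fix x i assume "x \<in> Z" "i < n"
    then have "x i \<in> {0..1}" using ZE(1) E01 by blast
    then show "-1 < x i \<and> x i < 2" by simp
  qed
  obtain x0 where x0: "x0 \<in> E" "\<forall>P\<in>I. eval_mpoly P x0 = 0" using I by auto
  then have "x0 \<in> {..<n} \<rightarrow>\<^sub>E {0..1}" using E01 by blast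
  then have "x0 \<in> {..<n} \<rightarrow>\<^sub>E {-1..2}" by (rule rev_subsetD) (intro PiE_mono, auto)
  then have "x0 \<in> Z" using x0 by (auto simp: Z_def Kc_def Q_def R_def E_def)
  then have Zne: "Z \<noteq> {}" by blast
  have Rc: "\<forall>r\<in>R. continuous_on UNIV r"
  proof
    fix r assume "r \<in> R"
    then obtain P where P: "P \<in> \<P>" "r = eval_mpoly P" by (auto simp: R_def)
    have "r = (\<lambda>x. \<Sum>m\<in>mons n d. of_int (Poly_Mapping.lookup P m) * monval n (Poly_Mapping.lookup m) x)"
      using ev[OF P(1)] P(2) by (simp add: fun_eq_iff)
    then show "continuous_on UNIV r"
      by (simp only:) (intro continuous_on_sum continuous_on_mult continuous_on_const continuous_on_monval)
  qed
  have Rf: "finite R" using fin by (simp add: R_def)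
  \<comment> \<open>\<open>Q\<close> has total degree at most 2nd. With D = nd + 1 the pure powers
    have exponent m = 2nd + 1, which exceeds the degree of every other term of the critical point
    equations.\<close>
  have D1: "1 \<le> n * d + 1" and Dm: "2 * (n * d + 1) - 1 = m" by (auto simp: m_def)
  obtain p X s where pX: "p \<in> Z" "filterlim s at_top sequentially" "\<forall>j. (\<lambda>k. X k j) \<longlonglongrightarrow> p j"
    "\<forall>k. \<forall>i<n. X k i ^ m
       = s k * (\<Sum>t\<in>T. of_int (- c t * int (e t i)) * monval n ((e t)(i := e t i - 1)) (X k))"
    by (rule critical_sequence[where Q = Q and T = T and c = c and n = n and e = e and R = R
        and D = "n * d + 1", OF Qeq Q0 Rf Rc D1,
        folded Kc_def, folded Z_def, OF Zne inside strict, unfolded Dm])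
  have el: "e t j \<le> 2 * d" if "t \<in> T" for t j
    using that by (auto simp: T_def e_def mons_def mult_2 intro: add_mono)
  \<comment> \<open>For \<open>e t i = 0\<close> the truncated exponent is not lowered, but then the
    coefficient is 0, and the degree bound 2nd < m still holds.\<close>
  interpret ps: power_system n m "\<lambda>_. T" "\<lambda>i t. - c t * int (e t i)" "\<lambda>i t. (e t)(i := e t i - 1)" h
  proof
    show "finite T" by (rule finT)
    show "(\<Sum>j<n. ((e t)(i := e t i - 1)) j) < m" if "t \<in> T" for i t
    proof -
      have "(\<Sum>j<n. ((e t)(i := e t i - 1)) j) \<le> (\<Sum>j<n. 2 * d)"
      proof (rule sum_mono)
        fix j show "((e t)(i := e t i - 1)) j \<le> 2 * d"
          using el[OF that, of j] el[OF that, of i] by auto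
      qed
      then show ?thesis by (simp add: m_def)
    qed
    show "0 \<le> h" using M by (simp add: h_def)
    show "(\<Sum>t\<in>T. real_of_int \<bar>- c t * int (e t i)\<bar>) \<le> h" for i
    proof -
      \<comment> \<open>Origin of \<open>h\<close>: differentiation costs 2d, each squared
        constraint costs the square of its coefficient sum, and the constraints in \<open>I\<close>
        are counted by \<open>card_bounded_polys\<close>.\<close>
      have "(\<Sum>t\<in>T. real_of_int \<bar>- c t * int (e t i)\<bar>) \<le> (\<Sum>t\<in>T. 2 * real d * \<bar>real_of_int (c t)\<bar>)"
      proof (rule sum_mono)
        fix t assume "t \<in> T"
        then have "real (e t i) \<le> real (2 * d)" using el by (simp only: of_nat_le_iff)
        then have "\<bar>real_of_int (c t)\<bar> * real (e t i) \<le> \<bar>real_of_int (c t)\<bar> * real (2 * d)"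
          by (intro mult_left_mono) auto
        then show "real_of_int \<bar>- c t * int (e t i)\<bar> \<le> 2 * real d * \<bar>real_of_int (c t)\<bar>"
          by (simp add: abs_mult mult_ac)
      qed
      also have "\<dots> = 2 * real d * (\<Sum>P\<in>I. \<Sum>a\<in>mons n d. \<Sum>b\<in>mons n d.
          real_of_int \<bar>Poly_Mapping.lookup P a\<bar> * real_of_int \<bar>Poly_Mapping.lookup P b\<bar>)"
        unfolding T_def sum.cartesian_product sum_distrib_left
        by (intro sum.cong) (auto simp: c_def abs_mult)
      also have "\<dots> = 2 * real d * (\<Sum>P\<in>I. (\<Sum>a\<in>mons n d. real_of_int \<bar>Poly_Mapping.lookup P a\<bar>)\<^sup>2)"
        by (simp only: power2_eq_square sum_product)
      also have "\<dots> \<le> 2 * real d * (\<Sum>P\<in>I. (real ((d + 1) ^ n) * M)\<^sup>2)"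
        using \<P> IP by (intro mult_left_mono sum_mono power_mono coeff_sum_bound sum_nonneg) auto
      also have "\<dots> = 2 * real d * (real (card I) * (real ((d + 1) ^ n) * M)\<^sup>2)" by simp
      also have "\<dots> \<le> h"
      proof -
        have "card I \<le> card (bounded_polys n d M)"
          using IP \<P> card_bounded_polys(1)[OF M] by (intro card_mono) auto
        then have "real (card I) \<le> (2 * M + 1) ^ ((d + 1) ^ n)"
          using card_bounded_polys(2)[OF M, of n d] by linarith
        then show ?thesis unfolding h_def by (intro mult_left_mono mult_right_mono) auto
      qed
      finally show ?thesis .
    qed
  qed
  have sol: "ps.solves (X k) (s k)" for k
    unfolding ps.solves_def using pX(4) by blast
  show thesis
  proof (rule that)
    show "p \<in> E" using ZE(1) pX(1) .
    show "\<forall>j<n. \<exists>f. f \<noteq> 0 \<and> degree f \<le> m ^ n \<and>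
      height f \<le> fact (m ^ n) * (1 + (1 + h) ^ (n * m)) ^ m ^ n \<and> rpoly f (p j) = 0"
    proof (intro allI impI)
      fix j assume j: "j < n"
      have "1 \<le> m" by (simp add: m_def)
      with sol pX(2) pX(3)[rule_format, of j] j
      obtain f where "f \<noteq> 0" "degree f \<le> m ^ n"
        "height f \<le> fact (m ^ n) * (1 + (1 + h) ^ (n * m)) ^ m ^ n" "rpoly f (p j) = 0"
        by (rule ps.limit_coordinate_polynomial)
      then show "\<exists>f. f \<noteq> 0 \<and> degree f \<le> m ^ n \<and>
        height f \<le> fact (m ^ n) * (1 + (1 + h) ^ (n * m)) ^ m ^ n \<and> rpoly f (p j) = 0"
        by (intro exI[of _ f] conjI)
    qed
  qed
qed


subsection \<open>Games from multiaffine functions\<close>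

text \<open>These are the multilinear extensions of functions on 0/1 points, the form of every
  expected payoff. Tracking the set \<open>S\<close> of variables allows products without repeated
  variables.\<close>

definition multiaffine_on :: "'v set \<Rightarrow> (('v \<Rightarrow> real) \<Rightarrow> real) \<Rightarrow> bool" where
  "multiaffine_on S f \<longleftrightarrow>
     (\<forall>x j. f x = x j * f (x(j := 1)) + (1 - x j) * f (x(j := 0))) \<and>
     (\<forall>x y. (\<forall>v\<in>S. x v = y v) \<longrightarrow> f x = f y)"

lemma multiaffine_on_split:
  "multiaffine_on S f \<Longrightarrow> f x = x j * f (x(j := 1)) + (1 - x j) * f (x(j := 0))"
  unfolding multiaffine_on_def by blast

lemma multiaffine_on_cong:
  "multiaffine_on S f \<Longrightarrow> (\<And>v. v \<in> S \<Longrightarrow> x v = y v) \<Longrightarrow> f x = f y"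
  unfolding multiaffine_on_def by blast

lemma multiaffine_on_mono: "multiaffine_on S f \<Longrightarrow> S \<subseteq> T \<Longrightarrow> multiaffine_on T f"
  unfolding multiaffine_on_def by blast

lemma multiaffine_on_const [intro, simp]: "multiaffine_on S (\<lambda>x. c)"
  by (simp add: multiaffine_on_def algebra_simps)

lemma multiaffine_on_var [intro, simp]: "v \<in> S \<Longrightarrow> multiaffine_on S (\<lambda>x. x v)"
  by (auto simp: multiaffine_on_def algebra_simps)

lemma multiaffine_on_add:
  assumes f: "multiaffine_on S f" and g: "multiaffine_on S g"
  shows "multiaffine_on S (\<lambda>x. f x + g x)"
  unfolding multiaffine_on_def
proof (intro conjI allI impI)
  fix x :: "_ \<Rightarrow> real" and j show "f x + g x = x j * (f (x(j := 1)) + g (x(j := 1))) + (1 - x j) * (f (x(j := 0)) + g (x(j := 0)))"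
    using multiaffine_on_split[OF f, of x j] multiaffine_on_split[OF g, of x j]
    by (simp only: distrib_left)
next
  fix x y :: "_ \<Rightarrow> real" assume "\<forall>v\<in>S. x v = y v"
  then show "f x + g x = f y + g y"
    using multiaffine_on_cong[OF f, of x y] multiaffine_on_cong[OF g, of x y] by simp
qed

text \<open>Disjointness excludes squares: each variable occurs in at most one factor, which is
  affine in it.\<close>

lemma multiaffine_on_mult:
  assumes f: "multiaffine_on S f" and g: "multiaffine_on T g" and ST: "S \<inter> T = {}"
  shows "multiaffine_on (S \<union> T) (\<lambda>x. f x * g x)"
  unfolding multiaffine_on_def
proof (intro conjI allI impI)
  fix x :: "_ \<Rightarrow> real" and j
  show "f x * g x = x j * (f (x(j := 1)) * g (x(j := 1))) + (1 - x j) * (f (x(j := 0)) * g (x(j := 0)))"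
  proof (cases "j \<in> S")
    case True
    then have "g (x(j := t)) = g x" for t
      using ST by (intro multiaffine_on_cong[OF g]) auto
    then show ?thesis by (subst multiaffine_on_split[OF f, of x j]) (simp add: algebra_simps)
  next
    case False
    then have "f (x(j := t)) = f x" for t
      by (intro multiaffine_on_cong[OF f]) auto
    then show ?thesis by (subst multiaffine_on_split[OF g, of x j]) (simp add: algebra_simps)
  qed
next
  fix x y :: "_ \<Rightarrow> real" assume "\<forall>v\<in>S \<union> T. x v = y v"
  then show "f x * g x = f y * g y"
    using multiaffine_on_cong[OF f, of x y] multiaffine_on_cong[OF g, of x y] by simp
qed

lemma multiaffine_on_cmult: "multiaffine_on S f \<Longrightarrow> multiaffine_on S (\<lambda>x. c * f x)"
  using multiaffine_on_mult[of "{}" "\<lambda>_. c" S f] by simp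

lemma multiaffine_on_diff:
  "multiaffine_on S f \<Longrightarrow> multiaffine_on S g \<Longrightarrow> multiaffine_on S (\<lambda>x. f x - g x)"
  using multiaffine_on_add[of S f "\<lambda>x. (- 1) * g x"] multiaffine_on_cmult[of S g "- 1"] by simp

lemma multiaffine_on_sum:
  "(\<And>i. i \<in> I \<Longrightarrow> multiaffine_on S (f i)) \<Longrightarrow> multiaffine_on S (\<lambda>x. \<Sum>i\<in>I. f i x)"
  by (induction I rule: infinite_finite_induct) (simp_all add: multiaffine_on_add)

lemma multiaffine_on_prod:
  assumes "finite I" "\<And>i. i \<in> I \<Longrightarrow> multiaffine_on (S i) (f i)"
    "\<And>i j. i \<in> I \<Longrightarrow> j \<in> I \<Longrightarrow> i \<noteq> j \<Longrightarrow> S i \<inter> S j = {}"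
  shows "multiaffine_on (\<Union>i\<in>I. S i) (\<lambda>x. \<Prod>i\<in>I. f i x)"
  using assms
proof (induction I rule: finite_induct)
  case (insert i I)
  have "multiaffine_on (S i \<union> (\<Union>i\<in>I. S i)) (\<lambda>x. f i x * (\<Prod>i\<in>I. f i x))"
    using insert.prems insert.hyps by (intro multiaffine_on_mult insert.IH) fastforce+
  then show ?case using insert.hyps by simp
qed simp

lemma multiaffine_on_reindex:
  assumes f: "multiaffine_on S f" and d: "inj_on d S"
  shows "multiaffine_on (d ` S) (\<lambda>x. f (\<lambda>v. x (d v)))"
  unfolding multiaffine_on_def
proof (intro conjI allI impI)
  fix x :: "_ \<Rightarrow> real" and j
  show "f (\<lambda>v. x (d v)) = x j * f (\<lambda>v. (x(j := 1)) (d v)) + (1 - x j) * f (\<lambda>v. (x(j := 0)) (d v))"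
  proof (cases "j \<in> d ` S")
    case True
    then obtain u where u: "u \<in> S" "j = d u" by blast
    have "f (\<lambda>v. (x(j := t)) (d v)) = f ((\<lambda>v. x (d v))(u := t))" for t
      using d u by (intro multiaffine_on_cong[OF f]) (auto simp: inj_on_def)
    then show ?thesis
      using multiaffine_on_split[OF f, of "\<lambda>v. x (d v)" u] u by simp
  next
    case False
    have "f (\<lambda>v. (x(j := t)) (d v)) = f (\<lambda>v. x (d v))" for t
      using False by (intro multiaffine_on_cong[OF f]) auto
    then show ?thesis by (simp add: algebra_simps)
  qed
next
  fix x y :: "_ \<Rightarrow> real" assume "\<forall>v\<in>d ` S. x v = y v"
  then show "f (\<lambda>v. x (d v)) = f (\<lambda>v. y (d v))"
    by (intro multiaffine_on_cong[OF f]) auto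
qed

text \<open>The value is the expectation of \<open>f\<close> under independent rounding of the
  coordinates in \<open>J\<close> to 0 or 1; one coordinate is split off at a time.\<close>

lemma multiaffine_expansion:
  assumes f: "multiaffine_on S f" and J: "finite J"
  shows "f x = (\<Sum>s\<in>J \<rightarrow>\<^sub>E {..<2::nat}. (\<Prod>j\<in>J. binary_profile x j (s j)) *
    f (\<lambda>j. if j \<in> J then of_bool (s j = 0) else x j))"
  using J
proof (induction J rule: finite_induct)
  case (insert j J)
  let ?o = "\<lambda>g i. if i \<in> J then of_bool (g i = (0::nat)) else x i"
  let ?w = "\<lambda>g :: nat \<Rightarrow> nat. \<Prod>i\<in>J. binary_profile x i (g i)"
  let ?T = "\<lambda>s. (\<Prod>i\<in>insert j J. binary_profile x i (s i)) *
    f (\<lambda>i. if i \<in> insert j J then of_bool (s i = 0) else x i)"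
  have T: "?T (g(j := y)) = binary_profile x j y * ?w g * f ((?o g)(j := of_bool (y = 0)))" for g y
  proof -
    have "(\<Prod>i\<in>J. binary_profile x i ((g(j := y)) i)) = ?w g"
      using insert.hyps by (intro prod.cong) auto
    moreover have "(\<lambda>i. if i \<in> insert j J then of_bool ((g(j := y)) i = 0) else x i) = (?o g)(j := of_bool (y = 0))"
      by auto
    ultimately show ?thesis using insert.hyps by (simp only: prod.insert[OF insert.hyps] fun_upd_same)
  qed
  have inj: "inj_on (\<lambda>(y, g). g(j := y)) ({..<2::nat} \<times> (J \<rightarrow>\<^sub>E {..<2}))"
    using inj_combinator[OF insert.hyps(2), of "\<lambda>_. {..<2}"] by simp
  have "(\<Sum>s\<in>insert j J \<rightarrow>\<^sub>E {..<2}. ?T s) = (\<Sum>(y, g)\<in>{..<2} \<times> (J \<rightarrow>\<^sub>E {..<2}). ?T (g(j := y)))"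
    unfolding PiE_insert_eq by (subst sum.reindex[OF inj]) (simp only: comp_def case_prod_unfold)
  also have "\<dots> = (\<Sum>y<2. \<Sum>g\<in>J \<rightarrow>\<^sub>E {..<2}. ?T (g(j := y)))"
    by (simp only: sum.cartesian_product)
  also have "\<dots> = (\<Sum>g\<in>J \<rightarrow>\<^sub>E {..<2}. ?w g * (x j * f ((?o g)(j := 1)) + (1 - x j) * f ((?o g)(j := 0))))"
    unfolding T by (simp add: numeral_2_eq_2 binary_profile_def sum.distrib[symmetric] algebra_simps)
  also have "\<dots> = (\<Sum>g\<in>J \<rightarrow>\<^sub>E {..<2}. ?w g * f (?o g))"
    using insert.hyps by (intro sum.cong refl) (simp add: multiaffine_on_split[OF f, of "?o _" j])
  also have "\<dots> = f x" using insert.IH by simp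
  finally show ?case by simp
qed (simp add: PiE_empty_domain)

text \<open>\<open>D i\<close> is the gain of the first pure strategy over the second, whose payoff
  is 0. Pure strategy 0 corresponds to probability 1, hence
  \<open>of_bool (s j = 0)\<close>.\<close>

definition multiaffine_game :: "nat \<Rightarrow> (nat \<Rightarrow> (nat \<Rightarrow> real) \<Rightarrow> real) \<Rightarrow> game" where
  "multiaffine_game N D = \<lparr>num_players = N, num_strats = \<lambda>_. 2,
     payoff = \<lambda>i s. if s i = 0 then D i (\<lambda>j. of_bool (s j = 0)) else 0\<rparr>"

lemma expected_payoff_multiaffine_game:
  assumes D: "multiaffine_on ({..<N} - {i}) (D i)" and i: "i < N"
  shows "expected_payoff (multiaffine_game N D) i (binary_profile x) = x i * D i x"
proof -
  have "multiaffine_on ({i} \<union> ({..<N} - {i})) (\<lambda>x. x i * D i x)"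
    by (intro multiaffine_on_mult D) auto
  then have f: "multiaffine_on {..<N} (\<lambda>x. x i * D i x)"
    using i by (simp add: insert_absorb)
  have "x i * D i x = (\<Sum>s\<in>{..<N} \<rightarrow>\<^sub>E {..<2::nat}. (\<Prod>j<N. binary_profile x j (s j)) *
    (\<lambda>x. x i * D i x) (\<lambda>j. if j \<in> {..<N} then of_bool (s j = 0) else x j))"
    using multiaffine_expansion[OF f, of "{..<N}" x] by simp
  also have "\<dots> = (\<Sum>s\<in>{..<N} \<rightarrow>\<^sub>E {..<2::nat}. (\<Prod>j<N. binary_profile x j (s j)) *
    (\<lambda>x. x i * D i x) (\<lambda>j. of_bool (s j = 0)))"
    by (intro sum.cong refl arg_cong2[of _ _ _ _ "(*)"] multiaffine_on_cong[OF f]) simp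
  finally show ?thesis
    by (simp add: expected_payoff_def pure_profiles_def multiaffine_game_def of_bool_def
        if_distrib[of "\<lambda>c. c * _"] cong: if_cong)
qed

lemma mixed_strategy_2:
  "num_strats G i = 2 \<Longrightarrow> mixed_strategy G i \<tau> \<longleftrightarrow> 0 \<le> \<tau> 0 \<and> 0 \<le> \<tau> 1 \<and> \<tau> 0 + \<tau> 1 = 1"
  by (auto simp: mixed_strategy_def numeral_2_eq_2 less_Suc_eq)

text \<open>The expected payoff is \<open>x i * D i x\<close>, and \<open>D i\<close> does not
  depend on \<open>x i\<close>, so a best response is decided by the sign of \<open>D i x\<close>
  alone.\<close>

lemma binary_nash_set_multiaffine_game:
  assumes D: "\<And>i. i < N \<Longrightarrow> multiaffine_on ({..<N} - {i}) (D i)"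
  shows "binary_nash_set (multiaffine_game N D) =
    {x \<in> {..<N} \<rightarrow>\<^sub>E {0..1}. \<forall>i<N. (0 < D i x \<longrightarrow> x i = 1) \<and> (D i x < 0 \<longrightarrow> x i = 0)}"
proof -
  let ?G = "multiaffine_game N D"
  have [simp]: "num_players ?G = N" "num_strats ?G i = 2" for i by (simp_all add: multiaffine_game_def)
  have dev: "expected_payoff ?G i ((binary_profile x)(i := \<tau>)) = \<tau> 0 * D i x"
    if i: "i < N" and \<tau>: "\<tau> 0 + \<tau> 1 = 1" for x \<tau> i
  proof -
    \<comment> \<open>A mixed strategy \<open>\<tau>\<close> is arbitrary at indices from 2 on, so
      the two profiles agree only where pure profiles can look.\<close>
    have eq: "((binary_profile x)(i := \<tau>)) j k = binary_profile (x(i := \<tau> 0)) j k" if "k < 2" for j k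
      using that \<tau> by (auto simp: binary_profile_def numeral_2_eq_2 less_Suc_eq)
    have "(\<Prod>j<N. ((binary_profile x)(i := \<tau>)) j (s j)) = (\<Prod>j<N. binary_profile (x(i := \<tau> 0)) j (s j))"
      if "s \<in> pure_profiles ?G" for s
      using that by (intro prod.cong refl eq) (auto simp: pure_profiles_def)
    then have "expected_payoff ?G i ((binary_profile x)(i := \<tau>)) = expected_payoff ?G i (binary_profile (x(i := \<tau> 0)))"
      unfolding expected_payoff_def by (intro sum.cong) auto
    also have "\<dots> = \<tau> 0 * D i (x(i := \<tau> 0))"
      using expected_payoff_multiaffine_game[of N i D, OF D[OF i] i] by simp
    also have "D i (x(i := \<tau> 0)) = D i x"
      by (rule multiaffine_on_cong[OF D[OF i]]) auto
    finally show ?thesis .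
  qed
  have "nash_equilibrium ?G (binary_profile x) \<longleftrightarrow>
      (\<forall>i<N. (0 < D i x \<longrightarrow> x i = 1) \<and> (D i x < 0 \<longrightarrow> x i = 0))"
    if x: "x \<in> {..<N} \<rightarrow>\<^sub>E {0..1}" for x
  proof
    assume ne: "nash_equilibrium ?G (binary_profile x)"
    show "\<forall>i<N. (0 < D i x \<longrightarrow> x i = 1) \<and> (D i x < 0 \<longrightarrow> x i = 0)"
    proof (intro allI impI)
      fix i assume i: "i < N"
      have le: "t * D i x \<le> x i * D i x" if t: "0 \<le> t" "t \<le> 1" for t
      proof -
        define \<tau> where "\<tau> k = (if k = (0::nat) then t else 1 - t)" for k
        have "mixed_strategy ?G i \<tau>" using t by (simp add: mixed_strategy_2 \<tau>_def)
        then have "expected_payoff ?G i ((binary_profile x)(i := \<tau>)) \<le> expected_payoff ?G i (binary_profile x)"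
          using ne i by (simp add: nash_equilibrium_def)
        moreover have "\<tau> 0 + \<tau> 1 = 1" by (simp add: \<tau>_def)
        ultimately have "\<tau> 0 * D i x \<le> x i * D i x"
          using dev[OF i, of \<tau> x] expected_payoff_multiaffine_game[of N i D x, OF D[OF i] i] by simp
        then show ?thesis by (simp add: \<tau>_def)
      qed
      have xi: "0 \<le> x i" "x i \<le> 1" using x i by (auto simp: PiE_iff)
      have "x i = 1" if "0 < D i x" using le[of 1] that xi by simp
      moreover have "x i = 0" if "D i x < 0" using le[of 0] that xi by (simp add: zero_le_mult_iff)
      ultimately show "(0 < D i x \<longrightarrow> x i = 1) \<and> (D i x < 0 \<longrightarrow> x i = 0)" by blast
    qed
  next
    assume br: "\<forall>i<N. (0 < D i x \<longrightarrow> x i = 1) \<and> (D i x < 0 \<longrightarrow> x i = 0)"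
    have "mixed_strategy ?G i (binary_profile x i)" if "i < N" for i
      using x that by (auto simp: mixed_strategy_2 binary_profile_def PiE_iff)
    moreover have "expected_payoff ?G i ((binary_profile x)(i := \<tau>)) \<le> expected_payoff ?G i (binary_profile x)"
      if i: "i < N" and \<tau>: "mixed_strategy ?G i \<tau>" for i \<tau>
    proof -
      have t: "0 \<le> \<tau> 0" "\<tau> 0 \<le> 1" "\<tau> 0 + \<tau> 1 = 1" using \<tau> by (auto simp: mixed_strategy_2)
      have "\<tau> 0 * D i x \<le> x i * D i x"
      proof (cases "D i x" "0 :: real" rule: linorder_cases)
        case less
        then show ?thesis using br i t by (simp add: mult_nonneg_nonpos)
      next
        case greater
        then show ?thesis using br i t by (simp add: mult_left_le_one_le)
      qed simp
      then show ?thesis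
        using dev[OF i t(3), of x] expected_payoff_multiaffine_game[of N i D x, OF D[OF i] i] by simp
    qed
    ultimately show "nash_equilibrium ?G (binary_profile x)"
      by (simp add: nash_equilibrium_def)
  qed
  then show ?thesis by (auto simp: binary_nash_set_def)
qed

text \<open>Lets players carry structured names: they are renumbered so that \<open>X 0\<close>,
  ..., \<open>X (n - 1)\<close> come first. Payoffs are values at 0/1 points, so integrality and
  size are required only there.\<close>

lemma game_from_multiaffine_family:
  fixes V :: "'v set" and D :: "'v \<Rightarrow> ('v \<Rightarrow> real) \<Rightarrow> real" and X :: "nat \<Rightarrow> 'v"
  assumes V: "finite V" and X: "inj_on X {..<n}" "X ` {..<n} \<subseteq> V"
    and D: "\<And>v. v \<in> V \<Longrightarrow> multiaffine_on (V - {v}) (D v)"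
    and pay: "\<And>v y. v \<in> V \<Longrightarrow> (\<And>u. y u \<in> {0, 1}) \<Longrightarrow> D v y \<in> \<int> \<and> \<bar>D v y\<bar> \<le> b"
    and b: "0 \<le> b"
  obtains G where "binary_game G" "num_players G = card V" "n \<le> card V"
    "\<forall>i<card V. \<forall>s\<in>pure_profiles G. payoff G i s \<in> \<int> \<and> \<bar>payoff G i s\<bar> \<le> b"
    "(\<lambda>x. restrict x {..<n}) ` binary_nash_set G =
     (\<lambda>y. restrict (\<lambda>j. y (X j)) {..<n}) ` {y. \<forall>v\<in>V. 0 \<le> y v \<and> y v \<le> 1 \<and>
       (0 < D v y \<longrightarrow> y v = 1) \<and> (D v y < 0 \<longrightarrow> y v = 0)}"
proof -
  define N where "N = card V"
  have cX: "card (X ` {..<n}) = n" using X(1) by (simp add: card_image)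
  then have nN: "n \<le> N" using card_mono[OF V X(2)] by (simp add: N_def)
  have "card {n..<N} = card (V - X ` {..<n})"
    using X V cX by (simp add: card_Diff_subset N_def)
  then obtain e' where e': "bij_betw e' {n..<N} (V - X ` {..<n})"
    using V finite_same_card_bij[of "{n..<N}" "V - X ` {..<n}"] by auto
  define e where "e j = (if j < n then X j else e' j)" for j
  have "bij_betw e {..<n} (X ` {..<n})"
    using X(1) by (simp add: bij_betw_def e_def inj_on_def)
  moreover have "bij_betw e {n..<N} (V - X ` {..<n})"
    using e' by (rule bij_betw_cong[THEN iffD1, rotated]) (simp add: e_def)
  ultimately have "bij_betw e ({..<n} \<union> {n..<N}) (X ` {..<n} \<union> (V - X ` {..<n}))"
    by (rule bij_betw_combine) blast
  moreover have "{..<n} \<union> {n..<N} = {..<N}" using nN by auto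
  moreover have "X ` {..<n} \<union> (V - X ` {..<n}) = V" using X(2) by blast
  ultimately have e: "bij_betw e {..<N} V" by simp
  define d where "d = inv_into {..<N} e"
  have d: "bij_betw d V {..<N}" unfolding d_def by (rule bij_betw_inv_into[OF e])
  have ed: "e (d v) = v" if "v \<in> V" for v
    using bij_betw_inv_into_right[OF e that] by (simp add: d_def)
  have de: "d (e i) = i" if "i < N" for i
    using bij_betw_inv_into_left[OF e] that by (simp add: d_def)
  have eV: "e i \<in> V" if "i < N" for i using e that by (auto simp: bij_betw_def)
  have dN: "d v < N" if "v \<in> V" for v using d that by (auto simp: bij_betw_def)
  define D' where "D' i x = D (e i) (\<lambda>v. x (d v))" for i and x :: "nat \<Rightarrow> real"
  define G where "G = multiaffine_game N D'"
  have D': "multiaffine_on ({..<N} - {i}) (D' i)" if i: "i < N" for i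
  proof -
    have inj: "inj_on d V" using d by (simp add: bij_betw_def)
    have "multiaffine_on (d ` (V - {e i})) (D' i)"
      unfolding D'_def[abs_def]
      by (rule multiaffine_on_reindex[OF D[OF eV[OF i]] inj_on_subset[OF inj]]) blast
    then show ?thesis
    proof (rule multiaffine_on_mono)
      show "d ` (V - {e i}) \<subseteq> {..<N} - {i}" using dN ed by fastforce
    qed
  qed
  have nash: "binary_nash_set G = {x \<in> {..<N} \<rightarrow>\<^sub>E {0..1}. \<forall>i<N. (0 < D' i x \<longrightarrow> x i = 1) \<and> (D' i x < 0 \<longrightarrow> x i = 0)}"
    unfolding G_def by (rule binary_nash_set_multiaffine_game[OF D'])
  let ?Y = "{y. \<forall>v\<in>V. 0 \<le> y v \<and> y v \<le> 1 \<and> (0 < D v y \<longrightarrow> y v = 1) \<and> (D v y < 0 \<longrightarrow> y v = 0)}"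
  show thesis
  proof (rule that[of G])
    show "binary_game G" by (simp add: G_def binary_game_def multiaffine_game_def)
    show "num_players G = card V" by (simp add: G_def multiaffine_game_def N_def)
    show "n \<le> card V" using nN by (simp add: N_def)
    show "\<forall>i<card V. \<forall>s\<in>pure_profiles G. payoff G i s \<in> \<int> \<and> \<bar>payoff G i s\<bar> \<le> b"
    proof (intro allI impI ballI)
      fix i and s :: "nat \<Rightarrow> nat" assume "i < card V"
      then have "e i \<in> V" using eV by (simp add: N_def)
      then have "D (e i) (\<lambda>v. of_bool (s (d v) = 0)) \<in> \<int> \<and> \<bar>D (e i) (\<lambda>v. of_bool (s (d v) = 0))\<bar> \<le> b"
        by (rule pay) (simp add: of_bool_def)
      then show "payoff G i s \<in> \<int> \<and> \<bar>payoff G i s\<bar> \<le> b"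
        using b by (simp add: G_def multiaffine_game_def D'_def)
    qed
    show "(\<lambda>x. restrict x {..<n}) ` binary_nash_set G = (\<lambda>y. restrict (\<lambda>j. y (X j)) {..<n}) ` ?Y"
    proof (intro equalityI subsetI; elim imageE)
      fix z x assume z: "z = restrict x {..<n}" and x: "x \<in> binary_nash_set G"
      have "(\<lambda>v. x (d v)) \<in> ?Y"
      proof (intro CollectI ballI)
        fix v assume v: "v \<in> V"
        have "x (d v) \<in> {0..1}" using x dN[OF v] unfolding nash by (auto simp: PiE_iff)
        moreover have "(0 < D' (d v) x \<longrightarrow> x (d v) = 1) \<and> (D' (d v) x < 0 \<longrightarrow> x (d v) = 0)"
          using x dN[OF v] unfolding nash by blast
        ultimately show "0 \<le> x (d v) \<and> x (d v) \<le> 1 \<and> (0 < D v (\<lambda>v. x (d v)) \<longrightarrow> x (d v) = 1)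
            \<and> (D v (\<lambda>v. x (d v)) < 0 \<longrightarrow> x (d v) = 0)"
          by (simp add: D'_def ed[OF v])
      qed
      moreover have "z = restrict (\<lambda>j. x (d (X j))) {..<n}"
      proof (unfold z, rule restrict_ext)
        fix j assume "j \<in> {..<n}"
        then show "x j = x (d (X j))" using de[of j] nN by (simp add: e_def)
      qed
      ultimately show "z \<in> (\<lambda>y. restrict (\<lambda>j. y (X j)) {..<n}) ` ?Y" by (intro image_eqI)
    next
      fix z y assume z: "z = restrict (\<lambda>j. y (X j)) {..<n}" and y: "y \<in> ?Y"
      define x where "x = restrict (\<lambda>i. y (e i)) {..<N}"
      have D'x: "D' i x = D (e i) y" if "i < N" for i
        unfolding D'_def using eV[OF that] dN ed
        by (intro multiaffine_on_cong[OF D]) (auto simp: x_def)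
      have "x \<in> binary_nash_set G"
        unfolding nash using y eV D'x by (auto simp: x_def)
      moreover have "z = restrict x {..<n}"
        unfolding z using nN by (intro restrict_ext) (simp add: x_def e_def)
      ultimately show "z \<in> (\<lambda>x. restrict x {..<n}) ` binary_nash_set G" by (intro image_eqI)
    qed
  qed
qed


subsection \<open>The game of a semialgebraic set\<close>

text \<open>Binary expansion of the exponent, peeling off the lowest bit and passing to the square
  of x.\<close>

lemma prod_binary_powers:
  fixes x :: real
  shows "e < 2 ^ b \<Longrightarrow> (\<Prod>k<b. (x ^ (2 ^ k)) ^ (e div 2 ^ k mod 2)) = x ^ e"
proof (induction b arbitrary: e x)
  case 0
  then have "e = 0" by simp
  then show ?case by simp
next
  case (Suc b)
  have "(\<Prod>k<Suc b. (x ^ (2 ^ k)) ^ (e div 2 ^ k mod 2))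
      = x ^ (e mod 2) * (\<Prod>k<b. ((x\<^sup>2) ^ (2 ^ k)) ^ (e div 2 div 2 ^ k mod 2))"
    unfolding prod.lessThan_Suc_shift by (simp only: power_mult[symmetric] div_mult2_eq power_Suc power_0
        div_by_1 power_one_right)
  also have "\<dots> = x ^ (e mod 2) * (x\<^sup>2) ^ (e div 2)"
  proof -
    have "e div 2 < 2 ^ b" using Suc.prems by (simp add: less_mult_imp_div_less)
    then show ?thesis by (simp only: Suc.IH)
  qed
  also have "\<dots> = x ^ (e mod 2 + 2 * (e div 2))"
    unfolding power_add power_mult ..
  also have "e mod 2 + 2 * (e div 2) = e" by (rule mod_mult_div_eq)
  finally show ?case .
qed

text \<open>A variant of matching pennies: \<open>w\<close> is drawn to 1 when \<open>z\<close>
  exceeds \<open>g\<close>, and a large \<open>w\<close> drives \<open>z\<close> to 0. Any deviation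
  of \<open>z\<close> from \<open>g\<close> is thus pushed past \<open>g\<close> to the other end, a
  contradiction.\<close>

lemma gadget_equation:
  fixes z w g :: real
  assumes "0 \<le> z" "z \<le> 1" "0 \<le> g" "g \<le> 1"
    and "0 < z - g \<longrightarrow> w = 1" "z - g < 0 \<longrightarrow> w = 0" "0 < 1 - 2 * w \<longrightarrow> z = 1" "1 - 2 * w < 0 \<longrightarrow> z = 0"
  shows "z = g"
proof (cases z g rule: linorder_cases)
  case less
  then have "w = 0" using assms(6) by simp
  then have "z = 1" using assms(7) by simp
  then show ?thesis using less assms(4) by simp
next
  case greater
  then have "w = 1" using assms(5) by simp
  then have "z = 0" using assms(8) by simp
  then show ?thesis using greater assms(3) by simp
qed

text \<open>Players \<open>PX j\<close> carry the point \<open>x\<close>, \<open>PY j\<close> the offset of \<open>p\<^sub>j\<close> in its isolating interval,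
  \<open>PU a b\<close> the sign of \<open>P\<^sub>a\<^sub>b(x)\<close>, and \<open>PZ t j k c\<close> the power with exponent \<open>2\<^sup>k\<close> of \<open>PY j\<close>
  (if \<open>t\<close>) or \<open>PX j\<close>, twice (\<open>c\<close>) so that it can be squared by a multiaffine function;
  \<open>PW t j k c\<close> compares \<open>PZ t j k c\<close> with its prescribed value.\<close>

datatype player = PX nat | PY nat | PU nat nat | PZ bool nat nat bool | PW bool nat nat bool

definition base :: "bool \<Rightarrow> nat \<Rightarrow> player" where
  "base t j = (if t then PY j else PX j)"

definition players :: "nat \<Rightarrow> nat \<Rightarrow> nat \<Rightarrow> nat \<Rightarrow> player set" where
  "players n l A B = PX ` {..<n} \<union> PY ` {..<n} \<union> (\<lambda>(a, b). PU a b) ` ({1..A} \<times> {1..B}) \<union>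
     (\<lambda>(t, j, k, c). PZ t j k c) ` (UNIV \<times> {..<n} \<times> {..<l} \<times> UNIV) \<union>
     (\<lambda>(t, j, k, c). PW t j k c) ` (UNIV \<times> {..<n} \<times> {..<l} \<times> UNIV)"

lemma players_iff [simp]:
  "PX j \<in> players n l A B \<longleftrightarrow> j < n"
  "PY j \<in> players n l A B \<longleftrightarrow> j < n"
  "PU a b \<in> players n l A B \<longleftrightarrow> a \<in> {1..A} \<and> b \<in> {1..B}"
  "PZ t j k c \<in> players n l A B \<longleftrightarrow> j < n \<and> k < l"
  "PW t j k c \<in> players n l A B \<longleftrightarrow> j < n \<and> k < l"
  by (auto simp: players_def image_iff)

lemma finite_players: "finite (players n l A B)"
  by (simp add: players_def)

lemma card_players: "card (players n l A B) \<le> 2 * n + A * B + 8 * (n * l)"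
proof -
  let ?U = "(\<lambda>(a, b). PU a b) ` ({1..A} \<times> {1..B})"
  let ?Z = "(\<lambda>(t, j, k, c). PZ t j k c) ` (UNIV \<times> {..<n} \<times> {..<l} \<times> UNIV)"
  let ?W = "(\<lambda>(t, j, k, c). PW t j k c) ` (UNIV \<times> {..<n} \<times> {..<l} \<times> UNIV)"
  have "card (PX ` {..<n}) \<le> n" "card (PY ` {..<n}) \<le> n"
    using card_image_le[of "{..<n}"] by simp_all
  moreover have "card ?U \<le> A * B"
    using card_image_le[of "{1..A} \<times> {1..B}"] by (simp add: card_cartesian_product)
  moreover have "card (UNIV \<times> {..<n} \<times> {..<l} \<times> UNIV :: (bool \<times> nat \<times> nat \<times> bool) set) = 4 * (n * l)"
    by (simp add: card_cartesian_product)
  then have "card ?Z \<le> 4 * (n * l)" "card ?W \<le> 4 * (n * l)"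
    using card_image_le[of "UNIV \<times> {..<n} \<times> {..<l} \<times> UNIV :: (bool \<times> nat \<times> nat \<times> bool) set"]
    by (auto intro!: order_trans[OF card_image_le])
  ultimately show ?thesis unfolding players_def
    using card_Un_le[of "PX ` {..<n}" "PY ` {..<n}"] card_Un_le[of "PX ` {..<n} \<union> PY ` {..<n}" ?U]
      card_Un_le[of "PX ` {..<n} \<union> PY ` {..<n} \<union> ?U" ?Z]
      card_Un_le[of "PX ` {..<n} \<union> PY ` {..<n} \<union> ?U \<union> ?Z" ?W] by linarith
qed

text \<open>Stands for the e-th power of the base coordinate, as a product of distinct players and
  hence multiaffine; only the copies marked \<open>False\<close> are used.\<close>

definition bit_power :: "nat \<Rightarrow> bool \<Rightarrow> nat \<Rightarrow> nat \<Rightarrow> (player \<Rightarrow> real) \<Rightarrow> real" where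
  "bit_power l t j e v = (\<Prod>k<l. v (PZ t j k False) ^ (e div 2 ^ k mod 2))"

lemma multiaffine_bit_power:
  "multiaffine_on ((\<lambda>k. PZ t j k False) ` {..<l}) (bit_power l t j e)"
proof -
  have "multiaffine_on (\<Union>k\<in>{..<l}. {PZ t j k False}) (\<lambda>v. \<Prod>k<l. v (PZ t j k False) ^ (e div 2 ^ k mod 2))"
  proof (rule multiaffine_on_prod)
    fix k show "multiaffine_on {PZ t j k False} (\<lambda>v. v (PZ t j k False) ^ (e div 2 ^ k mod 2))"
      by (cases "e div 2 ^ k mod 2 = 0") (auto simp: not_mod_2_eq_0_eq_1)
  qed auto
  then show ?thesis unfolding bit_power_def[abs_def] by (rule multiaffine_on_mono) auto
qed

lemma bit_power_01: "(\<And>u. v u \<in> {0, 1 :: real}) \<Longrightarrow> bit_power l t j e v \<in> {0, 1}"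
proof -
  assume v: "\<And>u. v u \<in> {0, 1 :: real}"
  have pw: "v u ^ i \<in> {0, 1}" for u i using v[of u] by (cases i) auto
  have "(\<Prod>k\<in>K. v (f k) ^ i k) \<in> {0, 1}" for K :: "nat set" and f i
  proof (induction K rule: infinite_finite_induct)
    case (insert k K)
    have "a \<in> {0, 1} \<Longrightarrow> c \<in> {0, 1} \<Longrightarrow> a * c \<in> {0, 1}" for a c :: real by auto
    then have "v (f k) ^ i k * (\<Prod>k\<in>K. v (f k) ^ i k) \<in> {0, 1}" using insert.IH pw by blast
    then show ?case by (simp only: prod.insert[OF insert.hyps])
  qed auto
  then show ?thesis unfolding bit_power_def .
qed

text \<open>A multiaffine substitute for "not in E": the inner product is 1 exactly when all sign
  players of \<open>a\<close> are at 0, and a single such \<open>a\<close> makes the whole product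
  vanish.\<close>

definition witness_test :: "nat \<Rightarrow> nat \<Rightarrow> (player \<Rightarrow> real) \<Rightarrow> real" where
  "witness_test A B v = (\<Prod>a\<in>{1..A}. 1 - (\<Prod>b\<in>{1..B}. 1 - v (PU a b)))"

lemma multiaffine_witness_test:
  "multiaffine_on (\<Union>a\<in>{1..A}. PU a ` {1..B}) (witness_test A B)"
  unfolding witness_test_def[abs_def]
proof (rule multiaffine_on_prod)
  fix a
  have "multiaffine_on (\<Union>b\<in>{1..B}. {PU a b}) (\<lambda>v. \<Prod>b\<in>{1..B}. 1 - v (PU a b))"
    by (intro multiaffine_on_prod multiaffine_on_diff) auto
  then have "multiaffine_on (PU a ` {1..B}) (\<lambda>v. \<Prod>b\<in>{1..B}. 1 - v (PU a b))"
    by (rule multiaffine_on_mono) auto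
  then show "multiaffine_on (PU a ` {1..B}) (\<lambda>v. 1 - (\<Prod>b\<in>{1..B}. 1 - v (PU a b)))"
    by (intro multiaffine_on_diff) auto
qed auto

lemma witness_test_bounds:
  assumes "\<And>a b. a \<in> {1..A} \<Longrightarrow> b \<in> {1..B} \<Longrightarrow> 0 \<le> v (PU a b) \<and> v (PU a b) \<le> 1"
  shows "0 \<le> witness_test A B v" "witness_test A B v \<le> 1"
    and "witness_test A B v = 0 \<longleftrightarrow> (\<exists>a\<in>{1..A}. \<forall>b\<in>{1..B}. v (PU a b) = 0)"
proof -
  let ?q = "\<lambda>a. \<Prod>b\<in>{1..B}. 1 - v (PU a b)"
  have q: "0 \<le> ?q a" "?q a \<le> 1" if "a \<in> {1..A}" for a
    using assms that by (auto intro!: prod_nonneg prod_le_1)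
  show "0 \<le> witness_test A B v" "witness_test A B v \<le> 1"
    unfolding witness_test_def using q by (auto intro!: prod_nonneg prod_le_1)
  have q1: "?q a = 1 \<longleftrightarrow> (\<forall>b\<in>{1..B}. v (PU a b) = 0)" if a: "a \<in> {1..A}" for a
  proof
    assume 1: "?q a = 1"
    show "\<forall>b\<in>{1..B}. v (PU a b) = 0"
    proof
      fix b assume b: "b \<in> {1..B}"
      have "?q a = (1 - v (PU a b)) * (\<Prod>b\<in>{1..B} - {b}. 1 - v (PU a b))"
        using b by (subst prod.remove[of _ b]) auto
      also have "\<dots> \<le> (1 - v (PU a b)) * 1"
        using assms a b by (intro mult_left_mono prod_le_1) auto
      finally show "v (PU a b) = 0" using 1 assms[OF a b] by simp
    qed
  qed simp
  have "witness_test A B v = 0 \<longleftrightarrow> (\<exists>a\<in>{1..A}. ?q a = 1)"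
    unfolding witness_test_def by (simp add: prod_zero_iff)
  then show "witness_test A B v = 0 \<longleftrightarrow> (\<exists>a\<in>{1..A}. \<forall>b\<in>{1..B}. v (PU a b) = 0)"
    using q1 by auto
qed


section \<open>Incentives of the players and the resulting equilibria\<close>

definition target :: "bool \<Rightarrow> nat \<Rightarrow> nat \<Rightarrow> (player \<Rightarrow> real) \<Rightarrow> real" where
  "target t j k v = (case k of 0 \<Rightarrow> v (base t j) | Suc i \<Rightarrow> v (PZ t j i False) * v (PZ t j i True))"

locale sign_game =
  fixes n d l A B :: nat and M \<beta> :: real and P :: "nat \<Rightarrow> nat \<Rightarrow> int_mpoly"
    and E :: "(nat \<Rightarrow> real) set" and p \<eta> :: "nat \<Rightarrow> real" and \<kappa> S :: "nat \<Rightarrow> nat" and r :: "nat \<Rightarrow> int poly"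
  assumes P: "\<And>a b. a \<in> {1..A} \<Longrightarrow> b \<in> {1..B} \<Longrightarrow> P a b \<in> bounded_polys n d M"
    and l: "1 \<le> l" "d < 2 ^ l"
    and E: "E = (\<Union>a\<in>{1..A}. \<Inter>b\<in>{1..B}. {x \<in> {..<n} \<rightarrow>\<^sub>E UNIV. eval_mpoly (P a b) x \<le> 0})"
    and E01: "E \<subseteq> {..<n} \<rightarrow>\<^sub>E {0..1}" and p: "p \<in> E"
    and S: "\<And>j. j < n \<Longrightarrow> 1 \<le> S j" "\<And>j. j < n \<Longrightarrow> \<kappa> j \<le> S j"
      "\<And>j. j < n \<Longrightarrow> real (S j) * p j = real (\<kappa> j) + \<eta> j"
    and \<eta>: "\<And>j. j < n \<Longrightarrow> 0 \<le> \<eta> j" "\<And>j. j < n \<Longrightarrow> \<eta> j \<le> 1"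
    and r: "\<And>j. j < n \<Longrightarrow> degree (r j) < 2 ^ l" "\<And>j. j < n \<Longrightarrow> rpoly (r j) (\<eta> j) = 0"
      "\<And>j z. j < n \<Longrightarrow> 0 \<le> z \<Longrightarrow> z < \<eta> j \<Longrightarrow> rpoly (r j) z < 0"
      "\<And>j z. j < n \<Longrightarrow> \<eta> j < z \<Longrightarrow> z \<le> 1 \<Longrightarrow> rpoly (r j) z > 0"
    and \<beta>: "1 \<le> \<beta>" "\<And>j. j < n \<Longrightarrow> real (S j) + 1 \<le> \<beta>" "\<And>j. j < n \<Longrightarrow> height (r j) \<le> \<beta>"
      "real ((d + 1) ^ n) * M \<le> \<beta>"
begin

text \<open>Once \<open>PY j\<close> sits at \<open>\<eta> j\<close> and the powers are correct, the
  incentive of \<open>PX j\<close> is the test times S (p - x). Its own coordinate is read from the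
  copy \<open>PZ False j 0 False\<close>, because an incentive may not involve the player's own
  variable.\<close>

fun D :: "player \<Rightarrow> (player \<Rightarrow> real) \<Rightarrow> real" where
  "D (PX j) v = witness_test A B v * (real (\<kappa> j) + v (PY j) - real (S j) * v (PZ False j 0 False))"
| "D (PY j) v = (\<Sum>e\<le>degree (r j). - of_int (coeff (r j) e) * bit_power l True j e v)"
| "D (PU a b) v = (\<Sum>m\<in>mons n d. of_int (Poly_Mapping.lookup (P a b) m) *
     (\<Prod>j<n. bit_power l False j (Poly_Mapping.lookup m j) v))"
| "D (PZ t j k c) v = 1 - 2 * v (PW t j k c)"
| "D (PW t j k c) v = v (PZ t j k c) - target t j k v"

lemma multiaffine_D:
  assumes u: "u \<in> players n l A B"
  shows "multiaffine_on (players n l A B - {u}) (D u)"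
proof (cases u)
  case (PX j)
  have "multiaffine_on {PY j, PZ False j 0 False} (\<lambda>v. real (\<kappa> j) + v (PY j) - real (S j) * v (PZ False j 0 False))"
    by (intro multiaffine_on_diff multiaffine_on_add multiaffine_on_cmult multiaffine_on_const multiaffine_on_var) auto
  then have "multiaffine_on ((\<Union>a\<in>{1..A}. PU a ` {1..B}) \<union> {PY j, PZ False j 0 False}) (D u)"
    unfolding PX D.simps by (intro multiaffine_on_mult multiaffine_witness_test) auto
  then show ?thesis by (rule multiaffine_on_mono) (use u l PX in auto)
next
  case (PY j)
  have "multiaffine_on ((\<lambda>k. PZ True j k False) ` {..<l}) (D u)"
    unfolding PY D.simps by (intro multiaffine_on_sum multiaffine_on_cmult multiaffine_bit_power)
  then show ?thesis by (rule multiaffine_on_mono) (use u PY in auto)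
next
  case (PU a b)
  have "multiaffine_on (\<Union>j\<in>{..<n}. (\<lambda>k. PZ False j k False) ` {..<l}) (D u)"
    unfolding PU D.simps
    by (intro multiaffine_on_sum multiaffine_on_cmult multiaffine_on_prod multiaffine_bit_power) auto
  then show ?thesis by (rule multiaffine_on_mono) (use u PU in auto)
next
  case (PZ t j k c)
  have "multiaffine_on {PW t j k c} (D u)"
    unfolding PZ D.simps
    by (intro multiaffine_on_diff multiaffine_on_cmult multiaffine_on_const multiaffine_on_var) auto
  then show ?thesis by (rule multiaffine_on_mono) (use u PZ in auto)
next
  case (PW t j k c)
  show ?thesis
  proof (cases k)
    case 0
    have "multiaffine_on {PZ t j k c, base t j} (D u)"
      unfolding PW D.simps target_def 0 by (simp, intro multiaffine_on_diff multiaffine_on_var) auto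
    then show ?thesis by (rule multiaffine_on_mono) (use u PW in \<open>auto simp: base_def\<close>)
  next
    case (Suc i)
    have "multiaffine_on ({PZ t j i False} \<union> {PZ t j i True}) (\<lambda>v. v (PZ t j i False) * v (PZ t j i True))"
      by (intro multiaffine_on_mult multiaffine_on_var) auto
    then have "multiaffine_on {PZ t j k c, PZ t j i False, PZ t j i True} (\<lambda>v. v (PZ t j i False) * v (PZ t j i True))"
      by (rule multiaffine_on_mono) auto
    then have "multiaffine_on {PZ t j k c, PZ t j i False, PZ t j i True} (D u)"
      unfolding PW D.simps target_def Suc by (simp, intro multiaffine_on_diff multiaffine_on_var) auto
    then show ?thesis by (rule multiaffine_on_mono) (use u PW Suc in auto)
  qed
qed

text \<open>At 0/1 points all products of players are 0 or 1, so coefficient sums bound the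
  polynomial incentives. For \<open>PX\<close> the linear factor lies between -S and S + 1, which is
  why \<open>\<beta>\<close> dominates S + 1.\<close>

lemma payoff_bound:
  assumes u: "u \<in> players n l A B" and v: "\<And>u. v u \<in> {0, 1}"
  shows "D u v \<in> \<int> \<and> \<bar>D u v\<bar> \<le> \<beta>"
proof -
  have vI: "v u \<in> \<int>" "0 \<le> v u" "v u \<le> 1" for u using v[of u] by auto
  have bp: "bit_power l t j e v \<in> \<int>" "0 \<le> bit_power l t j e v" "bit_power l t j e v \<le> 1" for t j e
    using bit_power_01[of v l t j e] v by auto
  show ?thesis
  proof (cases u)
    case (PX j)
    have j: "j < n" using u PX by simp
    have w: "0 \<le> witness_test A B v" "witness_test A B v \<le> 1"
      using vI by (auto intro!: witness_test_bounds)
    have wI: "witness_test A B v \<in> \<int>"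
      unfolding witness_test_def using vI by (auto intro!: Ints_prod Ints_diff)
    define q where "q = real (\<kappa> j) + v (PY j) - real (S j) * v (PZ False j 0 False)"
    have "real (\<kappa> j) \<le> real (S j)" using S(2)[OF j] by simp
    moreover have "real (S j) * v (PZ False j 0 False) \<le> real (S j) * 1"
      using vI by (intro mult_left_mono) auto
    moreover have "0 \<le> real (S j) * v (PZ False j 0 False)" using vI by simp
    ultimately have q: "\<bar>q\<bar> \<le> \<beta>"
      using \<beta>(2)[OF j] vI[of "PY j"] unfolding q_def by linarith
    have "q \<in> \<int>" unfolding q_def using vI by (intro Ints_diff Ints_add Ints_mult) auto
    then have "D u v \<in> \<int>" using wI by (simp add: PX q_def[symmetric])
    moreover have "\<bar>D u v\<bar> \<le> 1 * \<beta>"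
      unfolding PX D.simps q_def[symmetric] abs_mult using w q by (intro mult_mono) auto
    ultimately show ?thesis by simp
  next
    case (PY j)
    have j: "j < n" using u PY by simp
    have "\<bar>D u v\<bar> \<le> (\<Sum>e\<le>degree (r j). real_of_int \<bar>coeff (r j) e\<bar> * 1)"
      unfolding PY D.simps
    proof (rule order_trans[OF sum_abs], rule sum_mono)
      fix e
      have "\<bar>real_of_int (coeff (r j) e)\<bar> * \<bar>bit_power l True j e v\<bar> \<le> \<bar>real_of_int (coeff (r j) e)\<bar> * 1"
        using bp[of True j e] by (intro mult_left_mono) auto
      then show "\<bar>- of_int (coeff (r j) e) * bit_power l True j e v\<bar> \<le> real_of_int \<bar>coeff (r j) e\<bar> * 1"
        by (simp add: abs_mult)
    qed
    also have "\<dots> \<le> \<beta>" using height_altdef[of "r j" "degree (r j)"] \<beta>(3)[OF j] by simp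
    finally show ?thesis using bp by (auto simp: PY intro!: Ints_sum Ints_mult Ints_minus)
  next
    case (PU a b)
    have ab: "P a b \<in> bounded_polys n d M" using u PU P by simp
    have pr: "0 \<le> (\<Prod>j<n. bit_power l False j (f j) v)" "(\<Prod>j<n. bit_power l False j (f j) v) \<le> 1" for f
      using bp by (auto intro!: prod_nonneg prod_le_1)
    have "\<bar>D u v\<bar> \<le> (\<Sum>m\<in>mons n d. real_of_int \<bar>Poly_Mapping.lookup (P a b) m\<bar>)"
      unfolding PU D.simps
    proof (rule order_trans[OF sum_abs], rule sum_mono)
      fix m
      let ?q = "\<Prod>j<n. bit_power l False j (Poly_Mapping.lookup m j) v"
      have "\<bar>real_of_int (Poly_Mapping.lookup (P a b) m)\<bar> * \<bar>?q\<bar> \<le> \<bar>real_of_int (Poly_Mapping.lookup (P a b) m)\<bar> * 1"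
        using pr[of "Poly_Mapping.lookup m"] by (intro mult_left_mono) auto
      then show "\<bar>of_int (Poly_Mapping.lookup (P a b) m) * ?q\<bar> \<le> real_of_int \<bar>Poly_Mapping.lookup (P a b) m\<bar>"
        by (simp add: abs_mult)
    qed
    also have "\<dots> \<le> \<beta>" using coeff_sum_bound[OF ab] \<beta>(4) by linarith
    finally show ?thesis using bp by (auto simp: PU intro!: Ints_sum Ints_mult Ints_prod)
  next
    case (PZ t j k c)
    then show ?thesis using v[of "PW t j k c"] \<beta>(1) by auto
  next
    case (PW t j k c)
    have "target t j k v \<in> {0, 1}"
      using v[of "base t j"] v[of "PZ t j (k - 1) False"] v[of "PZ t j (k - 1) True"]
      by (cases k) (auto simp: target_def)
    then show ?thesis using v[of "PZ t j k c"] \<beta>(1) by (auto simp: PW)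
  qed
qed

definition equilibria :: "(player \<Rightarrow> real) set" where
  "equilibria = {y. \<forall>v\<in>players n l A B. 0 \<le> y v \<and> y v \<le> 1 \<and>
     (0 < D v y \<longrightarrow> y v = 1) \<and> (D v y < 0 \<longrightarrow> y v = 0)}"

lemma D_PY_eq:
  assumes z: "\<And>k. k < l \<Longrightarrow> y (PZ True j k False) = y (PY j) ^ (2 ^ k)" and j: "j < n"
  shows "D (PY j) y = - rpoly (r j) (y (PY j))"
proof -
  have "bit_power l True j e y = y (PY j) ^ e" if "e \<le> degree (r j)" for e
    unfolding bit_power_def using z r(1)[OF j] that by (simp add: prod_binary_powers)
  then show ?thesis by (simp add: rpoly_altdef sum_negf)
qed

lemma D_PU_eq:
  assumes z: "\<And>j k. j < n \<Longrightarrow> k < l \<Longrightarrow> y (PZ False j k False) = y (PX j) ^ (2 ^ k)"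
    and ab: "a \<in> {1..A}" "b \<in> {1..B}"
  shows "D (PU a b) y = eval_mpoly (P a b) (restrict (\<lambda>j. y (PX j)) {..<n})"
proof -
  have bp: "bit_power l False j e y = y (PX j) ^ e" if "e \<le> d" "j < n" for e j
    unfolding bit_power_def using z l(2) that by (simp add: prod_binary_powers)
  have "(\<Prod>j<n. bit_power l False j (Poly_Mapping.lookup m j) y)
      = monval n (Poly_Mapping.lookup m) (restrict (\<lambda>j. y (PX j)) {..<n})" if "m \<in> mons n d" for m
    unfolding monval_def using that by (intro prod.cong) (auto simp: bp mons_def)
  then show ?thesis by (simp add: eval_mpoly_monval[OF P[OF ab]])
qed

text \<open>The gadget forces each \<open>PZ\<close> to its target, which lies in [0,1]; the
  induction is over both copies \<open>c\<close> because the next power is the product of the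
  two.\<close>

lemma equilibrium_powers:
  assumes y: "y \<in> equilibria" and j: "j < n" and k: "k < l"
  shows "y (PZ t j k c) = y (base t j) ^ (2 ^ k)"
  using k
proof (induction k arbitrary: c)
  have ran: "0 \<le> y v \<and> y v \<le> 1" if "v \<in> players n l A B" for v
    using y that by (simp add: equilibria_def)
  have step: "y (PZ t j k c) = target t j k y" if k: "k < l" and t: "0 \<le> target t j k y" "target t j k y \<le> 1" for k c
  proof -
    have "PZ t j k c \<in> players n l A B" "PW t j k c \<in> players n l A B" using j k by simp_all
    then have "0 \<le> y (PZ t j k c) \<and> y (PZ t j k c) \<le> 1 \<and>
        (0 < D (PZ t j k c) y \<longrightarrow> y (PZ t j k c) = 1) \<and> (D (PZ t j k c) y < 0 \<longrightarrow> y (PZ t j k c) = 0)"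
      "(0 < D (PW t j k c) y \<longrightarrow> y (PW t j k c) = 1) \<and> (D (PW t j k c) y < 0 \<longrightarrow> y (PW t j k c) = 0)"
      using y unfolding equilibria_def by blast+
    then show ?thesis
      using t unfolding D.simps by (intro gadget_equation[of _ _ "y (PW t j k c)"]) blast+
  qed
  have b: "0 \<le> y (base t j)" "y (base t j) \<le> 1" using ran[of "base t j"] j by (auto simp: base_def)
  {
    case 0
    show ?case using step[of 0 c] 0 b by (simp add: target_def)
  next
    case (Suc k)
    have "target t j (Suc k) y = y (base t j) ^ (2 ^ k) * y (base t j) ^ (2 ^ k)"
      using Suc by (simp add: target_def)
    also have "\<dots> = y (base t j) ^ (2 ^ Suc k)" by (simp add: power_add[symmetric] mult_2)
    finally have t: "target t j (Suc k) y = y (base t j) ^ (2 ^ Suc k)" .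
    show ?case using step[of "Suc k" c] Suc.prems b by (simp add: t power_le_one)
  }
qed

text \<open>If the test vanishes, some \<open>a\<close> has all sign players at 0, which excludes
  positive values of its constraints. Otherwise the drive is active and holds the point at
  \<open>p\<close>, itself in \<open>E\<close>.\<close>

lemma equilibrium_in_E:
  assumes y: "y \<in> equilibria"
  shows "restrict (\<lambda>j. y (PX j)) {..<n} \<in> E"
proof -
  let ?x = "restrict (\<lambda>j. y (PX j)) {..<n}"
  have eq: "0 \<le> y v" "y v \<le> 1" "0 < D v y \<Longrightarrow> y v = 1" "D v y < 0 \<Longrightarrow> y v = 0" if "v \<in> players n l A B" for v
    using y that by (simp_all add: equilibria_def)
  have zX: "y (PZ False j k c) = y (PX j) ^ (2 ^ k)" and zY: "y (PZ True j k c) = y (PY j) ^ (2 ^ k)"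
    if "j < n" "k < l" for j k c
    using equilibrium_powers[OF y that, of _ c] by (auto simp: base_def)
  have w: "0 \<le> witness_test A B y"
    "witness_test A B y = 0 \<longleftrightarrow> (\<exists>a\<in>{1..A}. \<forall>b\<in>{1..B}. y (PU a b) = 0)"
    using witness_test_bounds(1,3)[of A B y] eq(1,2) by simp_all
  show ?thesis
  proof (cases "witness_test A B y = 0")
    case True
    then obtain a where a: "a \<in> {1..A}" "\<forall>b\<in>{1..B}. y (PU a b) = 0" using w(2) by blast
    have "eval_mpoly (P a b) ?x \<le> 0" if b: "b \<in> {1..B}" for b
    proof (rule ccontr)
      assume "\<not> eval_mpoly (P a b) ?x \<le> 0"
      then have "0 < D (PU a b) y" using D_PU_eq[OF zX a(1) b] by simp
      then have "y (PU a b) = 1" using a(1) b by (intro eq(3)) auto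
      then show False using a(2) b by simp
    qed
    then have "?x \<in> (\<Inter>b\<in>{1..B}. {x \<in> {..<n} \<rightarrow>\<^sub>E UNIV. eval_mpoly (P a b) x \<le> 0})"
      by simp
    then show ?thesis unfolding E by (rule UN_I[OF a(1)])
  next
    case False
    then have w0: "0 < witness_test A B y" using w(1) by simp
    have "y (PX j) = p j" if j: "j < n" for j
    proof -
      have Vj: "PX j \<in> players n l A B" "PY j \<in> players n l A B" using j by auto
      have DY: "D (PY j) y = - rpoly (r j) (y (PY j))" by (rule D_PY_eq) (use zY j in simp_all)
      \<comment> \<open>The polynomial is negative below and positive above \<open>\<eta> j\<close>,
        so any other position would push the player to the opposite end of [0,1].\<close>
      have \<eta>y: "y (PY j) = \<eta> j"
      proof (cases "y (PY j)" "\<eta> j" rule: linorder_cases)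
        case less
        then have "0 < D (PY j) y" using r(3)[OF j eq(1)[OF Vj(2)]] DY by simp
        then have "y (PY j) = 1" by (rule eq(3)[OF Vj(2)])
        then show ?thesis using less \<eta>(2)[OF j] by simp
      next
        case greater
        then have "D (PY j) y < 0" using r(4)[OF j _ eq(2)[OF Vj(2)]] DY by simp
        then have "y (PY j) = 0" by (rule eq(4)[OF Vj(2)])
        then show ?thesis using greater \<eta>(1)[OF j] by simp
      qed
      have Spos: "0 < real (S j)" using S(1)[OF j] by simp
      have "D (PX j) y = witness_test A B y * (real (S j) * p j - real (S j) * y (PX j))"
        using zX[OF j, of 0 False] l(1) S(3)[OF j] \<eta>y by simp
      then have DX: "D (PX j) y = (witness_test A B y * real (S j)) * (p j - y (PX j))"
        by (simp add: algebra_simps)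
      have pos: "0 < witness_test A B y * real (S j)" using w0 Spos by simp
      have p01: "0 \<le> p j" "p j \<le> 1" using p E01 j by (auto simp: PiE_iff subset_iff)
      show ?thesis
      proof (cases "y (PX j)" "p j" rule: linorder_cases)
        case less
        then have "0 < D (PX j) y" unfolding DX using pos by simp
        then have "y (PX j) = 1" by (rule eq(3)[OF Vj(1)])
        then show ?thesis using less p01 by simp
      next
        case greater
        then have "D (PX j) y < 0" unfolding DX using pos by (simp add: mult_pos_neg)
        then have "y (PX j) = 0" by (rule eq(4)[OF Vj(1)])
        then show ?thesis using greater p01 by simp
      qed
    qed
    then have "?x = restrict p {..<n}" by (intro restrict_ext) simp
    also have "\<dots> = p" using p E01 by (intro extensional_restrict) (auto simp: PiE_def)
    finally show ?thesis using p by simp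
  qed
qed

lemma equilibrium_exists:
  assumes x: "x \<in> E"
  obtains y where "y \<in> equilibria" "x = restrict (\<lambda>j. y (PX j)) {..<n}"
proof -
  have x01: "0 \<le> x j" "x j \<le> 1" if "j < n" for j
    using x E01 that by (auto simp: PiE_iff subset_iff)
  have xext: "restrict x {..<n} = x" using x E01 by (intro extensional_restrict) (auto simp: PiE_def)
  obtain a0 where a0: "a0 \<in> {1..A}" "\<forall>b\<in>{1..B}. eval_mpoly (P a0 b) x \<le> 0"
    using x unfolding E by auto
  \<comment> \<open>Since x satisfies all constraints of \<open>a0\<close>, the test is 0 and every
    \<open>PX\<close> is indifferent. The value 1/2 of \<open>PW\<close> makes \<open>PZ\<close>
    indifferent, exact powers make \<open>PW\<close> indifferent, and \<open>PY\<close> is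
    indifferent at its root.\<close>
  define y where "y v = (case v of PX j \<Rightarrow> x j | PY j \<Rightarrow> \<eta> j
    | PU a b \<Rightarrow> (if 0 < eval_mpoly (P a b) x then 1 else 0)
    | PZ t j k c \<Rightarrow> (if t then \<eta> j else x j) ^ (2 ^ k) | PW t j k c \<Rightarrow> 1 / 2)" for v
  have y: "y (PX j) = x j" "y (PY j) = \<eta> j" "y (PU a b) = (if 0 < eval_mpoly (P a b) x then 1 else 0)"
    "y (PZ t j k c) = (if t then \<eta> j else x j) ^ (2 ^ k)" "y (PW t j k c) = 1 / 2" for j a b t k c
    by (simp_all add: y_def)
  have ran: "0 \<le> y v" "y v \<le> 1" if "v \<in> players n l A B" for v
    using that x01 \<eta> by (cases v; simp add: y power_le_one)+
  have w: "witness_test A B y = 0"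
  proof -
    have "\<exists>a\<in>{1..A}. \<forall>b\<in>{1..B}. y (PU a b) = 0" using a0 by (auto simp: y not_less)
    then show ?thesis using witness_test_bounds(3)[of A B y] ran by simp
  qed
  have D0: "(0 < D v y \<longrightarrow> y v = 1) \<and> (D v y < 0 \<longrightarrow> y v = 0)" if v: "v \<in> players n l A B" for v
  proof (cases v)
    case (PX j)
    then show ?thesis using w by simp
  next
    case (PY j)
    then have j: "j < n" using v by simp
    have "D (PY j) y = 0" using D_PY_eq[of y j, OF _ j] r(2)[OF j] by (simp only: y if_True simp_thms)
    then show ?thesis using PY by simp
  next
    case (PU a b)
    then have "D (PU a b) y = eval_mpoly (P a b) x"
      using v by (subst D_PU_eq) (auto simp: y xext)
    then show ?thesis using PU by (simp only: y) auto
  next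
    case (PZ t j k c)
    then show ?thesis by (simp add: y)
  next
    case (PW t j k c)
    have "target t j k y = y (PZ t j k c)"
      by (cases k; cases t) (simp_all add: target_def base_def y power_add[symmetric] mult_2)
    then show ?thesis using PW by simp
  qed
  have "y \<in> equilibria" using ran D0 by (simp add: equilibria_def)
  moreover have "x = restrict (\<lambda>j. y (PX j)) {..<n}" using xext by (simp add: y)
  ultimately show thesis by (rule that)
qed

lemma game_exists:
  "\<exists>G N. binary_game G \<and> num_players G = N \<and> n \<le> N \<and>
    (\<forall>i<N. \<forall>s\<in>pure_profiles G. payoff G i s \<in> \<int> \<and> \<bar>payoff G i s\<bar> \<le> \<beta>) \<and>
    N \<le> 2 * n + A * B + 8 * (n * l) \<and> (\<lambda>x. restrict x {..<n}) ` binary_nash_set G = E"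
proof -
  have inj: "inj_on PX {..<n}" by (simp add: inj_on_def)
  have sub: "PX ` {..<n} \<subseteq> players n l A B" by auto
  obtain G where G: "binary_game G" "num_players G = card (players n l A B)" "n \<le> card (players n l A B)"
    "\<forall>i<card (players n l A B). \<forall>s\<in>pure_profiles G. payoff G i s \<in> \<int> \<and> \<bar>payoff G i s\<bar> \<le> \<beta>"
    "(\<lambda>x. restrict x {..<n}) ` binary_nash_set G =
     (\<lambda>y. restrict (\<lambda>j. y (PX j)) {..<n}) ` {y. \<forall>v\<in>players n l A B. 0 \<le> y v \<and> y v \<le> 1 \<and>
       (0 < D v y \<longrightarrow> y v = 1) \<and> (D v y < 0 \<longrightarrow> y v = 0)}"
    by (rule game_from_multiaffine_family[OF finite_players inj sub multiaffine_D payoff_bound])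
      (use \<beta>(1) in auto)
  have "(\<lambda>y. restrict (\<lambda>j. y (PX j)) {..<n}) ` equilibria = E"
  proof
    show "(\<lambda>y. restrict (\<lambda>j. y (PX j)) {..<n}) ` equilibria \<subseteq> E" using equilibrium_in_E by blast
    show "E \<subseteq> (\<lambda>y. restrict (\<lambda>j. y (PX j)) {..<n}) ` equilibria"
    proof
      fix x assume "x \<in> E"
      then obtain y where "y \<in> equilibria" "x = restrict (\<lambda>j. y (PX j)) {..<n}" by (rule equilibrium_exists)
      then show "x \<in> (\<lambda>y. restrict (\<lambda>j. y (PX j)) {..<n}) ` equilibria" by (intro image_eqI)
    qed
  qed
  then have "(\<lambda>x. restrict x {..<n}) ` binary_nash_set G = E"
    using G(5) by (simp only: equilibria_def)
  then show ?thesis using G(1-4) card_players[of n l A B] by blast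
qed

end


subsection \<open>Bounds\<close>

text \<open>Bookkeeping for crude bounds, used with b = nd(M + 1) and t = (nd)^n. A sum or product
  needs only an index above those of its operands, and a power with exponent at most t^c adds c.
  Indices such as 16 and 33 are running totals of these costs.\<close>

locale tower =
  fixes b :: real and t :: nat
  assumes b: "2 \<le> b" and t: "2 \<le> t"
begin

definition T :: "nat \<Rightarrow> real" where "T c = b ^ (t ^ c)"

lemma T_mono: "a \<le> c \<Longrightarrow> T a \<le> T c"
  unfolding T_def using b t by (intro power_increasing) auto

lemma T_ge: "2 \<le> T a"
proof -
  have "b ^ 1 \<le> b ^ (t ^ a)" using b t by (intro power_increasing) auto
  then show ?thesis using b by (simp add: T_def)
qed

lemma T_le: "x \<le> T a \<Longrightarrow> a \<le> c \<Longrightarrow> x \<le> T c"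
  using T_mono[of a c] by simp

lemma T_mult:
  assumes "x \<le> T a" "y \<le> T c" "0 \<le> y" "a < e" "c < e"
  shows "x * y \<le> T e"
proof -
  have "x * y \<le> T (e - 1) * T (e - 1)"
    using assms T_ge[of "e - 1"] by (intro mult_mono T_le[OF assms(1)] T_le[OF assms(2)]) auto
  also have "\<dots> = b ^ (2 * t ^ (e - 1))" by (simp add: T_def mult_2 power_add)
  also have "\<dots> \<le> b ^ (t ^ e)"
    using b t assms(4) by (intro power_increasing) (cases e; simp)+
  finally show ?thesis by (simp add: T_def)
qed

lemma T_add:
  assumes "x \<le> T a" "y \<le> T c" "a < e" "c < e"
  shows "x + y \<le> T e"
proof -
  have "x + y \<le> 2 * T (e - 1)"
  proof -
    have "x \<le> T (e - 1)" "y \<le> T (e - 1)"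
      using assms(3,4) by (intro T_le[OF assms(1)] T_le[OF assms(2)]; simp)+
    then show ?thesis by simp
  qed
  also have "\<dots> \<le> T e" using T_ge[of "e - 1"] assms by (intro T_mult[of _ "e - 1" _ "e - 1"]) auto
  finally show ?thesis .
qed

lemma T_power:
  assumes "0 \<le> x" "x \<le> T a" "k \<le> t ^ c"
  shows "x ^ k \<le> T (a + c)"
proof -
  have "x ^ k \<le> T a ^ k" using assms by (intro power_mono) auto
  also have "\<dots> \<le> T a ^ (t ^ c)" using T_ge[of a] assms by (intro power_increasing) auto
  also have "\<dots> = T (a + c)" by (simp add: T_def power_mult[symmetric] power_add)
  finally show ?thesis .
qed

lemma T_nat:
  assumes "k \<le> t ^ c" shows "real k \<le> T c"
proof -
  have "real k \<le> 2 ^ k" using of_nat_less_two_power[of k, where 'a = real] by simp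
  also have "\<dots> \<le> b ^ k" using b by (intro power_mono) auto
  also have "\<dots> \<le> T c" unfolding T_def using b assms by (intro power_increasing) auto
  finally show ?thesis .
qed

lemma T_fact:
  assumes "k \<le> t ^ c" shows "fact k \<le> T (c + c)"
proof -
  have "fact k \<le> real k ^ k" using fact_le_power[of k, where 'a = real] by simp
  also have "\<dots> \<le> T (c + c)" using assms by (intro T_power T_nat) auto
  finally show ?thesis .
qed

lemma coordinate_height_bound:
  assumes d: "real ((d + 1) ^ n) \<le> T 2" "(d + 1) ^ n \<le> t ^ 2" "2 * d \<le> t ^ 2"
    and M: "0 \<le> M" "2 * M + 1 \<le> T 0" and m: "n * m \<le> t ^ 4" "m ^ n \<le> t ^ 3"
  shows "fact (m ^ n) * (1 + (1 + 2 * real d * ((2 * M + 1) ^ ((d + 1) ^ n) * (real ((d + 1) ^ n) * M)^2)) ^ (n * m)) ^ m ^ n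
    \<le> T 16"
proof -
  define h where "h = 2 * real d * ((2 * M + 1) ^ ((d + 1) ^ n) * (real ((d + 1) ^ n) * M)^2)"
  have M0: "M \<le> T 0" using M by linarith
  have "real ((d + 1) ^ n) * M \<le> T 3" using d(1) M0 M(1) by (rule T_mult) simp_all
  then have "(real ((d + 1) ^ n) * M)^2 \<le> T (3 + 1)"
    using M(1) t by (intro T_power) auto
  moreover have "(2 * M + 1) ^ ((d + 1) ^ n) \<le> T (0 + 2)"
    using M d(2) by (intro T_power) auto
  ultimately have 5: "(2 * M + 1) ^ ((d + 1) ^ n) * (real ((d + 1) ^ n) * M)^2 \<le> T 5"
    by (intro T_mult[of _ "0 + 2" _ "3 + 1"]) simp_all
  have "2 * real d \<le> T 2" using T_nat[OF d(3)] by simp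
  then have "h \<le> T 6" unfolding h_def using 5 by (rule T_mult) (use M(1) in simp_all)
  have h0: "0 \<le> h" unfolding h_def using M(1) by simp
  have one: "1 \<le> T 0" using T_ge[of 0] by simp
  have "1 + h \<le> T 7" using one \<open>h \<le> T 6\<close> by (rule T_add) simp_all
  then have "(1 + h) ^ (n * m) \<le> T (7 + 4)" using h0 m(1) by (intro T_power) auto
  then have "1 + (1 + h) ^ (n * m) \<le> T 12" using one by (intro T_add[of _ 0 _ "7 + 4"]) simp_all
  then have "(1 + (1 + h) ^ (n * m)) ^ m ^ n \<le> T (12 + 3)" using h0 m(2) by (intro T_power) auto
  moreover have "fact (m ^ n) \<le> T (3 + 3)" using m(2) by (rule T_fact)
  ultimately show ?thesis unfolding h_def[symmetric] using h0
    by (intro T_mult[of _ "3 + 3" _ "12 + 3"]) simp_all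
qed

lemma isolation_height_bound:
  assumes L: "L \<le> t ^ 3" and H: "0 \<le> H" "H \<le> T 16"
    and S: "real S \<le> real L ^ L * H * (fact (L^2) * (1 + 2 * (real L ^ L * H)) ^ L^2) + 1"
  shows "real S + 1 \<le> T 33" "real L ^ L * H * real (Suc S) ^ L \<le> T 33"
proof -
  define h4 where "h4 = real L ^ L * H"
  have "real L ^ L \<le> T (3 + 3)" using L by (intro T_power T_nat) auto
  then have h4: "h4 \<le> T 17" unfolding h4_def using H by (intro T_mult[of _ "3 + 3" _ 16]) simp_all
  have h40: "0 \<le> h4" unfolding h4_def using H by simp
  have one: "1 \<le> T 0" "2 \<le> T 0" using T_ge[of 0] by simp_all
  have "(L ^ 2) \<le> (t ^ 3) ^ 2" using L by (intro power_mono) auto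
  then have L2: "L ^ 2 \<le> t ^ 6" by (simp add: power_mult[symmetric])
  have "2 * h4 \<le> T 18" using one(2) h4 h40 by (rule T_mult) simp_all
  with one(1) have "1 + 2 * h4 \<le> T 19" by (rule T_add) simp_all
  then have "(1 + 2 * h4) ^ L^2 \<le> T (19 + 6)" using h40 L2 by (intro T_power) auto
  moreover have "fact (L^2) \<le> T (6 + 6)" using L2 by (rule T_fact)
  ultimately have f: "fact (L^2) * (1 + 2 * h4) ^ L^2 \<le> T 26"
    using h40 by (intro T_mult[of _ "6 + 6" _ "19 + 6"]) simp_all
  have "h4 * (fact (L^2) * (1 + 2 * h4) ^ L^2) \<le> T 27"
    using h4 f by (rule T_mult) (use h40 in simp_all)
  then have "h4 * (fact (L^2) * (1 + 2 * h4) ^ L^2) + 1 \<le> T 28"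
    using one(1) by (rule T_add) simp_all
  then have "real S \<le> T 28" using S unfolding h4_def by linarith
  then have S1: "real S + 1 \<le> T 29" using one(1) by (rule T_add) simp_all
  then show "real S + 1 \<le> T 33" by (rule T_le) simp
  have S2: "real (Suc S) ^ L \<le> T (29 + 3)" using S1 L by (intro T_power) auto
  show "real L ^ L * H * real (Suc S) ^ L \<le> T 33"
    unfolding h4_def[symmetric] using h4 S2 by (rule T_mult) simp_all
qed

end

text \<open>About 3n log(nd) bits suffice for degrees up to (nd)^(3n); the additional bit makes the
  inequality strict.\<close>

lemma log_player_bound:
  fixes n d :: nat
  assumes n: "1 \<le> n" and nd: "2 \<le> n * d" and L: "L \<le> ((n * d) ^ n) ^ 3"
  obtains l where "1 \<le> l" "L < 2 ^ l"
    "real (2 * n + 8 * (n * l)) \<le> 42 * (real n)\<^sup>2 * log 2 (real n * real d)"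
proof -
  define x where "x = real n * real d"
  have x: "2 \<le> x" using nd unfolding x_def by (metis of_nat_le_iff of_nat_mult of_nat_numeral)
  define w where "w = log 2 x"
  have lam: "1 \<le> w" using x by (simp add: w_def le_log_iff)
  define l where "l = nat \<lceil>3 * real n * w\<rceil> + 1"
  have pos: "0 \<le> 3 * real n * w" using lam by simp
  have l: "3 * real n * w + 1 \<le> real l" "real l \<le> 3 * real n * w + 2"
    using pos unfolding l_def by linarith+
  have "2 powr (3 * real n * w) = (2 powr w) powr (3 * real n)"
    by (simp add: powr_powr mult_ac)
  also have "2 powr w = x" using x by (simp add: w_def)
  also have "x powr (3 * real n) = x powr real (n * 3)" by (simp add: mult.commute)
  also have "\<dots> = x ^ (n * 3)" using x by (intro powr_realpow) simp
  also have "\<dots> = real (((n * d) ^ n) ^ 3)" by (simp add: x_def power_mult)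
  finally have "real (((n * d) ^ n) ^ 3) < 2 powr (3 * real n * w + 1)"
    using x by (simp add: powr_add x_def)
  also have "\<dots> \<le> 2 powr real l" using l by (intro powr_mono) auto
  also have "\<dots> = real (2 ^ l)" by (simp add: powr_realpow)
  finally have L2: "L < 2 ^ l" using L by (simp only: of_nat_less_iff)
  have "real n \<le> (real n)\<^sup>2" using n by (simp add: power2_eq_square)
  also have "\<dots> \<le> (real n)\<^sup>2 * w" using lam by (simp add: mult_le_cancel_left1)
  finally have n1: "real n \<le> (real n)\<^sup>2 * w" .
  have "real n * real l \<le> real n * (3 * real n * w + 2)" using l by (intro mult_left_mono) auto
  also have "\<dots> = 3 * ((real n)\<^sup>2 * w) + 2 * real n" by (simp add: power2_eq_square algebra_simps)
  \<comment> \<open>With w the logarithm, the bound is 24 n^2 w + 18 n, and n \<le> n^2 w; this is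
    the origin of 42 = 24 + 18.\<close>
  finally have "real (2 * n + 8 * (n * l)) \<le> 42 * ((real n)\<^sup>2 * w)" using n1 by simp
  then show thesis using L2 by (intro that[of l]) (auto simp: l_def w_def x_def)
qed

lemma game_for_semialgebraic_set:
  fixes n d A B :: nat and M :: real and P :: "nat \<Rightarrow> nat \<Rightarrow> int_mpoly"
  assumes n: "1 \<le> n" and B: "1 \<le> B" and d: "2 \<le> d" and M: "0 \<le> M"
    and P: "\<forall>a\<in>{1..A}. \<forall>b\<in>{1..B}. P a b \<in> bounded_polys n d M"
    and E: "E = (\<Union>a\<in>{1..A}. \<Inter>b\<in>{1..B}. {x \<in> {..<n} \<rightarrow>\<^sub>E UNIV. eval_mpoly (P a b) x \<le> 0})"
    and ne: "E \<noteq> {}" and E01: "E \<subseteq> {..<n} \<rightarrow>\<^sub>E {0..1}"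
  shows "\<exists>G N. binary_game G \<and> num_players G = N \<and> n \<le> N \<and>
    (\<forall>i<N. \<forall>s\<in>pure_profiles G. payoff G i s \<in> \<int> \<and>
      \<bar>payoff G i s\<bar> \<le> (real n * real d * (M + 1)) ^ (((n * d) ^ n) ^ 33)) \<and>
    real N \<le> real A * real B + 42 * (real n)\<^sup>2 * log 2 (real n * real d) \<and>
    (\<lambda>x. restrict x {..<n}) ` binary_nash_set G = E"
proof -
  define x where "x = n * d"
  have dx: "d \<le> x" using n by (simp add: x_def)
  then have x2: "2 \<le> x" using d by simp
  define t where "t = x ^ n"
  have xt: "x \<le> t" unfolding t_def using n x2 by (intro self_le_power) auto
  have nx: "n \<le> x" using d by (simp add: x_def)
  define \<beta>0 where "\<beta>0 = real n * real d * (M + 1)"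
  have \<beta>0: "\<beta>0 = real x * (M + 1)" by (simp add: \<beta>0_def x_def)
  have "2 * (M + 1) \<le> \<beta>0" unfolding \<beta>0 using x2 M by (intro mult_right_mono) auto
  then have bb: "2 * M + 1 \<le> \<beta>0" "2 \<le> \<beta>0" using M by auto
  interpret tower \<beta>0 t using bb(2) x2 xt by unfold_locales auto
  define m where "m = 2 * n * d + 1"
  define L where "L = m ^ n"
  have sq: "2 * x \<le> x ^ 2" "2 * x ^ 2 \<le> x ^ 3"
    using x2 by (simp_all add: power2_eq_square power3_eq_cube)
  then have mx: "m \<le> x ^ 3" using x2 unfolding m_def x_def[symmetric] by (simp add: x_def mult.assoc)
  have "L \<le> (x ^ 3) ^ n" unfolding L_def using mx by (intro power_mono) auto
  also have "(x ^ 3) ^ n = t ^ 3" by (simp add: t_def power_mult[symmetric] mult.commute)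
  finally have Lt: "L \<le> t ^ 3" .
  have "n * m \<le> t * t ^ 3"
  proof (intro mult_mono)
    show "n \<le> t" using nx xt by simp
    show "m \<le> t ^ 3" by (rule order_trans[OF mx power_mono[OF xt]]) simp
  qed simp_all
  then have nm: "n * m \<le> t ^ 4" by (simp add: eval_nat_numeral)
  have "(d + 1) ^ n \<le> (x ^ 2) ^ n" using dx sq x2 by (intro power_mono) auto
  also have "(x ^ 2) ^ n = t ^ 2" by (simp add: t_def power_mult[symmetric] mult.commute)
  finally have d1: "(d + 1) ^ n \<le> t ^ 2" .
  have "x ^ 2 \<le> t ^ 2" using xt by (rule power_mono) simp
  then have "2 * d \<le> t ^ 2" using dx sq(1) by linarith
  define H where "H = fact (m ^ n) * (1 + (1 + 2 * real d * ((2 * M + 1) ^ ((d + 1) ^ n) *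
    (real ((d + 1) ^ n) * M)^2)) ^ (n * m)) ^ m ^ n"
  have M0: "2 * M + 1 \<le> T 0" using bb by (simp add: T_def)
  have H: "H \<le> T 16" unfolding H_def
    by (rule coordinate_height_bound[OF T_nat[OF d1] d1 \<open>2 * d \<le> t ^ 2\<close> M M0 nm Lt[unfolded L_def]])
  have H0: "0 \<le> H" unfolding H_def using M by simp
  \<comment> \<open>One nonempty piece of the union is enough: it lies in \<open>E\<close>, hence in
    the unit cube, so \<open>algebraic_point\<close> applies to its constraints alone.\<close>
  obtain q where "q \<in> E" using ne by blast
  then obtain a0 where a0: "a0 \<in> {1..A}"
    and q: "q \<in> (\<Inter>b\<in>{1..B}. {x \<in> {..<n} \<rightarrow>\<^sub>E UNIV. eval_mpoly (P a0 b) x \<le> 0})"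
    unfolding E by (rule UN_E)
  have ne0: "(\<Inter>b\<in>{1..B}. {x \<in> {..<n} \<rightarrow>\<^sub>E UNIV. eval_mpoly (P a0 b) x \<le> 0}) \<noteq> {}"
    by (rule ex_in_conv[THEN iffD1, OF exI, OF q])
  have Ea: "{x \<in> {..<n} \<rightarrow>\<^sub>E UNIV. \<forall>R\<in>P a0 ` {1..B}. eval_mpoly R x \<le> 0}
      = (\<Inter>b\<in>{1..B}. {x \<in> {..<n} \<rightarrow>\<^sub>E UNIV. eval_mpoly (P a0 b) x \<le> 0})"
    using B by auto
  have EaE: "(\<Inter>b\<in>{1..B}. {x \<in> {..<n} \<rightarrow>\<^sub>E UNIV. eval_mpoly (P a0 b) x \<le> 0}) \<subseteq> E"
    unfolding E by (rule UN_upper[OF a0])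
  have Pa: "P a0 ` {1..B} \<subseteq> bounded_polys n d M" using bspec[OF P a0] by blast
  have Ea01: "{x \<in> {..<n} \<rightarrow>\<^sub>E UNIV. \<forall>R\<in>P a0 ` {1..B}. eval_mpoly R x \<le> 0} \<subseteq> {..<n} \<rightarrow>\<^sub>E {0..1}"
    unfolding Ea using EaE E01 by (rule order_trans)
  obtain p where p0: "p \<in> {x \<in> {..<n} \<rightarrow>\<^sub>E UNIV. \<forall>R\<in>P a0 ` {1..B}. eval_mpoly R x \<le> 0}"
    and root: "\<forall>j<n. \<exists>f. f \<noteq> 0 \<and> degree f \<le> L \<and> height f \<le> H \<and> rpoly f (p j) = 0"
    by (rule algebraic_point[OF M Pa ne0[folded Ea] Ea01, folded m_def, folded H_def, folded L_def])
  have p: "p \<in> E" using p0 EaE unfolding Ea by (rule rev_subsetD)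
  define good where "good j \<kappa> S \<eta> r \<longleftrightarrow> 1 \<le> S \<and> \<kappa> \<le> S \<and> real S * p j = real \<kappa> + \<eta> \<and> 0 \<le> \<eta> \<and> \<eta> \<le> 1 \<and>
    degree r \<le> L \<and> rpoly r \<eta> = 0 \<and> (\<forall>z. 0 \<le> z \<longrightarrow> z < \<eta> \<longrightarrow> rpoly r z < 0) \<and>
    (\<forall>z. \<eta> < z \<longrightarrow> z \<le> 1 \<longrightarrow> rpoly r z > 0) \<and> real S + 1 \<le> T 33 \<and> height r \<le> T 33"
    for j \<kappa> S :: nat and \<eta> r
  have "\<exists>\<kappa> S \<eta> r. good j \<kappa> S \<eta> r" if j: "j < n" for j
  proof -
    obtain f where f: "f \<noteq> 0" "degree f \<le> L" "height f \<le> H" "rpoly f (p j) = 0" using root[rule_format, OF j] by (elim exE conjE) (rule that)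
    have p01: "0 \<le> p j" "p j \<le> 1" using p E01 j by (auto simp: PiE_iff subset_iff)
    obtain k S r y where i: "k \<le> S" "1 \<le> S"
      "real S \<le> real L ^ L * H * (fact (L^2) * (1 + 2 * (real L ^ L * H)) ^ L^2) + 1"
      "0 \<le> y" "y \<le> 1" "real S * p j = real k + y"
      "degree r \<le> L" "height r \<le> real L ^ L * H * real (Suc S) ^ L" "rpoly r y = 0"
      "\<forall>z. 0 \<le> z \<longrightarrow> z < y \<longrightarrow> rpoly r z < 0" "\<forall>z. y < z \<longrightarrow> z \<le> 1 \<longrightarrow> rpoly r z > 0"
      by (rule isolate_root[OF f p01])
    have "good j k S y r"
      unfolding good_def using isolation_height_bound[OF Lt H0 H i(3)] i(8)
      by (intro conjI i) simp_all
    then show ?thesis by (intro exI)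
  qed
  then have "\<forall>j. \<exists>\<kappa> S \<eta> r. j < n \<longrightarrow> good j \<kappa> S \<eta> r" by blast
  then obtain \<kappa> S \<eta> r where good: "\<And>j. j < n \<Longrightarrow> good j (\<kappa> j) (S j) (\<eta> j) (r j)"
    by metis
  have nd: "2 \<le> n * d" using x2 by (simp add: x_def)
  obtain l where lb: "1 \<le> l" "L < 2 ^ l"
    "real (2 * n + 8 * (n * l)) \<le> 42 * (real n)\<^sup>2 * log 2 (real n * real d)"
    by (rule log_player_bound[OF n nd Lt[unfolded t_def x_def]])
  \<comment> \<open>The bits chosen for the isolating polynomials also cover the exponents of the
    given ones.\<close>
  have dL: "d < 2 ^ l"
  proof -
    have "m = 2 * x + 1" by (simp add: m_def x_def mult.assoc)
    then have "d \<le> m" using dx by linarith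
    also have "\<dots> \<le> L" unfolding L_def using n by (intro self_le_power) (auto simp: m_def)
    finally show ?thesis using lb(2) by simp
  qed
  have coeffs: "real ((d + 1) ^ n) * M \<le> T 33"
    using T_nat[OF d1] M M0 by (intro T_mult[of _ 2 _ 0]) auto
  interpret sign_game n d l A B M "T 33" P E p \<eta> \<kappa> S r
  proof
    show "E = (\<Union>a\<in>{1..A}. \<Inter>b\<in>{1..B}. {x \<in> {..<n} \<rightarrow>\<^sub>E UNIV. eval_mpoly (P a b) x \<le> 0})"
      by (rule E)
    show "1 \<le> T 33" using T_ge[of 33] by simp
    fix j assume j: "j < n"
    note g = good[OF j, unfolded good_def]
    show "1 \<le> S j" "\<kappa> j \<le> S j" "real (S j) * p j = real (\<kappa> j) + \<eta> j" "0 \<le> \<eta> j" "\<eta> j \<le> 1"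
      "rpoly (r j) (\<eta> j) = 0" "real (S j) + 1 \<le> T 33" "height (r j) \<le> T 33"
      using g by blast+
    show "degree (r j) < 2 ^ l" using g lb(2) by linarith
    show "rpoly (r j) z < 0" if "0 \<le> z" "z < \<eta> j" for z using g that by blast
    show "rpoly (r j) z > 0" if "\<eta> j < z" "z \<le> 1" for z using g that by blast
  qed (use P lb(1) dL E01 p coeffs in simp_all)
  obtain G N where G: "binary_game G" "num_players G = N" "n \<le> N"
    "\<forall>i<N. \<forall>s\<in>pure_profiles G. payoff G i s \<in> \<int> \<and> \<bar>payoff G i s\<bar> \<le> T 33"
    "N \<le> 2 * n + A * B + 8 * (n * l)" "(\<lambda>x. restrict x {..<n}) ` binary_nash_set G = E"
    using game_exists by (elim exE conjE) (rule that)
  have "real N \<le> real (A * B) + real (2 * n + 8 * (n * l))" using G(5) by linarith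
  then have "real N \<le> real A * real B + 42 * (real n)\<^sup>2 * log 2 (real n * real d)" using lb(3) by simp
  moreover have "T 33 = (real n * real d * (M + 1)) ^ (((n * d) ^ n) ^ 33)"
    by (simp only: T_def) (simp only: \<beta>0_def t_def x_def)
  ultimately show ?thesis using G by (intro exI[of _ G] exI[of _ N]) simp
qed

theorem proposition9:
  "\<exists>K :: real. \<forall>(n::nat) (A::nat) (B::nat) (d::nat) (M::real) (P :: nat \<Rightarrow> nat \<Rightarrow> int_mpoly) E.
     n \<ge> 1 \<and> A \<ge> 1 \<and> B \<ge> 1 \<and> d \<ge> 2 \<and> M \<ge> 0 \<and>
     (\<forall>a \<in> {1..A}. \<forall>b \<in> {1..B}.
        P a b \<in> polys_in_vars n \<and>
        (\<forall>i < n. degree_in i (P a b) \<le> d) \<and>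
        (\<forall>m. \<bar>real_of_int (Poly_Mapping.lookup (P a b) m)\<bar> \<le> M)) \<and>
     E = (\<Union>a \<in> {1..A}. \<Inter>b \<in> {1..B}. {x \<in> {..<n} \<rightarrow>\<^sub>E UNIV. eval_mpoly (P a b) x \<le> 0}) \<and>
     E \<noteq> {} \<and> E \<subseteq> ({..<n} \<rightarrow>\<^sub>E {0..1})
     \<longrightarrow> (\<exists>G N. binary_game G \<and> num_players G = N \<and> n \<le> N \<and>
           (\<forall>i < N. \<forall>s \<in> pure_profiles G.
              payoff G i s \<in> \<int> \<and>
              \<bar>payoff G i s\<bar> \<le> (real n * real d * (M + 1)) powr ((real n * real d) powr (K * real n))) \<and>
           real N \<le> 1 + real A * real B + K * (real n)\<^sup>2 * log 2 (real n * real d) \<and>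
           (\<lambda>x. restrict x {..<n}) ` binary_nash_set G = E)"
\<comment> \<open>The player count dictates 42; the payoff bound, obtained with 33 in the exponent,
  is weakened to the same constant.\<close>
proof (intro exI[of _ "42::real"] allI impI, elim conjE)
  fix n A B d :: nat and M :: real and P :: "nat \<Rightarrow> nat \<Rightarrow> int_mpoly" and E
  assume n: "1 \<le> n" and B: "1 \<le> B" and d: "2 \<le> d" and M: "0 \<le> M"
    and P: "\<forall>a \<in> {1..A}. \<forall>b \<in> {1..B}. P a b \<in> polys_in_vars n \<and> (\<forall>i < n. degree_in i (P a b) \<le> d) \<and>
        (\<forall>m. \<bar>real_of_int (Poly_Mapping.lookup (P a b) m)\<bar> \<le> M)"
    and E: "E = (\<Union>a \<in> {1..A}. \<Inter>b \<in> {1..B}. {x \<in> {..<n} \<rightarrow>\<^sub>E UNIV. eval_mpoly (P a b) x \<le> 0})"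
    and ne: "E \<noteq> {}" and E01: "E \<subseteq> ({..<n} \<rightarrow>\<^sub>E {0..1})"
  have P': "\<forall>a\<in>{1..A}. \<forall>b\<in>{1..B}. P a b \<in> bounded_polys n d M"
    using P by (simp add: bounded_polys_def)
  obtain G N where G: "binary_game G" "num_players G = N" "n \<le> N"
    "\<forall>i<N. \<forall>s\<in>pure_profiles G. payoff G i s \<in> \<int> \<and>
      \<bar>payoff G i s\<bar> \<le> (real n * real d * (M + 1)) ^ (((n * d) ^ n) ^ 33)"
    "real N \<le> real A * real B + 42 * (real n)\<^sup>2 * log 2 (real n * real d)"
    "(\<lambda>x. restrict x {..<n}) ` binary_nash_set G = E"
    using game_for_semialgebraic_set[OF n B d M P' E ne E01] by (elim exE conjE) (rule that)
  define x where "x = real n * real d"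
  have "2 \<le> n * d" using mult_le_mono[OF n d] by simp
  then have x: "2 \<le> x" unfolding x_def by (metis of_nat_le_iff of_nat_mult of_nat_numeral)
  have base: "1 \<le> x * (M + 1)" using mult_mono[of 1 x 1 "M + 1"] x M by simp
  have "x powr (42 * real n) = x ^ (42 * n)"
    using x powr_realpow[of x "42 * n"] by simp
  also have "\<dots> = real (((n * d) ^ n) ^ 42)" by (simp add: x_def power_mult[symmetric] mult.commute)
  finally have e: "x powr (42 * real n) = real (((n * d) ^ n) ^ 42)" .
  have "(x * (M + 1)) ^ (((n * d) ^ n) ^ 33) \<le> (x * (M + 1)) ^ (((n * d) ^ n) ^ 42)"
  proof (intro power_increasing base)
    have "1 \<le> n * d" using \<open>2 \<le> n * d\<close> by linarith
    then have "1 \<le> (n * d) ^ n" by (rule one_le_power)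
    then show "1 \<le> (n * d) ^ n" .
  qed simp
  also have "\<dots> = (x * (M + 1)) powr (x powr (42 * real n))"
    unfolding e using base by (intro powr_realpow[symmetric]) simp
  finally have "(real n * real d * (M + 1)) ^ (((n * d) ^ n) ^ 33)
      \<le> (real n * real d * (M + 1)) powr ((real n * real d) powr (42 * real n))"
    by (simp only: x_def)
  then have "\<forall>i<N. \<forall>s\<in>pure_profiles G. payoff G i s \<in> \<int> \<and>
      \<bar>payoff G i s\<bar> \<le> (real n * real d * (M + 1)) powr ((real n * real d) powr (42 * real n))"
    using G(4) by (meson order_trans)
  then show "\<exists>G N. binary_game G \<and> num_players G = N \<and> n \<le> N \<and>
           (\<forall>i < N. \<forall>s \<in> pure_profiles G.
              payoff G i s \<in> \<int> \<and>
              \<bar>payoff G i s\<bar> \<le> (real n * real d * (M + 1)) powr ((real n * real d) powr (42 * real n))) \<and>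
           real N \<le> 1 + real A * real B + 42 * (real n)\<^sup>2 * log 2 (real n * real d) \<and>
           (\<lambda>x. restrict x {..<n}) ` binary_nash_set G = E"
    using G by (intro exI[of _ G] exI[of _ N]) simp
qed

end
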